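(* Let $\Omega\subset\mathbb{C}$ be a bounded simply connected domain and $a,b\in L_\infty(\Omega;\mathbb{B})$. For every $z\in\Omega$ there exist functions $K_z,L_z\in\mathcal{A}_{(a,b)}^2(\Omega;\mathbb{B})$ such that $$\operatorname{Sc}W(z)=\langle W,K_z\rangle_{L_2(\Omega;\mathbb{B})},\qquad \operatorname{Vec}W(z)=\langle W,L_z\rangle_{L_2(\Omega;\mathbb{B})}\qquad\text{for all } W\in\mathcal{A}_{(a,b)}^2(\Omega;\mathbb{B}).$$ Moreover, setting for $A\in\mathbb{B}$ and $z,\zeta\in\Omega$ $$\mathscr{K}_\Omega^{(a,b)}(A;z,\zeta):=\operatorname{Sc}(A)\,K_\zeta(z)+\operatorname{Vec}(A)\,L_\zeta(z),$$ the following reproducing property holds for every $W\in\mathcal{A}_{(a,b)}^2(\Omega;\mathbb{B})$ and every $z\in\Omega$: $$W(z)=\iint_\Omega\mathscr{K}_\Omega^{(a,b)}(W(\zeta);z,\zeta)\,dA_\zeta.$$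
   Context: $\mathbb{B}=\{u+\mathbf{j}v : u,v\in\mathbb{C}\}$ is the commutative $\mathbb{C}$-algebra of bicomplex numbers, with $\mathbf{j}^2=-1$ and $i\mathbf{j}=\mathbf{j}i$. For $W=u+\mathbf{j}v$: $\operatorname{Sc}W=u$, $\operatorname{Vec}W=v$, $\overline{W}=u-\mathbf{j}v$. With $^*$ the complex conjugation, $\langle W,V\rangle_{\mathbb{B}}=(\operatorname{Sc}W)(\operatorname{Sc}V)^*+(\operatorname{Vec}W)(\operatorname{Vec}V)^*$. A function $F:\Omega\to\mathbb{B}$ belongs to $\mathscr{F}(\Omega;\mathbb{B})$ (for a space $\mathscr{F}(\Omega)$ of complex-valued functions) iff $\operatorname{Sc}F,\operatorname{Vec}F\in\mathscr{F}(\Omega)$. $\langle F,G\rangle_{L_2(\Omega;\mathbb{B})}=\iint_\Omega\langle F(z),G(z)\rangle_{\mathbb{B}}\,dA_z$. With $z=x+iy$, $\overline{\boldsymbol{\partial}}=\frac12\left(\frac{\partial}{\partial x}+\mathbf{j}\frac{\partial}{\partial y}\right)$. A function $V\in L_{1,loc}(\Omega;\mathbb{B})$ is the weak $\overline{\boldsymbol{\partial}}$-derivative of $W\in L_2(\Omega;\mathbb{B})$ if $\iint_\Omega W\,\overline{\boldsymbol{\partial}}\phi\,dA=-\iint_\Omega V\phi\,dA$ for all $\phi\in C_0^\infty(\Omega;\mathbb{B})$. $\mathcal{A}_{(a,b)}^2(\Omega;\mathbb{B})$ is the set of all weak solutions $W\in L_2(\Omega;\mathbb{B})$ of $\overline{\boldsymbol{\partial}}W=aW+b\overline{W}$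 in $\Omega$. Every such $W$ has a continuous representative in $\Omega$, and $W(z)$ denotes its value. *)

theory Defs
  imports "HOL-Analysis.Analysis"
begin

section \<open>Bicomplex numbers\<close>

text \<open>
  The bicomplex number u + j v is the pair (u, v). This inherits the complex-componentwise
  addition and, as norm, the Euclidean norm of \<open>\<complex> \<times> \<complex>\<close>; only the product is new.
\<close>

type_synonym bicomplex = "complex \<times> complex"

abbreviation Sc :: "bicomplex \<Rightarrow> complex" where "Sc \<equiv> fst"
abbreviation Vec :: "bicomplex \<Rightarrow> complex" where "Vec \<equiv> snd"

definition bc_mult :: "bicomplex \<Rightarrow> bicomplex \<Rightarrow> bicomplex"  (infixl \<open>\<odot>\<close> 70) where
  "W \<odot> V = (Sc W * Sc V - Vec W * Vec V, Sc W * Vec V + Vec W * Sc V)"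

definition bc_of_complex :: "complex \<Rightarrow> bicomplex" where
  "bc_of_complex u = (u, 0)"

definition bc_j :: bicomplex where
  "bc_j = (0, 1)"

definition bc_cnj :: "bicomplex \<Rightarrow> bicomplex" where
  "bc_cnj W = (Sc W, - Vec W)"

definition bc_inner :: "bicomplex \<Rightarrow> bicomplex \<Rightarrow> complex" where
  "bc_inner W V = Sc W * cnj (Sc V) + Vec W * cnj (Vec V)"

section \<open>Function spaces\<close>

text \<open>
  Elements of the Lebesgue spaces are represented by total functions; only the values on
  \<open>\<Omega>\<close>, up to null sets, are relevant.
\<close>

definition L1_loc :: "complex set \<Rightarrow> (complex \<Rightarrow> complex) set" where
  "L1_loc \<Omega> = {f. \<forall>K. compact K \<and> K \<subseteq> \<Omega> \<longrightarrow> integrable (lebesgue_on K) f}"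

definition L2_space :: "complex set \<Rightarrow> (complex \<Rightarrow> complex) set" where
  "L2_space \<Omega> = {f \<in> borel_measurable (lebesgue_on \<Omega>).
                   integrable (lebesgue_on \<Omega>) (\<lambda>z. (cmod (f z))\<^sup>2)}"

definition Linf_space :: "complex set \<Rightarrow> (complex \<Rightarrow> complex) set" where
  "Linf_space \<Omega> = {f \<in> borel_measurable (lebesgue_on \<Omega>).
                     \<exists>C. AE z in lebesgue_on \<Omega>. cmod (f z) \<le> C}"

definition partial_x :: "(complex \<Rightarrow> 'a::real_normed_vector) \<Rightarrow> complex \<Rightarrow> 'a" where
  "partial_x f z = vector_derivative (\<lambda>t. f (z + of_real t)) (at 0)"

definition partial_y :: "(complex \<Rightarrow> 'a::real_normed_vector) \<Rightarrow> complex \<Rightarrow> 'a" where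
  "partial_y f z = vector_derivative (\<lambda>t. f (z + \<i> * of_real t)) (at 0)"

text \<open>Here differentiability is over the reals.\<close>

primrec C_times :: "nat \<Rightarrow> (complex \<Rightarrow> 'a::real_normed_vector) \<Rightarrow> bool" where
  "C_times 0 f \<longleftrightarrow> continuous_on UNIV f"
| "C_times (Suc n) f \<longleftrightarrow>
     (\<forall>z. f differentiable (at z)) \<and> C_times n (partial_x f) \<and> C_times n (partial_y f)"

definition test_functions :: "complex set \<Rightarrow> (complex \<Rightarrow> complex) set" where
  "test_functions \<Omega> = {f. (\<forall>n. C_times n f) \<and>
     compact (closure {z. f z \<noteq> 0}) \<and> closure {z. f z \<noteq> 0} \<subseteq> \<Omega>}"

definition bc_space :: "(complex \<Rightarrow> complex) set \<Rightarrow> (complex \<Rightarrow> bicomplex) set" where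
  "bc_space S = {F. (\<lambda>z. Sc (F z)) \<in> S \<and> (\<lambda>z. Vec (F z)) \<in> S}"

definition L2_inner ::
  "complex set \<Rightarrow> (complex \<Rightarrow> bicomplex) \<Rightarrow> (complex \<Rightarrow> bicomplex) \<Rightarrow> complex" where
  "L2_inner \<Omega> F G = (LINT z|lebesgue_on \<Omega>. bc_inner (F z) (G z))"

section \<open>The bicomplex Vekua equation and its Bergman space\<close>

definition dbar :: "(complex \<Rightarrow> bicomplex) \<Rightarrow> complex \<Rightarrow> bicomplex" where
  "dbar \<phi> z = (1/2) *\<^sub>R (partial_x \<phi> z + bc_j \<odot> partial_y \<phi> z)"

definition is_weak_dbar ::
  "complex set \<Rightarrow> (complex \<Rightarrow> bicomplex) \<Rightarrow> (complex \<Rightarrow> bicomplex) \<Rightarrow> bool" where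
  "is_weak_dbar \<Omega> W V \<longleftrightarrow> W \<in> bc_space (L2_space \<Omega>) \<and> V \<in> bc_space (L1_loc \<Omega>) \<and>
     (\<forall>\<phi> \<in> bc_space (test_functions \<Omega>).
        (LINT z|lebesgue_on \<Omega>. W z \<odot> dbar \<phi> z) = - (LINT z|lebesgue_on \<Omega>. V z \<odot> \<phi> z))"

definition vekua_bergman ::
  "complex set \<Rightarrow> (complex \<Rightarrow> bicomplex) \<Rightarrow> (complex \<Rightarrow> bicomplex) \<Rightarrow> (complex \<Rightarrow> bicomplex) set" where
  "vekua_bergman \<Omega> a b = {W \<in> bc_space (L2_space \<Omega>).
     is_weak_dbar \<Omega> W (\<lambda>z. a z \<odot> W z + b z \<odot> bc_cnj (W z))}"

text \<open>
  For open \<open>\<Omega>\<close> the continuous representative is unique on \<open>\<Omega>\<close>; outside \<open>\<Omega>\<close> the chosen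
  function is arbitrary and must not be evaluated.
\<close>

definition cont_rep :: "complex set \<Rightarrow> (complex \<Rightarrow> bicomplex) \<Rightarrow> complex \<Rightarrow> bicomplex" where
  "cont_rep \<Omega> W = (SOME V. continuous_on \<Omega> V \<and> (AE z in lebesgue_on \<Omega>. V z = W z))"

definition is_Sc_kernel ::
  "complex set \<Rightarrow> (complex \<Rightarrow> bicomplex) \<Rightarrow> (complex \<Rightarrow> bicomplex) \<Rightarrow> complex \<Rightarrow>
     (complex \<Rightarrow> bicomplex) \<Rightarrow> bool" where
  "is_Sc_kernel \<Omega> a b z k \<longleftrightarrow> k \<in> vekua_bergman \<Omega> a b \<and>
     (\<forall>W \<in> vekua_bergman \<Omega> a b. Sc (cont_rep \<Omega> W z) = L2_inner \<Omega> W k)"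

definition is_Vec_kernel ::
  "complex set \<Rightarrow> (complex \<Rightarrow> bicomplex) \<Rightarrow> (complex \<Rightarrow> bicomplex) \<Rightarrow> complex \<Rightarrow>
     (complex \<Rightarrow> bicomplex) \<Rightarrow> bool" where
  "is_Vec_kernel \<Omega> a b z l \<longleftrightarrow> l \<in> vekua_bergman \<Omega> a b \<and>
     (\<forall>W \<in> vekua_bergman \<Omega> a b. Vec (cont_rep \<Omega> W z) = L2_inner \<Omega> W l)"

definition bergman_kernel ::
  "complex set \<Rightarrow> (complex \<Rightarrow> complex \<Rightarrow> bicomplex) \<Rightarrow> (complex \<Rightarrow> complex \<Rightarrow> bicomplex) \<Rightarrow>
     bicomplex \<Rightarrow> complex \<Rightarrow> complex \<Rightarrow> bicomplex" where
  "bergman_kernel \<Omega> K L A z \<zeta> =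
     bc_of_complex (Sc A) \<odot> cont_rep \<Omega> (K \<zeta>) z + bc_of_complex (Vec A) \<odot> cont_rep \<Omega> (L \<zeta>) z"

end

theory Submission
  imports Defs
begin

text \<open>
  Testing the weak equation against a smooth cutoff \<open>\<chi>\<close> times the regularised kernel
  \<open>conj w / (\<bar>w\<bar>\<^sup>2 + e\<^sup>2)\<close>, whose \<open>dbar\<close>-derivative is the approximate identity
  \<open>e\<^sup>2 / (\<bar>w\<bar>\<^sup>2 + e\<^sup>2)\<^sup>2\<close>, and letting \<open>e\<close> tend to 0 expresses \<open>\<chi> W\<close> almost everywhere as the
  Cauchy transform of a function dominated by \<open>\<bar>W\<bar>\<close>. Used twice on shrinking discs this bounds \<open>W\<close> by
  its \<open>L2\<close> norm, because the composition of two kernels \<open>1/\<bar>w\<bar>\<close> is locally square integrable; used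
  once more, on a bounded function, it yields a continuous representative and bounded point
  evaluations. Bounded point evaluations and Fatou's lemma make the Bergman space complete, so the
  kernels exist by the Riesz argument, and the reproducing property is the conjugate symmetry of
  the kernels.
\<close>

section \<open>Approximate identities on the plane\<close>

text \<open>The obstacle is borderline: in the plane \<open>|w| powr (-2)\<close> is not locally
  integrable, so one application of the kernel \<open>1/|w|\<close> to a square integrable function
  need not be bounded. The exponent \<open>-3/2\<close> recurs because one exponent between 1 and 2
  dominates every singularity that occurs and leaves room: half a power beyond the kernel pays for
  the factor \<open>sqrt e\<close> in the regularisation error, or for
  \<open>|z - \<eta>| powr (-1/2)\<close> in the composition. No integration by parts is carried
  out: the weak equation, applied to an explicitly differentiated test function, is already the
  identity wanted, so the work lies in showing that this function is smooth. Every local constant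
  depends on the disc and the coefficients alone; this independence of \<open>W\<close> turns
  interior regularity into bounded point evaluations. In the reproducing formula the kernels at
  different points are chosen independently, so measurability in \<open>\<zeta>\<close> is not
  evident; conjugate symmetry supplies it by rewriting the integrand through the two fixed kernels
  at \<open>z\<close>.\<close>

lemma nn_integral_lborel_affine:
  fixes f :: "'a::euclidean_space \<Rightarrow> ennreal"
  assumes [measurable]: "f \<in> borel_measurable borel" and c: "c \<noteq> 0"
  shows "(\<integral>\<^sup>+x. f x \<partial>lborel) = ennreal (\<bar>c\<bar> ^ DIM('a)) * (\<integral>\<^sup>+x. f (t + c *\<^sub>R x) \<partial>lborel)"
  by (subst lborel_affine[OF c, of t])
     (simp add: nn_integral_density nn_integral_distr nn_integral_cmult)

lemma integrable_lborel_affine: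
  fixes f :: "'a::euclidean_space \<Rightarrow> 'b::{banach, second_countable_topology}"
  assumes f: "integrable lborel f" and c: "c \<noteq> 0"
  shows "integrable lborel (\<lambda>x. f (t + c *\<^sub>R x))"
proof -
  have [measurable]: "f \<in> borel_measurable borel" using f by auto
  have "ennreal (\<bar>c\<bar> ^ DIM('a)) * (\<integral>\<^sup>+x. ennreal (norm (f (t + c *\<^sub>R x))) \<partial>lborel) < \<infinity>"
    using f nn_integral_lborel_affine[of "\<lambda>x. ennreal (norm (f x))" c t] c
    unfolding integrable_iff_bounded by simp
  moreover have "0 < \<bar>c\<bar> ^ DIM('a)" using c by simp
  ultimately have "(\<integral>\<^sup>+x. ennreal (norm (f (t + c *\<^sub>R x))) \<partial>lborel) < \<infinity>"
    by (auto simp: ennreal_mult_less_top)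
  then show ?thesis unfolding integrable_iff_bounded by simp
qed

lemma integral_lborel_affine:
  fixes f :: "'a::euclidean_space \<Rightarrow> 'b::{banach, second_countable_topology}"
  assumes f: "integrable lborel f" and c: "c \<noteq> 0"
  shows "(\<integral>x. f x \<partial>lborel) = \<bar>c\<bar> ^ DIM('a) *\<^sub>R (\<integral>x. f (t + c *\<^sub>R x) \<partial>lborel)"
  using c f f[THEN borel_measurable_integrable] integrable_lborel_affine[OF f c, of t]
  by (subst lborel_affine[OF c, of t]) (simp add: integral_density integral_distr)

lemma nn_integral_reflect:
  fixes f :: "'a::euclidean_space \<Rightarrow> ennreal"
  assumes "f \<in> borel_measurable borel"
  shows "(\<integral>\<^sup>+x. f (z - x) \<partial>lborel) = (\<integral>\<^sup>+x. f x \<partial>lborel)"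
  using nn_integral_lborel_affine[OF assms, of "-1" z] by simp

text \<open>Dynkin's argument: boxes form an intersection-stable generator of the Borel sets, and
  the sets of vanishing integral are closed under complements, thanks to the vanishing total
  integral \<open>UN\<close>, and under countable disjoint unions.\<close>

lemma set_integral_eq_0_if_integral_box_0:
  fixes f :: "'a::euclidean_space \<Rightarrow> 'b::{banach, second_countable_topology}"
  assumes int: "integrable lborel f" and zero: "\<And>a b. set_lebesgue_integral lborel (box a b) f = 0"
    and UN: "integral\<^sup>L lborel f = 0"
    and A0: "A \<in> sets borel"
  shows "set_lebesgue_integral lborel A f = 0"
proof -
  have sb: "sets (borel :: 'a measure) = sigma_sets UNIV (range (\<lambda>(a, b). box a b))"
    by (subst borel_eq_box) (rule sets_measure_of, simp)
  define P where "P A \<longleftrightarrow> set_lebesgue_integral lborel A f = 0" for A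
  have Sint: "set_integrable lborel A f" if "A \<in> sets borel" for A
    unfolding set_integrable_def using that by (intro integrable_mult_indicator int) simp
  have I: "Int_stable (range (\<lambda>(a, b). box a b :: 'a set))"
  proof (rule Int_stableI)
    fix A B :: "'a set"
    assume "A \<in> range (\<lambda>(a, b). box a b)" "B \<in> range (\<lambda>(a, b). box a b)"
    then obtain a b c d where AB: "A = box a b" "B = box c d" by auto
    show "A \<inter> B \<in> range (\<lambda>(a, b). box a b)" unfolding AB box_Int_box
      by (intro range_eqI[where x="(_, _)"]) simp
  qed
  have "P A"
  proof (rule sigma_sets_induct_disjoint[OF I _ A0[unfolded sb]])
    show "range (\<lambda>(a, b). box a b :: 'a set) \<subseteq> Pow UNIV" by simp
    show "P S" if "S \<in> range (\<lambda>(a, b). box a b)" for S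
      using that zero by (auto simp: P_def)
    show "P {}" by (simp add: P_def set_lebesgue_integral_def)
    show "P (UNIV - S)" if S: "S \<in> sigma_sets UNIV (range (\<lambda>(a, b). box a b))" "P S" for S
    proof -
      have SB: "S \<in> sets borel" using S(1) unfolding sb .
      have "set_lebesgue_integral lborel (S \<union> (UNIV - S)) f
          = set_lebesgue_integral lborel S f + set_lebesgue_integral lborel (UNIV - S) f"
        by (intro set_integral_Un Sint) (use SB in auto)
      then show ?thesis using S(2) UN by (simp add: P_def set_lebesgue_integral_def)
    qed
    show "P (\<Union>i. S i)" if S: "disjoint_family S"
        "range S \<subseteq> sigma_sets UNIV (range (\<lambda>(a, b). box a b))" "\<And>i. P (S i)" for S :: "nat \<Rightarrow> 'a set"
    proof -
      have SB: "S i \<in> sets borel" for i using S(2) unfolding sb by auto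
      have dj: "S i \<inter> S j = {}" if "i \<noteq> j" for i j
        using S(1) that unfolding disjoint_family_on_def by blast
      have SU: "set_integrable lborel (\<Union>i. S i) f" by (rule Sint) (use SB in blast)
      have "set_lebesgue_integral lborel (\<Union>i. S i) f = (\<Sum>i. set_lebesgue_integral lborel (S i) f)"
        by (rule lebesgue_integral_countable_add[OF _ dj SU]) (use SB in simp_all)
      then show ?thesis using S(3) by (simp add: P_def)
    qed
  qed
  then show ?thesis by (simp add: P_def)
qed

text \<open>Truncating \<open>f\<close> to a fixed box makes it integrable, and since two boxes meet
  in a box the truncation still has zero integral over every box. Countably many boxes exhaust the
  space.\<close>

lemma AE_eq_0_if_integral_box_0:
  fixes f :: "'a::euclidean_space \<Rightarrow> 'b::{banach, second_countable_topology}"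
  assumes int: "\<And>a b. integrable lborel (\<lambda>x. indicator (box a b) x *\<^sub>R f x)"
    and zero: "\<And>a b. (\<integral>x. indicator (box a b) x *\<^sub>R f x \<partial>lborel) = 0"
  shows "AE x in lborel. f x = 0"
proof -
  have "AE x in lborel. indicator (box c d) x *\<^sub>R f x = 0" for c d
  proof (rule sigma_finite_measure.density_zero[OF lborel.sigma_finite_measure_axioms])
    show "set_lebesgue_integral lborel A (\<lambda>x. indicator (box c d) x *\<^sub>R f x) = 0"
      if "A \<in> sets lborel" for A
    proof (rule set_integral_eq_0_if_integral_box_0)
      show "set_lebesgue_integral lborel (box a b) (\<lambda>x. indicator (box c d) x *\<^sub>R f x) = 0" for a b
      proof -
        have "\<exists>p q. box a b \<inter> box c d = box p q" by (intro exI) (rule box_Int_box)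
        then obtain p q where pq: "box a b \<inter> box c d = box p q" by blast
        have "indicat_real (box a b) x *\<^sub>R indicat_real (box c d) x *\<^sub>R f x = indicator (box p q) x *\<^sub>R f x" for x
          unfolding pq[symmetric] by (auto simp: indicator_def)
        then show ?thesis unfolding set_lebesgue_integral_def by (simp only: zero)
      qed
    qed (use int zero that in auto)
  qed (rule int)
  then have "AE x in lborel. \<forall>n::nat. indicator (box (- (real n *\<^sub>R One)) (real n *\<^sub>R One)) x *\<^sub>R f x = 0"
    by (subst AE_all_countable) blast
  then show ?thesis
  proof eventually_elim
    case (elim x)
    have "x \<in> (\<Union>i::nat. box (- (real i *\<^sub>R One)) (real i *\<^sub>R One))" by (simp add: UN_box_eq_UNIV)
    then obtain n :: nat where "x \<in> box (- (real n *\<^sub>R One)) (real n *\<^sub>R One)" by (rule UN_E)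
    with elim[rule_format, of n] show ?case by simp
  qed
qed

section \<open>Dyadic estimates for a local singularity and for decay at infinity\<close>

lemma emeasure_cball_complex:
  "0 \<le> r \<Longrightarrow> emeasure lborel (cball (z::complex) r) = ennreal (pi * r ^ 2)"
  by (simp add: emeasure_cball unit_ball_vol_2)

lemma ennreal_le_suminf: "f k \<le> (\<Sum>k. f k :: ennreal)"
  using sum_le_suminf[of f "{k}"] by simp

lemma summable_geometric_shift: "\<bar>c\<bar> < 1 \<Longrightarrow> summable (\<lambda>n. K * c ^ n :: real)"
  by (intro summable_mult summable_geometric) simp

text \<open>Dyadic annuli: on \<open>2 powr (-k-1) < \<bar>w\<bar> \<le> 2 powr (-k)\<close> the integrand is at most
  \<open>2 powr (3/2 * (k+1))\<close>, while the area decays like \<open>4 powr (-k)\<close>.\<close>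
lemma nn_integral_singular_kernel:
  "(\<integral>\<^sup>+w. ennreal (indicator (cball 0 1) w * cmod w powr (-3/2)) \<partial>lborel) < \<infinity>"
proof -
  let ?q = "2 powr (3/2) :: real"
  let ?g = "\<lambda>k w. ennreal (?q ^ Suc k) * indicator (cball 0 ((1/2) ^ k)) (w::complex)"
  have pt: "ennreal (indicator (cball 0 1) w * cmod w powr (-3/2)) \<le> (\<Sum>k. ?g k w)" for w
  proof (cases "w \<noteq> 0 \<and> cmod w \<le> 1")
    case True
    then have "\<exists>k. (1/2::real) ^ k < cmod w" by (intro real_arch_pow_inv) auto
    define n where "n = (LEAST k. (1/2::real) ^ k < cmod w)"
    have n: "(1/2::real) ^ n < cmod w" unfolding n_def by (rule LeastI_ex) fact
    have "n \<noteq> 0" using n True by (auto intro: Nat.gr0I)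
    then obtain k where k: "n = Suc k" using not0_implies_Suc by blast
    then have "\<not> (1/2::real) ^ k < cmod w" using not_less_Least[of k "\<lambda>k. (1/2::real) ^ k < cmod w"] by (simp flip: n_def)
    then have "w \<in> cball 0 ((1/2) ^ k)" by simp
    have "cmod w powr (-3/2) \<le> ((1/2::real) ^ n) powr (-3/2)"
      using n by (intro powr_mono2') auto
    also have "\<dots> = ?q ^ n"
    proof -
      have "(1/2::real) ^ n = 2 powr (- real n)"
        by (simp add: powr_minus powr_realpow power_one_over inverse_eq_divide)
      moreover have "?q ^ n = ?q powr real n" by (rule powr_realpow[symmetric]) simp
      ultimately show ?thesis by (simp add: powr_powr mult.commute[of 3 "real n"])
    qed
    finally have "cmod w powr (-3/2) \<le> ?q ^ Suc k" using k by simp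
    then have "ennreal (indicator (cball 0 1) w * cmod w powr (-3/2)) \<le> ?g k w"
      using \<open>w \<in> _\<close> True by (simp add: ennreal_leI)
    also have "\<dots> \<le> (\<Sum>k. ?g k w)"
      by (rule ennreal_le_suminf[of "\<lambda>k. ?g k w"])
    finally show ?thesis .
  qed auto
  have "(\<integral>\<^sup>+w. ennreal (indicator (cball 0 1) w * cmod w powr (-3/2)) \<partial>lborel) \<le> (\<integral>\<^sup>+w. (\<Sum>k. ?g k w) \<partial>lborel)"
    by (intro nn_integral_mono pt)
  also have "\<dots> = (\<Sum>k. \<integral>\<^sup>+w. ?g k w \<partial>lborel)" by (rule nn_integral_suminf) (intro borel_measurable_times_ennreal borel_measurable_const borel_measurable_indicator, simp)
  also have "\<dots> = (\<Sum>k. ennreal (?q * pi * (?q / 4) ^ k))"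
  proof (rule suminf_cong)
    fix k
    have "(\<integral>\<^sup>+w. ?g k w \<partial>lborel) = ennreal (?q ^ Suc k) * ennreal (pi * ((1/2) ^ k)\<^sup>2)"
      by (simp add: nn_integral_cmult_indicator emeasure_cball_complex)
    also have "\<dots> = ennreal (?q ^ Suc k * (pi * ((1/2) ^ k)\<^sup>2))"
      by (rule ennreal_mult[symmetric]) auto
    also have "?q ^ Suc k * (pi * ((1/2) ^ k)\<^sup>2) = ?q * pi * (?q / 4) ^ k"
      by (simp add: power_divide power_mult[symmetric] mult.commute[of k 2] power_mult[of 2 2])
    finally show "(\<integral>\<^sup>+w. ?g k w \<partial>lborel) = ennreal (?q * pi * (?q / 4) ^ k)" .
  qed
  also have "\<dots> < \<infinity>"
  proof -
    have "?q < 2 powr 2" by (rule powr_less_mono) auto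
    then have "\<bar>?q / 4\<bar> < 1" by simp
    then have "summable (\<lambda>k. ?q * pi * (?q / 4) ^ k)" by (rule summable_geometric_shift)
    then show ?thesis by (subst suminf_ennreal2) auto
  qed
  finally show ?thesis .
qed

text \<open>Up to a factor, the area density \<open>1 / (1 + |w|^2)^2\<close> of stereographic
  projection, dilated to scale \<open>e\<close> so that the total mass is kept.\<close>

definition approx_delta :: "real \<Rightarrow> complex \<Rightarrow> real" where
  "approx_delta e w = e\<^sup>2 / ((cmod w)\<^sup>2 + e\<^sup>2)\<^sup>2"

lemma approx_delta_nonneg [simp]: "0 \<le> approx_delta e w"
  by (simp add: approx_delta_def)

lemma approx_delta_pos: "e > 0 \<Longrightarrow> 0 < approx_delta e w"
  unfolding approx_delta_def by (intro divide_pos_pos zero_less_power add_nonneg_pos) auto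

lemma measurable_approx_delta [measurable]: "approx_delta e \<in> borel_measurable borel"
  unfolding approx_delta_def by measurable

lemma approx_delta_scale:
  assumes "e > 0" shows "approx_delta e (e *\<^sub>R w) = approx_delta 1 w / e\<^sup>2"
proof -
  have "(cmod (e *\<^sub>R w))\<^sup>2 + e\<^sup>2 = e\<^sup>2 * ((cmod w)\<^sup>2 + 1)"
    by (simp add: power_mult_distrib algebra_simps)
  then show ?thesis using assms by (simp add: approx_delta_def power_mult_distrib power2_eq_square)
qed

lemma approx_delta_bound:
  assumes "e > 0" shows "approx_delta e w \<le> 1 / e\<^sup>2"
proof -
  have "(e\<^sup>2)\<^sup>2 \<le> ((cmod w)\<^sup>2 + e\<^sup>2)\<^sup>2" by (intro power_mono) auto
  then show ?thesis using assms unfolding approx_delta_def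
    by (intro frac_le_eq[THEN iffD2] divide_left_mono) (auto simp: divide_simps power2_eq_square[of "e\<^sup>2"] add_nonneg_eq_0_iff mult_ac)
qed

text \<open>Decay like \<open>|w|^(-4)\<close> beats area growth like \<open>|w|^2\<close>. With
  \<open>n\<close> the least exponent such that \<open>|w| < 2 ^ n\<close>, the density is at most
  \<open>16 * (1/16) ^ n\<close>, the 16 paying for the step from \<open>n\<close> to
  \<open>n - 1\<close> in the lower bound for \<open>|w|\<close>; the areas leave a geometric series
  of ratio 1/4.\<close>

lemma nn_integral_approx_delta: "(\<integral>\<^sup>+w. ennreal (approx_delta 1 w) \<partial>lborel) < \<infinity>"
proof -
  let ?g = "\<lambda>k w. ennreal (16 * (1/16) ^ k) * indicator (cball 0 (2 ^ k)) (w::complex)"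
  have pt: "ennreal (approx_delta 1 w) \<le> (\<Sum>k. ?g k w)" for w
  proof -
    have ex: "\<exists>k. cmod w < (2::real) ^ k" by (rule real_arch_pow) simp
    define n where "n = (LEAST k. cmod w < (2::real) ^ k)"
    have n: "cmod w < (2::real) ^ n" unfolding n_def by (rule LeastI_ex) fact
    have "approx_delta 1 w \<le> 16 * (1/16) ^ n"
    proof (cases n)
      case 0
      then show ?thesis using approx_delta_bound[of 1 w] by simp
    next
      case (Suc k)
      then have "2 ^ k \<le> cmod w" using not_less_Least[of k "\<lambda>k. cmod w < (2::real) ^ k"] by (simp add: not_less flip: n_def)
      then have "((2 ^ k)\<^sup>2)\<^sup>2 \<le> ((cmod w)\<^sup>2 + 1)\<^sup>2"
        by (intro power_mono) (auto intro: order_trans[OF power_mono])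
      then have "approx_delta 1 w \<le> 1 / ((2 ^ k)\<^sup>2)\<^sup>2"
        unfolding approx_delta_def by (intro frac_le) auto
      also have "((2 ^ k)\<^sup>2)\<^sup>2 = (16::real) ^ k"
        by (simp add: power_mult[symmetric] mult.commute[of k] power_mult)
      finally show ?thesis using Suc by (simp add: power_divide)
    qed
    then have "ennreal (approx_delta 1 w) \<le> ?g n w" using n by (simp add: ennreal_leI)
    also have "\<dots> \<le> (\<Sum>k. ?g k w)"
      by (rule ennreal_le_suminf[of "\<lambda>k. ?g k w"])
    finally show ?thesis .
  qed
  have "(\<integral>\<^sup>+w. ennreal (approx_delta 1 w) \<partial>lborel) \<le> (\<integral>\<^sup>+w. (\<Sum>k. ?g k w) \<partial>lborel)"
    by (intro nn_integral_mono pt)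
  also have "\<dots> = (\<Sum>k. \<integral>\<^sup>+w. ?g k w \<partial>lborel)" by (rule nn_integral_suminf) (intro borel_measurable_times_ennreal borel_measurable_const borel_measurable_indicator, simp)
  also have "\<dots> = (\<Sum>k. ennreal (16 * pi * (1 / 4) ^ k))"
  proof (rule suminf_cong)
    fix k
    have "(\<integral>\<^sup>+w. ?g k w \<partial>lborel) = ennreal (16 * (1/16) ^ k) * ennreal (pi * (2 ^ k)\<^sup>2)"
      by (simp add: nn_integral_cmult_indicator emeasure_cball_complex)
    also have "\<dots> = ennreal (16 * (1/16) ^ k * (pi * (2 ^ k)\<^sup>2))"
      by (rule ennreal_mult[symmetric]) auto
    also have "16 * (1/16) ^ k * (pi * (2 ^ k)\<^sup>2) = 16 * pi * (1/4) ^ k"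
      by (simp add: power_divide power_mult[symmetric] mult.commute[of k 2] power_mult[of 2 2])
        (simp add: divide_simps flip: power_mult_distrib)
    finally show "(\<integral>\<^sup>+w. ?g k w \<partial>lborel) = ennreal (16 * pi * (1 / 4) ^ k)" .
  qed
  also have "\<dots> < \<infinity>"
    by (subst suminf_ennreal2) (auto intro!: summable_geometric_shift)
  finally show ?thesis .
qed

lemma integrable_approx_delta: "integrable lborel (approx_delta 1)"
  using nn_integral_approx_delta by (intro integrableI_nonneg) auto

text \<open>Numerically this is pi, the constant of Cauchy's formula. It enters later as a divisor,
  through its positivity.\<close>

definition delta_mass :: real where "delta_mass = (\<integral>w. approx_delta 1 w \<partial>lborel)"

lemma delta_mass_pos: "delta_mass > 0"
proof -
  have "delta_mass \<ge> 0" by (simp add: delta_mass_def)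
  moreover have "delta_mass \<noteq> 0"
  proof
    assume "delta_mass = 0"
    then have "AE w::complex in lborel. approx_delta 1 w = 0" unfolding delta_mass_def
      by (subst (asm) integral_nonneg_eq_0_iff_AE) (auto intro: integrable_approx_delta)
    then have "AE w::complex in lborel. False"
      by eventually_elim (metis approx_delta_pos less_irrefl zero_less_one)
    then have "emeasure lborel (UNIV::complex set) = 0" by (simp add: AE_iff_measurable[of UNIV])
    then show False by (simp add: emeasure_lborel_UNIV)
  qed
  ultimately show ?thesis by simp
qed

section \<open>Smooth cutoffs of the Cauchy kernel\<close>

text \<open>The flat function \<open>exp (-1/t)\<close> divided by \<open>t ^ k\<close>. Carrying
  the power as an index makes the family closed under differentiation up to linear combinations, so
  all orders of smoothness are reached at once.\<close>

definition bump :: "nat \<Rightarrow> real \<Rightarrow> real" where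
  "bump k t = (if t > 0 then exp (- (1 / t)) / t ^ k else 0)"

lemma bump_nonneg: "0 \<le> bump k t"
  by (simp add: bump_def)

lemma bump_pos: "t > 0 \<Longrightarrow> 0 < bump k t"
  by (simp add: bump_def)

lemma bump_eq_0: "t \<le> 0 \<Longrightarrow> bump k t = 0"
  by (simp add: bump_def)

lemma bump_tendsto_0: "(bump k \<longlongrightarrow> 0) (at 0)"
proof -
  have "((\<lambda>s::real. s ^ k / exp s) \<longlongrightarrow> 0) at_top" by (rule tendsto_power_div_exp_0)
  then have "((\<lambda>t::real. inverse t ^ k / exp (inverse t)) \<longlongrightarrow> 0) (at_right 0)"
    by (rule filterlim_compose) (rule filterlim_inverse_at_top_right)
  moreover have "\<forall>\<^sub>F t in at_right 0. inverse t ^ k / exp (inverse t) = bump k t"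
    unfolding eventually_at_filter
    by (intro always_eventually)
      (simp add: bump_def exp_minus inverse_eq_divide power_one_over)
  ultimately have "(bump k \<longlongrightarrow> 0) (at_right 0)" by (rule Lim_transform_eventually)
  moreover have "(bump k \<longlongrightarrow> 0) (at_left 0)"
    by (rule tendsto_eventually, unfold eventually_at_filter, intro always_eventually) (simp add: bump_def)
  ultimately show ?thesis by (simp add: filterlim_at_split)
qed

lemma DERIV_bump: "(bump k has_real_derivative bump (k + 2) t - of_nat k * bump (k + 1) t) (at t)"
proof -
  consider "t > 0" | "t < 0" | "t = 0" by linarith
  then show ?thesis
  proof cases
    case 1
    have "((\<lambda>t. exp (- (1 / t)) / t ^ k) has_real_derivative bump (k + 2) t - of_nat k * bump (k + 1) t) (at t)"
    proof (cases k)
      case 0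
      then show ?thesis using 1
        by (auto intro!: derivative_eq_intros simp: bump_def power2_eq_square)
    next
      case (Suc j)
      show ?thesis using 1 unfolding Suc
        by (auto intro!: derivative_eq_intros simp: bump_def divide_simps power2_eq_square)
          (cases j; auto simp: algebra_simps)
    qed
    then show ?thesis
      by (rule has_field_derivative_transform_within_open[where S="{0<..}"]) (use 1 in \<open>auto simp: bump_def\<close>)
  next
    case 2
    have "((\<lambda>t. 0) has_real_derivative bump (k + 2) t - of_nat k * bump (k + 1) t) (at t)"
      using 2 by (simp add: bump_def)
    then show ?thesis
      by (rule has_field_derivative_transform_within_open[where S="{..<0}"]) (use 2 in \<open>auto simp: bump_def\<close>)
  next
    case 3
    \<comment> \<open>At the origin the difference quotient is \<open>bump (Suc k) h\<close>, so the
      limit already known for the next index is the derivative.\<close>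
    have "((\<lambda>h. bump k h / h) \<longlongrightarrow> 0) (at 0)"
      by (rule Lim_transform_eventually[OF bump_tendsto_0[of "Suc k"]])
        (auto simp: eventually_at_filter bump_def mult.commute)
    then show ?thesis using 3 by (simp add: has_field_derivative_iff bump_def)
  qed
qed

lemma continuous_bump: "continuous_on UNIV (bump k)"
  by (rule DERIV_continuous_on[OF has_field_derivative_at_within[OF DERIV_bump]])

section \<open>Partial derivatives and an algebra closed under them\<close>

lemma partial_has_derivative:
  assumes "(f has_derivative D) (at z)"
  shows "partial_x f z = D 1" "partial_y f z = D \<i>"
proof -
  interpret bounded_linear D using assms by (rule has_derivative_bounded_linear)
  have *: "vector_derivative (\<lambda>t. f (z + c * of_real t)) (at 0) = D c" for c
  proof (rule vector_derivative_at)
    have "((\<lambda>t. z + c * of_real t) has_derivative (\<lambda>t. c * of_real t)) (at 0)"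
      by (auto intro!: derivative_eq_intros)
    from has_derivative_compose[OF this, of f D] assms
    have "((\<lambda>t. f (z + c * of_real t)) has_derivative (\<lambda>t. D (c * of_real t))) (at 0)" by simp
    moreover have "D (c * of_real t) = t *\<^sub>R D c" for t
      by (metis scaleR mult.commute scaleR_conv_of_real)
    ultimately show "((\<lambda>t. f (z + c * of_real t)) has_vector_derivative D c) (at 0)"
      by (simp add: has_vector_derivative_def)
  qed
  show "partial_x f z = D 1" "partial_y f z = D \<i>"
    using *[of 1] *[of \<i>] by (simp_all add: partial_x_def partial_y_def)
qed

text \<open>The squared distance, kept as a polynomial in real coordinates; the norm itself is not
  differentiable at 0.\<close>

definition rsq :: "complex \<Rightarrow> complex \<Rightarrow> real" where
  "rsq a z = (Re z - Re a)\<^sup>2 + (Im z - Im a)\<^sup>2"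

lemma rsq_eq: "rsq a z = (cmod (z - a))\<^sup>2"
  by (simp add: rsq_def cmod_power2)

lemma rsq_nonneg: "0 \<le> rsq a z"
  by (simp add: rsq_def)

lemma has_derivative_rsq:
  "(rsq a has_derivative (\<lambda>h. 2 * (Re z - Re a) * Re h + 2 * (Im z - Im a) * Im h)) (at z)"
  unfolding rsq_def by (auto intro!: derivative_eq_intros simp: algebra_simps)

text \<open>An algebra of functions that contains the test functions needed and is closed under both
  partial derivatives; membership therefore gives \<open>C_times n\<close> for every \<open>n\<close>.\<close>
inductive smooth_alg :: "(complex \<Rightarrow> complex) \<Rightarrow> bool" where
  const: "smooth_alg (\<lambda>_. c)"
| Re: "smooth_alg (\<lambda>z. of_real (Re z))"
| Im: "smooth_alg (\<lambda>z. of_real (Im z))"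
| bump: "smooth_alg (\<lambda>z. of_real (bump k (r - rsq a z)))"
| inv: "e > 0 \<Longrightarrow> smooth_alg (\<lambda>z. of_real (inverse (rsq a z + e\<^sup>2)))"
| add: "smooth_alg f \<Longrightarrow> smooth_alg g \<Longrightarrow> smooth_alg (\<lambda>z. f z + g z)"
| mult: "smooth_alg f \<Longrightarrow> smooth_alg g \<Longrightarrow> smooth_alg (\<lambda>z. f z * g z)"

text \<open>Differentiating a bump raises its index by 1 and 2, and differentiating an inverse
  produces its square times a linear factor; both stay in the algebra because every index is a
  generator and products are allowed. The total derivative is carried along, the partials being its
  values at \<open>1\<close> and \<open>\<i>\<close>.\<close>

lemma smooth_alg_has_derivative:
  assumes "smooth_alg f"
  shows "\<exists>D. (\<forall>z. (f has_derivative D z) (at z)) \<and> smooth_alg (\<lambda>z. D z 1) \<and> smooth_alg (\<lambda>z. D z \<i>)"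
  using assms
proof induction
  case (const c)
  show ?case
    by (rule exI[of _ "\<lambda>_ _. 0"]) (auto intro: smooth_alg.const)
next
  case Re
  show ?case
    by (rule exI[of _ "\<lambda>_ h. of_real (Re h)"])
      (auto intro!: smooth_alg.const[of 1, simplified] smooth_alg.const[of 0, simplified] derivative_eq_intros)
next
  case Im
  show ?case
    by (rule exI[of _ "\<lambda>_ h. of_real (Im h)"])
      (auto intro!: smooth_alg.const[of 1, simplified] smooth_alg.const[of 0, simplified] derivative_eq_intros)
next
  case (bump k r a)
  let ?b = "\<lambda>z. bump (k + 2) (r - rsq a z) - of_nat k * bump (k + 1) (r - rsq a z)"
  let ?D = "\<lambda>z h. complex_of_real (?b z * - (2 * (Re z - Re a) * Re h + 2 * (Im z - Im a) * Im h))"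
  have d: "((\<lambda>z. complex_of_real (bump k (r - rsq a z))) has_derivative ?D z) (at z)" for z
  proof -
    have "((\<lambda>z. r - rsq a z) has_derivative (\<lambda>h. - (2 * (Re z - Re a) * Re h + 2 * (Im z - Im a) * Im h))) (at z)"
      using has_derivative_diff[OF has_derivative_const has_derivative_rsq, of r a z] by simp
    from has_derivative_compose[OF this, OF DERIV_bump[of k "r - rsq a z", unfolded has_field_derivative_def]]
    show ?thesis by (rule has_derivative_of_real)
  qed
  have b: "smooth_alg (\<lambda>z. of_real (?b z))"
  proof -
    have "smooth_alg (\<lambda>z. of_real (bump (k+2) (r - rsq a z)) + (- of_nat k) * of_real (bump (k+1) (r - rsq a z)))"
      by (intro smooth_alg.intros)
    then show ?thesis by (rule back_subst[of smooth_alg]) (simp add: fun_eq_iff)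
  qed
  have 1: "smooth_alg (\<lambda>z. of_real (?b z) * ((-2) * (of_real (Re z) + (- of_real (Re a)))))"
    by (intro smooth_alg.mult smooth_alg.add smooth_alg.const smooth_alg.Re b)
  have 2: "smooth_alg (\<lambda>z. of_real (?b z) * ((-2) * (of_real (Im z) + (- of_real (Im a)))))"
    by (intro smooth_alg.mult smooth_alg.add smooth_alg.const smooth_alg.Im b)
  show ?case
  proof (intro exI[of _ ?D] conjI allI d)
    show "smooth_alg (\<lambda>z. ?D z 1)"
      using 1 by (rule back_subst[of smooth_alg]) (auto simp: fun_eq_iff algebra_simps)
    show "smooth_alg (\<lambda>z. ?D z \<i>)"
      using 2 by (rule back_subst[of smooth_alg]) (auto simp: fun_eq_iff algebra_simps)
  qed
next
  case (inv e a)
  let ?i = "\<lambda>z. inverse (rsq a z + e\<^sup>2)"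
  let ?D = "\<lambda>z h. complex_of_real (- (?i z * (2 * (Re z - Re a) * Re h + 2 * (Im z - Im a) * Im h) * ?i z))"
  have nz: "rsq a z + e\<^sup>2 \<noteq> 0" for z
    using inv rsq_nonneg[of a z] by (smt (verit) zero_less_power)
  have d: "((\<lambda>z. complex_of_real (?i z)) has_derivative ?D z) (at z)" for z
    using Deriv.has_derivative_inverse[OF nz has_derivative_add[OF has_derivative_rsq has_derivative_const[of "e\<^sup>2"]]]
    by (intro has_derivative_of_real) simp
  have i: "smooth_alg (\<lambda>z. of_real (?i z))" using inv by (rule smooth_alg.inv)
  have 1: "smooth_alg (\<lambda>z. of_real (?i z) * (of_real (?i z) * ((-2) * (of_real (Re z) + (- of_real (Re a))))))"
    by (intro smooth_alg.mult smooth_alg.add smooth_alg.const smooth_alg.Re i)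
  have 2: "smooth_alg (\<lambda>z. of_real (?i z) * (of_real (?i z) * ((-2) * (of_real (Im z) + (- of_real (Im a))))))"
    by (intro smooth_alg.mult smooth_alg.add smooth_alg.const smooth_alg.Im i)
  show ?case
  proof (intro exI[of _ ?D] conjI allI d)
    show "smooth_alg (\<lambda>z. ?D z 1)"
      using 1 by (rule back_subst[of smooth_alg]) (auto simp: fun_eq_iff algebra_simps)
    show "smooth_alg (\<lambda>z. ?D z \<i>)"
      using 2 by (rule back_subst[of smooth_alg]) (auto simp: fun_eq_iff algebra_simps)
  qed
next
  case (add f g)
  then obtain D E where D: "\<forall>z. (f has_derivative D z) (at z)" "smooth_alg (\<lambda>z. D z 1)" "smooth_alg (\<lambda>z. D z \<i>)"
    and E: "\<forall>z. (g has_derivative E z) (at z)" "smooth_alg (\<lambda>z. E z 1)" "smooth_alg (\<lambda>z. E z \<i>)" by blast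
  show ?case
    by (rule exI[of _ "\<lambda>z h. D z h + E z h"]) (use D E in \<open>auto intro: has_derivative_add smooth_alg.add\<close>)
next
  case (mult f g)
  then obtain D E where D: "\<forall>z. (f has_derivative D z) (at z)" "smooth_alg (\<lambda>z. D z 1)" "smooth_alg (\<lambda>z. D z \<i>)"
    and E: "\<forall>z. (g has_derivative E z) (at z)" "smooth_alg (\<lambda>z. E z 1)" "smooth_alg (\<lambda>z. E z \<i>)" by blast
  show ?case
    by (rule exI[of _ "\<lambda>z h. f z * E z h + D z h * g z"])
      (use D E mult.hyps in \<open>auto intro!: has_derivative_mult smooth_alg.add smooth_alg.mult\<close>)
qed

lemma smooth_alg_C_times: "smooth_alg f \<Longrightarrow> C_times n f"
proof (induction n arbitrary: f)
  case 0
  from smooth_alg_has_derivative[OF 0] show ?case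
    by (auto simp: continuous_on_eq_continuous_at intro: has_derivative_continuous)
next
  case (Suc n)
  from smooth_alg_has_derivative[OF Suc.prems] obtain D
    where D: "\<And>z. (f has_derivative D z) (at z)" "smooth_alg (\<lambda>z. D z 1)" "smooth_alg (\<lambda>z. D z \<i>)" by blast
  have "partial_x f = (\<lambda>z. D z 1)" "partial_y f = (\<lambda>z. D z \<i>)"
    using partial_has_derivative[OF D(1)] by auto
  then show ?case using D Suc.IH by (auto simp: differentiable_def)
qed


section \<open>The truncated regularised Cauchy kernel as a test function\<close>

definition cutoff :: "complex \<Rightarrow> real \<Rightarrow> complex \<Rightarrow> real" where
  "cutoff a R \<zeta> = bump 0 (R\<^sup>2 - rsq a \<zeta>)"

text \<open>The derivative of \<open>bump 0\<close> is \<open>bump 2\<close>, and the inner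
  derivative contributes -2, whose 2 cancels the 1/2 in \<open>dbar\<close>. The pair is
  \<open>\<zeta> - a\<close> with \<open>j\<close> in the role of the imaginary unit.\<close>

definition cutoff_dbar :: "complex \<Rightarrow> real \<Rightarrow> complex \<Rightarrow> bicomplex" where
  "cutoff_dbar a R \<zeta> = (- bump 2 (R\<^sup>2 - rsq a \<zeta>)) *\<^sub>R (of_real (Re \<zeta> - Re a), of_real (Im \<zeta> - Im a))"

text \<open>For \<open>e = 0\<close> this is \<open>1 / (x + \<^bold>j y)\<close>, up to the factor \<open>\<pi>\<close> the fundamental solution of \<open>dbar\<close>,
  with value 0 at the singularity; \<open>e > 0\<close> regularises it.\<close>
definition kern :: "real \<Rightarrow> complex \<Rightarrow> bicomplex" where
  "kern e w = inverse ((cmod w)\<^sup>2 + e\<^sup>2) *\<^sub>R (of_real (Re w), - of_real (Im w))"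

text \<open>The test variable is \<open>\<zeta>\<close>. The parameter \<open>z\<close> may lie
  anywhere, since the compact support comes from the cutoff alone.\<close>

definition kern_test :: "complex \<Rightarrow> real \<Rightarrow> real \<Rightarrow> complex \<Rightarrow> complex \<Rightarrow> bicomplex" where
  "kern_test a R e z \<zeta> = cutoff a R \<zeta> *\<^sub>R kern e (z - \<zeta>)"

lemma cutoff_nonneg: "0 \<le> cutoff a R \<zeta>"
  by (simp add: cutoff_def bump_nonneg)

lemma cutoff_outside: "\<zeta> \<notin> cball a R \<Longrightarrow> 0 \<le> R \<Longrightarrow> cutoff a R \<zeta> = 0"
  unfolding cutoff_def rsq_eq
  by (rule bump_eq_0) (simp add: dist_norm norm_minus_commute power_mono)

lemma cutoff_dbar_outside: "\<zeta> \<notin> cball a R \<Longrightarrow> 0 \<le> R \<Longrightarrow> cutoff_dbar a R \<zeta> = 0"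
  unfolding cutoff_dbar_def rsq_eq
  by (subst bump_eq_0) (simp_all add: dist_norm norm_minus_commute power_mono zero_prod_def)

lemma cutoff_pos: "\<zeta> \<in> ball a R \<Longrightarrow> 0 < cutoff a R \<zeta>"
  unfolding cutoff_def rsq_eq
  by (rule bump_pos) (simp add: dist_norm norm_minus_commute power_strict_mono)

lemma continuous_rsq: "continuous_on UNIV (rsq a)"
  unfolding rsq_def by (intro continuous_intros)

lemma continuous_cutoff: "continuous_on UNIV (cutoff a R)"
  unfolding cutoff_def
  by (intro continuous_on_compose2[OF continuous_bump] continuous_intros continuous_rsq) auto

lemma continuous_cutoff_dbar: "continuous_on UNIV (cutoff_dbar a R)"
  unfolding cutoff_dbar_def
  by (intro continuous_on_compose2[OF continuous_bump] continuous_intros continuous_rsq) auto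

lemma kern_test_eq:
  "kern_test a R e z \<zeta> = (of_real (bump 0 (R\<^sup>2 - rsq a \<zeta>) * (inverse (rsq z \<zeta> + e\<^sup>2) * (Re z - Re \<zeta>))),
     of_real (bump 0 (R\<^sup>2 - rsq a \<zeta>) * (inverse (rsq z \<zeta> + e\<^sup>2) * (Im \<zeta> - Im z))))"
  by (simp add: kern_test_def cutoff_def kern_def rsq_eq norm_minus_commute scaleR_conv_of_real algebra_simps)

lemma kern_test_in_test_functions:
  assumes "cball a R \<subseteq> \<Omega>" "0 \<le> R" "e > 0"
  shows "kern_test a R e z \<in> bc_space (test_functions \<Omega>)"
proof -
  have s: "smooth_alg (\<lambda>\<zeta>. Sc (kern_test a R e z \<zeta>))" "smooth_alg (\<lambda>\<zeta>. Vec (kern_test a R e z \<zeta>))"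
  proof -
    have "smooth_alg (\<lambda>\<zeta>. of_real (bump 0 (R\<^sup>2 - rsq a \<zeta>)) * (of_real (inverse (rsq z \<zeta> + e\<^sup>2)) *
        (of_real (Re z) + (-1) * of_real (Re \<zeta>))))"
      by (intro smooth_alg.intros assms)
    then show "smooth_alg (\<lambda>\<zeta>. Sc (kern_test a R e z \<zeta>))"
      by (rule back_subst[of smooth_alg]) (simp add: fun_eq_iff kern_test_eq)
    have "smooth_alg (\<lambda>\<zeta>. of_real (bump 0 (R\<^sup>2 - rsq a \<zeta>)) * (of_real (inverse (rsq z \<zeta> + e\<^sup>2)) *
        (of_real (Im \<zeta>) + of_real (- Im z))))"
      by (intro smooth_alg.mult smooth_alg.add smooth_alg.const smooth_alg.Im smooth_alg.bump smooth_alg.inv assms)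
    then show "smooth_alg (\<lambda>\<zeta>. Vec (kern_test a R e z \<zeta>))"
      by (rule back_subst[of smooth_alg]) (simp add: fun_eq_iff kern_test_eq)
  qed
  have z: "kern_test a R e z \<zeta> = 0" if "\<zeta> \<notin> cball a R" for \<zeta>
    using cutoff_outside[OF that assms(2)] by (simp add: kern_test_def)
  have supp: "compact (closure {\<zeta>. f (kern_test a R e z \<zeta>) \<noteq> 0}) \<and> closure {\<zeta>. f (kern_test a R e z \<zeta>) \<noteq> 0} \<subseteq> \<Omega>"
    if "f 0 = (0::complex)" for f
  proof -
    have "{\<zeta>. f (kern_test a R e z \<zeta>) \<noteq> 0} \<subseteq> cball a R" using z that by force
    then have "closure {\<zeta>. f (kern_test a R e z \<zeta>) \<noteq> 0} \<subseteq> cball a R" by (rule closure_minimal) simp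
    then show ?thesis using assms(1) by (auto intro: bounded_subset[OF bounded_cball] simp: compact_eq_bounded_closed)
  qed
  show ?thesis unfolding bc_space_def test_functions_def
    using s supp[of fst] supp[of snd] by (auto intro: smooth_alg_C_times)
qed

text \<open>Leibniz rule. With \<open>w = x + j y\<close> and \<open>N = |w|^2 + e^2\<close>,
  \<open>dbar\<close> of \<open>conj w / N\<close> is
  \<open>1 / N - |w|^2 / N^2 = e^2 / N^2\<close>; the reflected argument \<open>z - \<zeta>\<close>
  supplies the minus sign.\<close>

lemma dbar_kern_test:
  assumes "e > 0"
  shows "dbar (kern_test a R e z) \<zeta> =
    cutoff_dbar a R \<zeta> \<odot> kern e (z - \<zeta>) - (cutoff a R \<zeta> * approx_delta e (z - \<zeta>)) *\<^sub>R (1, 0)"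
proof -
  define N where "N = rsq z \<zeta> + e\<^sup>2"
  define n where "n h = 2 * (Re \<zeta> - Re z) * Re h + 2 * (Im \<zeta> - Im z) * Im h" for h
  define b where "b = bump 0 (R\<^sup>2 - rsq a \<zeta>)"
  define b' where "b' h = bump 2 (R\<^sup>2 - rsq a \<zeta>) * - (2 * (Re \<zeta> - Re a) * Re h + 2 * (Im \<zeta> - Im a) * Im h)" for h
  have N: "N > 0" using assms rsq_nonneg[of z \<zeta>] by (simp add: N_def add_nonneg_pos)
  have di: "((\<lambda>\<zeta>. inverse (rsq z \<zeta> + e\<^sup>2)) has_derivative (\<lambda>h. - (inverse N * n h * inverse N))) (at \<zeta>)"
    using Deriv.has_derivative_inverse[OF _ has_derivative_add[OF has_derivative_rsq has_derivative_const[of "e\<^sup>2"]]] N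
    unfolding N_def n_def by auto
  have db: "((\<lambda>\<zeta>. bump 0 (R\<^sup>2 - rsq a \<zeta>)) has_derivative b') (at \<zeta>)"
  proof -
    have "((\<lambda>z. R\<^sup>2 - rsq a z) has_derivative (\<lambda>h. - (2 * (Re \<zeta> - Re a) * Re h + 2 * (Im \<zeta> - Im a) * Im h))) (at \<zeta>)"
      using has_derivative_diff[OF has_derivative_const has_derivative_rsq, of "R\<^sup>2" a \<zeta>] by simp
    from has_derivative_compose[OF this, OF DERIV_bump[of 0 "R\<^sup>2 - rsq a \<zeta>", unfolded has_field_derivative_def]]
    show ?thesis unfolding b'_def by (simp add: numeral_2_eq_2)
  qed
  have dR: "((\<lambda>\<zeta>. Re z - Re \<zeta>) has_derivative (\<lambda>h. - Re h)) (at \<zeta>)"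
    and dI: "((\<lambda>\<zeta>. Im \<zeta> - Im z) has_derivative (\<lambda>h. Im h)) (at \<zeta>)"
    by (auto intro!: derivative_eq_intros)
  note d1 = has_derivative_of_real[where 'a=complex, OF has_derivative_mult[OF db has_derivative_mult[OF di dR]]]
  note d2 = has_derivative_of_real[where 'a=complex, OF has_derivative_mult[OF db has_derivative_mult[OF di dI]]]
  note p = partial_has_derivative[OF has_derivative_Pair[OF d1 d2], folded kern_test_eq N_def b_def]
  have k: "kern e (z - \<zeta>) = (of_real (inverse N * (Re z - Re \<zeta>)), of_real (inverse N * (Im \<zeta> - Im z)))"
    by (simp add: kern_def N_def rsq_eq norm_minus_commute scaleR_conv_of_real algebra_simps)
  have dd: "approx_delta e (z - \<zeta>) = e\<^sup>2 * inverse N * inverse N"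
    by (simp add: approx_delta_def N_def rsq_eq norm_minus_commute power2_eq_square divide_inverse)
  have NN: "inverse N = inverse N * inverse N * ((Re \<zeta> - Re z)\<^sup>2 + (Im \<zeta> - Im z)\<^sup>2 + e\<^sup>2)"
    using N unfolding rsq_def[symmetric] N_def[symmetric] by simp
  define I where "I = inverse N"
  \<comment> \<open>Eliminating \<open>e\<close> in favour of \<open>I\<close> leaves a polynomial
    identity in \<open>I\<close>, the coordinates and the bump values, to be checked
    componentwise.\<close>
  have e2: "e\<^sup>2 * I * I = I - I * I * ((Re \<zeta> - Re z)\<^sup>2 + (Im \<zeta> - Im z)\<^sup>2)"
    using NN unfolding I_def[symmetric] by (simp add: algebra_simps)
  show ?thesis
    unfolding dbar_def p k dd cutoff_dbar_def cutoff_def bc_mult_def bc_j_def b_def[symmetric] I_def[symmetric] e2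
    by (simp add: b'_def n_def prod_eq_iff complex_eq_iff power2_eq_square field_simps)
qed

section \<open>Convergence of the approximate identity, tested on boxes\<close>

lemma integrable_box_approx_delta:
  assumes "e > 0"
  shows "integrable lborel (\<lambda>z. indicator (box p q) z * approx_delta e (z - \<zeta>))"
proof (rule Bochner_Integration.integrable_bound)
    show "integrable lborel (\<lambda>z. indicator (box p q) z * (1 / e\<^sup>2) :: real)"
      by (intro integrable_mult_left) (simp add: integrable_indicator_iff emeasure_lborel_box_eq)
    show "AE z in lborel. norm (indicator (box p q) z * approx_delta e (z - \<zeta>))
        \<le> norm (indicator (box p q) z * (1 / e\<^sup>2) :: real)"
      using approx_delta_bound[OF assms] by (intro AE_I2) (auto simp: indicator_def)
  qed measurable

text \<open>The substitution \<open>z = \<zeta> + e w\<close> moves the dependence on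
  \<open>e\<close> from the density into the indicator and leaves a fixed integrable weight.\<close>

lemma integral_box_approx_delta:
  assumes "e > 0"
  shows "(\<integral>z. indicator (box p q) z * approx_delta e (z - \<zeta>) \<partial>lborel)
    = (\<integral>w. indicator (box p q) (\<zeta> + e *\<^sub>R w) * approx_delta 1 w \<partial>lborel)"
proof -
  from integral_lborel_affine[OF integrable_box_approx_delta[OF assms, of p q \<zeta>], of e \<zeta>] assms
  have "(\<integral>z. indicator (box p q) z * approx_delta e (z - \<zeta>) \<partial>lborel)
    = e\<^sup>2 * (\<integral>w. indicator (box p q) (\<zeta> + e *\<^sub>R w) * approx_delta e (e *\<^sub>R w) \<partial>lborel)"
    by simp
  also have "\<dots> = (\<integral>w. indicator (box p q) (\<zeta> + e *\<^sub>R w) * approx_delta 1 w \<partial>lborel)"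
    unfolding approx_delta_scale[OF assms] using assms by simp
  finally show ?thesis .
qed

text \<open>Off the frontier the indicator at \<open>\<zeta> + e n *\<^sub>R w\<close> is eventually
  constant for each \<open>w\<close>, and \<open>approx_delta 1\<close> dominates. On the frontier
  the limit can be a proper fraction of the mass.\<close>

lemma box_approx_delta_tendsto:
  assumes e: "\<And>n. e n > 0" "e \<longlonglongrightarrow> 0" and fr: "\<zeta> \<notin> frontier (box p q)"
  shows "(\<lambda>n. \<integral>z. indicator (box p q) z * approx_delta (e n) (z - \<zeta>) \<partial>lborel)
      \<longlonglongrightarrow> indicator (box p q) \<zeta> * delta_mass"
proof -
  have "(\<lambda>n. \<integral>w. indicator (box p q) (\<zeta> + e n *\<^sub>R w) * approx_delta 1 w \<partial>lborel)
     \<longlonglongrightarrow> (\<integral>w. indicator (box p q) \<zeta> * approx_delta 1 w \<partial>lborel)"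
  proof (rule integral_dominated_convergence[where w="approx_delta 1"])
    show "integrable lborel (approx_delta 1)" by (rule integrable_approx_delta)
    show "AE w in lborel. (\<lambda>n. indicator (box p q) (\<zeta> + e n *\<^sub>R w) * approx_delta 1 w)
        \<longlonglongrightarrow> indicator (box p q) \<zeta> * approx_delta 1 w"
    proof (intro AE_I2)
      fix w
      have lim: "(\<lambda>n. \<zeta> + e n *\<^sub>R w) \<longlonglongrightarrow> \<zeta>"
        using tendsto_add[OF tendsto_const tendsto_scaleR[OF e(2) tendsto_const], of \<zeta> w] by simp
      obtain S where S: "open S" "\<zeta> \<in> S" "\<And>x. x \<in> S \<Longrightarrow> x \<in> box p q \<longleftrightarrow> \<zeta> \<in> box p q"
      proof (cases "\<zeta> \<in> box p q")
        case True
        then show ?thesis using that[of "box p q"] by auto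
      next
        case False
        then have "\<zeta> \<in> - closure (box p q)" using fr using interior_subset[of "box p q"] by (auto simp: frontier_def)
        then show ?thesis using that[of "- closure (box p q)"] False closure_subset by blast
      qed
      have "\<forall>\<^sub>F n in sequentially. \<zeta> + e n *\<^sub>R w \<in> S"
        by (rule topological_tendstoD[OF lim S(1,2)])
      then have "\<forall>\<^sub>F n in sequentially. indicator (box p q) (\<zeta> + e n *\<^sub>R w) * approx_delta 1 w
          = indicator (box p q) \<zeta> * approx_delta 1 w"
        by eventually_elim (use S(3) in \<open>auto simp: indicator_def\<close>)
      then show "(\<lambda>n. indicator (box p q) (\<zeta> + e n *\<^sub>R w) * approx_delta 1 w)
        \<longlonglongrightarrow> indicator (box p q) \<zeta> * approx_delta 1 w" by (rule tendsto_eventually)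
    qed
    show "AE w in lborel. norm (indicator (box p q) (\<zeta> + e n *\<^sub>R w) * approx_delta 1 w) \<le> approx_delta 1 w" for n
      by (intro AE_I2) (auto simp: indicator_def)
  qed measurable
  then show ?thesis using e(1) by (simp add: integral_box_approx_delta delta_mass_def)
qed

lemma box_approx_delta_bound:
  assumes "e > 0"
  shows "\<bar>\<integral>z. indicator (box p q) z * approx_delta e (z - \<zeta>) \<partial>lborel\<bar> \<le> delta_mass"
proof -
  have "\<bar>\<integral>w. indicator (box p q) (\<zeta> + e *\<^sub>R w) * approx_delta 1 w \<partial>lborel\<bar> \<le> (\<integral>w. approx_delta 1 w \<partial>lborel)"
    by (rule order_trans[OF integral_abs_bound integral_mono_AE'])
      (auto simp: indicator_def integrable_approx_delta)
  then show ?thesis by (simp add: integral_box_approx_delta[OF assms] delta_mass_def)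
qed

text \<open>The existence of the limit and a local majorant are assumed; the question is which
  function the limit is. Fubini moves the mollification from \<open>h\<close> onto box indicators,
  whose convergence is explicit, and box integrals determine a function almost everywhere.\<close>

lemma approx_identity_AE:
  fixes h u :: "complex \<Rightarrow> bicomplex"
  assumes h: "integrable lborel h" and um[measurable]: "u \<in> borel_measurable borel"
    and e: "\<And>n. e n > 0" "e \<longlonglongrightarrow> 0"
    and lim: "AE z in lborel. (\<lambda>n. \<integral>\<zeta>. approx_delta (e n) (z - \<zeta>) *\<^sub>R h \<zeta> \<partial>lborel) \<longlonglongrightarrow> u z"
    and dom: "\<And>p q. \<exists>G. integrable lborel G \<and> (\<forall>n. AE z in lborel.
       z \<in> box p q \<longrightarrow> norm (\<integral>\<zeta>. approx_delta (e n) (z - \<zeta>) *\<^sub>R h \<zeta> \<partial>lborel) \<le> G z)"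
  shows "AE z in lborel. u z = delta_mass *\<^sub>R h z"
proof -
  have [measurable]: "h \<in> borel_measurable borel" using h by auto
  define v where "v n z = (\<integral>\<zeta>. approx_delta (e n) (z - \<zeta>) *\<^sub>R h \<zeta> \<partial>lborel)" for n z
  have [measurable]: "v n \<in> borel_measurable borel" for n
    unfolding v_def by measurable
  have *: "integrable lborel (\<lambda>z. indicator (box p q) z *\<^sub>R u z) \<and>
     (\<integral>z. indicator (box p q) z *\<^sub>R u z \<partial>lborel) = (\<integral>z. indicator (box p q) z *\<^sub>R (delta_mass *\<^sub>R h z) \<partial>lborel)" for p q
  proof -
    obtain G where G: "integrable lborel G" "\<And>n. AE z in lborel. z \<in> box p q \<longrightarrow> norm (v n z) \<le> G z"
      using dom[of p q] unfolding v_def by blast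
    let ?I = "\<lambda>z. indicator (box p q) z :: real"
    have dc: "integrable lborel (\<lambda>z. ?I z *\<^sub>R u z)"
      "(\<lambda>n. \<integral>z. ?I z *\<^sub>R v n z \<partial>lborel) \<longlonglongrightarrow> (\<integral>z. ?I z *\<^sub>R u z \<partial>lborel)"
    proof -
      have l: "AE z in lborel. (\<lambda>n. ?I z *\<^sub>R v n z) \<longlonglongrightarrow> ?I z *\<^sub>R u z"
        using lim unfolding v_def[symmetric] by eventually_elim (intro tendsto_intros)
      have b: "AE z in lborel. norm (?I z *\<^sub>R v n z) \<le> \<bar>G z\<bar>" for n
        using G(2)[of n] by eventually_elim (auto simp: indicator_def)
      have G': "integrable lborel (\<lambda>z. \<bar>G z\<bar>)" using G(1) by simp
      show "integrable lborel (\<lambda>z. ?I z *\<^sub>R u z)"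
        by (rule integrable_dominated_convergence[OF _ _ G' l b]; measurable)
      show "(\<lambda>n. \<integral>z. ?I z *\<^sub>R v n z \<partial>lborel) \<longlonglongrightarrow> (\<integral>z. ?I z *\<^sub>R u z \<partial>lborel)"
        by (rule integral_dominated_convergence[OF _ _ G' l b]; measurable)
    qed
    \<comment> \<open>For fixed \<open>n\<close> the density is at most
      \<open>1 / (e n)\<^sup>2\<close>, so over a box the joint integrand is dominated by an
      integrable product and Fubini applies.\<close>
    have swap: "(\<integral>z. ?I z *\<^sub>R v n z \<partial>lborel)
      = (\<integral>\<zeta>. (\<integral>z. ?I z * approx_delta (e n) (z - \<zeta>) \<partial>lborel) *\<^sub>R h \<zeta> \<partial>lborel)" for n
    proof -
      have i1: "integrable (lborel \<Otimes>\<^sub>M lborel) (\<lambda>(\<zeta>, z). (?I z * approx_delta (e n) (z - \<zeta>)) *\<^sub>R h \<zeta>)"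
      proof (rule Bochner_Integration.integrable_bound)
        show "integrable (lborel \<Otimes>\<^sub>M lborel) (\<lambda>(\<zeta>, z). norm (h \<zeta>) * (?I z * (1 / (e n)\<^sup>2)))"
        proof (rule lborel_pair.Fubini_integrable)
          have i: "integrable lborel (\<lambda>z. ?I z * (1 / (e n)\<^sup>2))"
            by (intro integrable_mult_left) (simp add: integrable_indicator_iff emeasure_lborel_box_eq)
          then show "AE \<zeta> in lborel. integrable lborel (\<lambda>z. case (\<zeta>, z) of (\<zeta>, z) \<Rightarrow> norm (h \<zeta>) * (?I z * (1 / (e n)\<^sup>2)))"
            by (intro AE_I2) (simp only: prod.case integrable_mult_right)
          have "(\<integral>z. norm (case (\<zeta>, z) of (\<zeta>, z) \<Rightarrow> norm (h \<zeta>) * (?I z * (1 / (e n)\<^sup>2))) \<partial>lborel)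
              = norm (h \<zeta>) * (\<integral>z. ?I z * (1 / (e n)\<^sup>2) \<partial>lborel)" for \<zeta>
            by (subst Bochner_Integration.integral_mult_right_zero[symmetric])
              (auto intro!: Bochner_Integration.integral_cong simp: abs_mult)
          then show "integrable lborel (\<lambda>\<zeta>. \<integral>z. norm (case (\<zeta>, z) of (\<zeta>, z) \<Rightarrow> norm (h \<zeta>) * (?I z * (1 / (e n)\<^sup>2))) \<partial>lborel)"
            using h by (simp only: integrable_mult_left integrable_norm)
        qed measurable
        show "AE x in lborel \<Otimes>\<^sub>M lborel. norm (case x of (\<zeta>, z) \<Rightarrow> (?I z * approx_delta (e n) (z - \<zeta>)) *\<^sub>R h \<zeta>)
          \<le> norm (case x of (\<zeta>, z) \<Rightarrow> norm (h \<zeta>) * (?I z * (1 / (e n)\<^sup>2)))"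
        proof (intro AE_I2)
          have "norm (h a) * approx_delta (e n) w \<le> norm (h a) / (e n)\<^sup>2" for a w
            using mult_left_mono[OF approx_delta_bound[OF e(1)[of n]] norm_ge_zero, of "h a" w] by simp
          then show "norm (case x of (\<zeta>, z) \<Rightarrow> (?I z * approx_delta (e n) (z - \<zeta>)) *\<^sub>R h \<zeta>)
            \<le> norm (case x of (\<zeta>, z) \<Rightarrow> norm (h \<zeta>) * (?I z * (1 / (e n)\<^sup>2)))" for x
            by (auto simp: indicator_def mult.commute split: prod.split)
        qed
      qed measurable
      have "(\<integral>z. ?I z *\<^sub>R v n z \<partial>lborel) = (\<integral>z. (\<integral>\<zeta>. (?I z * approx_delta (e n) (z - \<zeta>)) *\<^sub>R h \<zeta> \<partial>lborel) \<partial>lborel)"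
        unfolding v_def by (subst integral_scaleR_right[symmetric]) (simp_all)
      also have "\<dots> = (\<integral>\<zeta>. (\<integral>z. (?I z * approx_delta (e n) (z - \<zeta>)) *\<^sub>R h \<zeta> \<partial>lborel) \<partial>lborel)"
        by (rule lborel_pair.Fubini_integral[OF i1])
      also have "\<dots> = (\<integral>\<zeta>. (\<integral>z. ?I z * approx_delta (e n) (z - \<zeta>) \<partial>lborel) *\<^sub>R h \<zeta> \<partial>lborel)"
        by (intro Bochner_Integration.integral_cong refl integral_scaleR_left integrable_box_approx_delta e)
      finally show ?thesis .
    qed
    have "(\<lambda>n. \<integral>\<zeta>. (\<integral>z. ?I z * approx_delta (e n) (z - \<zeta>) \<partial>lborel) *\<^sub>R h \<zeta> \<partial>lborel)
        \<longlonglongrightarrow> (\<integral>\<zeta>. (?I \<zeta> * delta_mass) *\<^sub>R h \<zeta> \<partial>lborel)"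
    proof (rule integral_dominated_convergence[where w="\<lambda>\<zeta>. delta_mass * norm (h \<zeta>)"])
      show "integrable lborel (\<lambda>\<zeta>. delta_mass * norm (h \<zeta>))" using h by simp
      have "frontier (box p q) \<in> null_sets lborel"
        using negligible_convex_frontier[of "box p q"] 
        by (simp add: negligible_iff_null_sets null_sets_completion_iff borel_closed)
      then have "AE \<zeta> in lborel. \<zeta> \<notin> frontier (box p q)" by (rule AE_not_in)
      then show "AE \<zeta> in lborel. (\<lambda>n. (\<integral>z. ?I z * approx_delta (e n) (z - \<zeta>) \<partial>lborel) *\<^sub>R h \<zeta>)
        \<longlonglongrightarrow> (?I \<zeta> * delta_mass) *\<^sub>R h \<zeta>"
        by eventually_elim (intro tendsto_intros box_approx_delta_tendsto e)
      show "AE \<zeta> in lborel. norm ((\<integral>z. ?I z * approx_delta (e n) (z - \<zeta>) \<partial>lborel) *\<^sub>R h \<zeta>)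
        \<le> delta_mass * norm (h \<zeta>)" for n
        using box_approx_delta_bound[OF e(1)] by (intro AE_I2) (auto intro: mult_right_mono)
    qed measurable
    then have "(\<integral>z. ?I z *\<^sub>R u z \<partial>lborel) = (\<integral>\<zeta>. (?I \<zeta> * delta_mass) *\<^sub>R h \<zeta> \<partial>lborel)"
      using dc(2) unfolding swap by (rule LIMSEQ_unique[symmetric])
    then show ?thesis using dc(1) by simp
  qed
  have "AE z in lborel. u z - delta_mass *\<^sub>R h z = 0"
  proof (rule AE_eq_0_if_integral_box_0)
    fix p q
    have i2: "integrable lborel (\<lambda>z. indicator (box p q) z *\<^sub>R (delta_mass *\<^sub>R h z))"
      by (rule integrable_mult_indicator) (use h in auto)
    show "integrable lborel (\<lambda>z. indicator (box p q) z *\<^sub>R (u z - delta_mass *\<^sub>R h z))"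
      using Bochner_Integration.integrable_diff[OF conjunct1[OF *[of p q]] i2] by (simp only: scaleR_diff_right)
    show "(\<integral>z. indicator (box p q) z *\<^sub>R (u z - delta_mass *\<^sub>R h z) \<partial>lborel) = 0"
      using Bochner_Integration.integral_diff[OF conjunct1[OF *[of p q]] i2] conjunct2[OF *[of p q]]
      by (simp only: scaleR_diff_right) simp
  qed
  then show ?thesis by simp
qed

section \<open>Weakly singular potentials\<close>

lemma pred_mem_cball [measurable (raw)]:
  fixes f :: "'a \<Rightarrow> complex"
  assumes [measurable]: "f \<in> borel_measurable M"
  shows "Measurable.pred M (\<lambda>x. f x \<in> cball a r)"
  unfolding mem_cball by measurable

lemma powr_minus_half: "0 < c \<Longrightarrow> c powr (-1/2) = inverse (sqrt c)" for c :: real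
  using powr_minus[of c "1/2"] by (simp add: powr_half_sqrt)

lemma powr_minus_three_halves: "0 < c \<Longrightarrow> c powr (-3/2) = inverse (sqrt c) * inverse c" for c :: real
  using powr_add[of c "-1/2" "-1"] powr_minus_half[of c] by (simp add: powr_minus)

lemma norm_kern: "norm (kern e w) = cmod w / ((cmod w)\<^sup>2 + e\<^sup>2)"
proof -
  have "norm (complex_of_real (Re w), - complex_of_real (Im w)) = cmod w"
    by (simp add: norm_prod_def cmod_def)
  then have "norm (kern e w) = \<bar>inverse ((cmod w)\<^sup>2 + e\<^sup>2)\<bar> * cmod w"
    by (simp only: kern_def norm_scaleR)
  then show ?thesis by (simp add: divide_inverse mult.commute)
qed

lemma norm_kern_le: "norm (kern e w) \<le> inverse (cmod w)"
proof (cases "w = 0")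
  case False
  have "cmod w / ((cmod w)\<^sup>2 + e\<^sup>2) \<le> cmod w / (cmod w)\<^sup>2"
    using False by (intro divide_left_mono mult_pos_pos) (auto intro: add_pos_nonneg)
  then show ?thesis using False by (simp add: norm_kern power2_eq_square field_simps)
qed (simp add: norm_kern)

lemma norm_kern_le_inverse:
  assumes "e > 0" shows "norm (kern e w) \<le> 1 / e"
proof -
  have "0 \<le> (cmod w - e)\<^sup>2 + cmod w * e" using assms by simp
  then have "cmod w * e \<le> (cmod w)\<^sup>2 + e\<^sup>2" by (simp add: power2_eq_square algebra_simps)
  then show ?thesis using assms by (simp add: norm_kern divide_simps add_nonneg_pos)
qed

lemma continuous_kern: "e > 0 \<Longrightarrow> continuous_on S (kern e)"
  unfolding kern_def by (intro continuous_intros) (auto simp: add_nonneg_eq_0_iff)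

lemma measurable_kern [measurable]: "kern e \<in> borel_measurable borel"
  unfolding kern_def by measurable

lemma kern_tendsto:
  assumes "e \<longlonglongrightarrow> 0" shows "(\<lambda>n. kern (e n) w) \<longlonglongrightarrow> kern 0 w"
proof (cases "w = 0")
  case False
  then show ?thesis unfolding kern_def
    by (intro tendsto_intros assms) auto
qed (simp add: kern_def zero_prod_def)

text \<open>With \<open>c = |w|\<close> the difference has norm
  \<open>(e^2 / (c^2 + e^2)) / c\<close>. Bounding the first factor by \<open>sqrt (e / c)\<close>
  trades half a power of singularity for a factor \<open>sqrt e\<close> that does not depend on
  \<open>w\<close>.\<close>

lemma norm_kern_diff:
  assumes "e > 0"
  shows "norm (kern 0 w - kern e w) \<le> sqrt e * cmod w powr (-3/2)"
proof (cases "w = 0")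
  case False
  define c where "c = cmod w"
  have c: "c > 0" using False by (simp add: c_def)
  have "kern 0 w - kern e w = (inverse (c\<^sup>2) - inverse (c\<^sup>2 + e\<^sup>2)) *\<^sub>R (of_real (Re w), - of_real (Im w))"
    by (simp add: kern_def c_def scaleR_diff_left)
  moreover have "norm (complex_of_real (Re w), - complex_of_real (Im w)) = c"
    by (simp add: norm_prod_def cmod_def c_def)
  ultimately have "norm (kern 0 w - kern e w) = \<bar>inverse (c\<^sup>2) - inverse (c\<^sup>2 + e\<^sup>2)\<bar> * c"
    by (simp only: norm_scaleR)
  also have "\<bar>inverse (c\<^sup>2) - inverse (c\<^sup>2 + e\<^sup>2)\<bar> = e\<^sup>2 / (c\<^sup>2 * (c\<^sup>2 + e\<^sup>2))"
  proof -
    have "c\<^sup>2 + e\<^sup>2 > 0" using c by (intro add_pos_nonneg) auto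
    then have "inverse (c\<^sup>2) - inverse (c\<^sup>2 + e\<^sup>2) = e\<^sup>2 / (c\<^sup>2 * (c\<^sup>2 + e\<^sup>2))"
      using division_ring_inverse_diff[of "c\<^sup>2" "c\<^sup>2 + e\<^sup>2"] c by (simp add: divide_inverse)
    then show ?thesis using \<open>c\<^sup>2 + e\<^sup>2 > 0\<close> by simp
  qed
  also have "e\<^sup>2 / (c\<^sup>2 * (c\<^sup>2 + e\<^sup>2)) * c = (e\<^sup>2 / (c\<^sup>2 + e\<^sup>2)) / c"
    using c by (simp add: power2_eq_square)
  also have "\<dots> \<le> sqrt (e / c) / c"
  proof (rule divide_right_mono)
    have pos: "c\<^sup>2 + e\<^sup>2 > 0" using c by (intro add_pos_nonneg) auto
    show "e\<^sup>2 / (c\<^sup>2 + e\<^sup>2) \<le> sqrt (e / c)"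
    proof (cases "e \<le> c")
      case True
      then have t: "0 \<le> e / c" "e / c \<le> 1" using c assms by auto
      have "e\<^sup>2 / (c\<^sup>2 + e\<^sup>2) \<le> e\<^sup>2 / c\<^sup>2"
        using c pos by (intro divide_left_mono mult_pos_pos) auto
      also have "\<dots> = (e / c)\<^sup>2" by (simp add: power_divide)
      also have "\<dots> \<le> e / c" using mult_left_le[OF t(2,1)] unfolding power2_eq_square .
      also have "\<dots> \<le> sqrt (e / c)" using mult_left_le[OF t(2,1)] by (intro real_le_rsqrt) (simp only: power2_eq_square)
      finally show ?thesis .
    next
      case False
      then have "1 \<le> e / c" using c by simp
      have "e\<^sup>2 / (c\<^sup>2 + e\<^sup>2) \<le> 1" using pos by (simp add: divide_simps)
      also have "1 \<le> sqrt (e / c)" using \<open>1 \<le> e / c\<close> by simp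
      finally show ?thesis .
    qed
  qed (use c in simp)
  also have "\<dots> = sqrt e * c powr (-3/2)"
  proof -
    have "c powr (-3/2) = inverse (sqrt c) * inverse c"
      using c by (rule powr_minus_three_halves)
    then show ?thesis unfolding real_sqrt_divide by (simp only:) (simp only: divide_inverse mult.assoc)
  qed
  finally show ?thesis by (simp add: c_def)
qed (simp add: kern_def)

definition sing_const :: real where
  "sing_const = enn2real (\<integral>\<^sup>+w. ennreal (indicator (cball 0 1) w * cmod w powr (-3/2)) \<partial>lborel)"

lemma sing_const_nonneg: "0 \<le> sing_const"
  by (simp add: sing_const_def)

definition riesz_const :: "real \<Rightarrow> real" where
  "riesz_const R = sing_const + pi * R\<^sup>2"

lemma riesz_const_nonneg: "0 \<le> riesz_const R"
  by (simp add: riesz_const_def sing_const_nonneg)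

text \<open>The singular part is integrated over the whole plane, where reflection and translation
  remove \<open>z\<close>; the remaining 1 contributes the area of the disc. Hence one constant
  serves every position of the singularity and every radius up to \<open>R\<close>.\<close>

lemma nn_integral_weakly_singular:
  fixes k :: "complex \<Rightarrow> real"
  assumes [measurable]: "k \<in> borel_measurable borel"
    and k: "\<And>w. k w \<le> indicator (cball 0 1) w * cmod w powr (-3/2) + 1"
    and r: "0 \<le> r" "r \<le> R"
  shows "(\<integral>\<^sup>+\<zeta>. indicator (cball a r) \<zeta> * ennreal (k (z - \<zeta>)) \<partial>lborel) \<le> ennreal (riesz_const R)"
proof -
  let ?g = "\<lambda>w. ennreal (indicator (cball 0 1) w * cmod w powr (-3/2))"
  have "(\<integral>\<^sup>+\<zeta>. indicator (cball a r) \<zeta> * ennreal (k (z - \<zeta>)) \<partial>lborel)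
     \<le> (\<integral>\<^sup>+\<zeta>. ?g (z - \<zeta>) + indicator (cball a r) \<zeta> \<partial>lborel)"
  proof (rule nn_integral_mono)
    fix \<zeta>
    have "ennreal (k (z - \<zeta>)) \<le> ?g (z - \<zeta>) + 1"
      using k[of "z - \<zeta>"] by (metis (no_types, lifting) ennreal_1 ennreal_leI ennreal_plus indicator_pos_le
          mult_nonneg_nonneg powr_ge_zero zero_le_one)
    then show "indicator (cball a r) \<zeta> * ennreal (k (z - \<zeta>)) \<le> ?g (z - \<zeta>) + indicator (cball a r) \<zeta>"
      by (cases "\<zeta> \<in> cball a r") auto
  qed
  also have "\<dots> = (\<integral>\<^sup>+\<zeta>. ?g (z - \<zeta>) \<partial>lborel) + emeasure lborel (cball a r)"
    by (subst nn_integral_add) auto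
  also have "(\<integral>\<^sup>+\<zeta>. ?g (z - \<zeta>) \<partial>lborel) = (\<integral>\<^sup>+\<zeta>. ?g \<zeta> \<partial>lborel)"
    by (rule nn_integral_reflect) measurable
  also have "\<dots> = ennreal sing_const"
    using nn_integral_singular_kernel by (simp add: sing_const_def)
  also have "ennreal sing_const + emeasure lborel (cball a r) = ennreal (sing_const + pi * r\<^sup>2)"
    using r by (simp add: emeasure_cball_complex sing_const_nonneg)
  also have "\<dots> \<le> ennreal (riesz_const R)"
    using r by (auto simp: riesz_const_def intro!: ennreal_leI mult_left_mono power_mono)
  finally show ?thesis .
qed

text \<open>One majorant for all kernels that occur: exponent 1 for the Cauchy kernel and for the
  square of the half-order kernel, exponent 3/2 for the composition and the regularisation error. At
  \<open>w = 0\<close> the convention \<open>0 powr x = 0\<close> makes the bound trivial.\<close>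

lemma powr_weakly_singular:
  assumes "0 \<le> s" "s \<le> 3/2"
  shows "cmod w powr (-s) \<le> indicator (cball 0 1) w * cmod w powr (-3/2) + 1"
proof (cases "w = 0")
  case False
  then have c: "cmod w > 0" by simp
  show ?thesis
  proof (cases "cmod w \<le> 1")
    case True
    then have "cmod w powr (-s) \<le> cmod w powr (-3/2)"
      using c assms by (intro powr_mono') auto
    then show ?thesis using True by simp
  next
    case False
    then have "cmod w powr (-s) \<le> cmod w powr 0" using assms by (intro powr_mono) auto
    then show ?thesis using False \<open>w \<noteq> 0\<close> by simp
  qed
qed simp

lemma inverse_weakly_singular: "inverse (cmod w) \<le> indicator (cball 0 1) w * cmod w powr (-3/2) + 1"
  using powr_weakly_singular[of 1 w] by (cases "w = 0") (simp_all add: powr_minus)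

text \<open>The larger factor \<open>x\<close> satisfies \<open>c \<le> 2 * x\<close>. Splitting
  \<open>1/x\<close> into two factors \<open>x powr (-1/2)\<close>, one is bounded through
  \<open>c\<close> and the other through the smaller factor. The cruder \<open>c \<le> 4 * x\<close>
  keeps the constant rational.\<close>

lemma inverse_product_bound:
  fixes a b c :: real
  assumes a: "0 < a" and b: "0 < b" and c: "0 < c" "c \<le> a + b"
  shows "inverse a * inverse b \<le> 2 * c powr (-1/2) * (a powr (-3/2) + b powr (-3/2))"
proof -
  have *: "inverse x * inverse y \<le> 2 * c powr (-1/2) * y powr (-3/2)"
    if x: "0 < x" and y: "0 < y" "y \<le> x" "c \<le> x + y" for x y :: real
  proof -
    have c': "c powr (-1/2) = inverse (sqrt c)" and y': "y powr (-3/2) = inverse (sqrt y) * inverse y"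
      using c y powr_minus_half powr_minus_three_halves by auto
    have "sqrt c \<le> sqrt (4 * x)" using that c by (intro real_sqrt_le_mono) linarith
    then have "sqrt c \<le> 2 * sqrt x" by (simp add: real_sqrt_mult)
    then have 1: "inverse (sqrt x) \<le> 2 * inverse (sqrt c)" using c x by (simp add: field_simps)
    have 2: "inverse (sqrt x) \<le> inverse (sqrt y)"
      using that by (intro le_imp_inverse_le) auto
    have "inverse x = inverse (sqrt x) * inverse (sqrt x)"
      using x by (simp flip: inverse_mult_distrib)
    also have "\<dots> \<le> (2 * inverse (sqrt c)) * inverse (sqrt y)"
      by (intro mult_mono 1 2) (use c x in auto)
    finally have "inverse x * inverse y \<le> (2 * inverse (sqrt c)) * inverse (sqrt y) * inverse y"
      using y by (intro mult_right_mono) auto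
    then show ?thesis unfolding c' y' by (simp only: mult.assoc)
  qed
  show ?thesis
  proof (cases "b \<le> a")
    case True
    have "2 * c powr (-1/2) * b powr (-3/2) \<le> 2 * c powr (-1/2) * (a powr (-3/2) + b powr (-3/2))"
      by (intro mult_left_mono) auto
    then show ?thesis using *[OF a b True c(2)] by linarith
  next
    case False
    have "2 * c powr (-1/2) * a powr (-3/2) \<le> 2 * c powr (-1/2) * (a powr (-3/2) + b powr (-3/2))"
      by (intro mult_left_mono) auto
    moreover have "inverse b * inverse a \<le> 2 * c powr (-1/2) * a powr (-3/2)"
      using *[OF b a] False c by simp
    ultimately show ?thesis using mult.commute[of "inverse a" "inverse b"] by linarith
  qed
qed

text \<open>The planar Riesz potential of order 1, unnormalised. Values in \<open>ennreal\<close>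
  allow Tonelli before any finiteness is known; the diagonal point, where
  \<open>inverse 0 = 0\<close>, is null.\<close>

definition riesz_pot :: "(complex \<Rightarrow> ennreal) \<Rightarrow> complex \<Rightarrow> ennreal" where
  "riesz_pot f z = (\<integral>\<^sup>+\<zeta>. f \<zeta> * ennreal (inverse (cmod (z - \<zeta>))) \<partial>lborel)"

lemma measurable_riesz_pot [measurable]:
  assumes [measurable]: "f \<in> borel_measurable borel"
  shows "riesz_pot f \<in> borel_measurable borel"
  unfolding riesz_pot_def by measurable

text \<open>By Tonelli and the symmetry of the kernel, the uniform kernel bound is integrated
  against \<open>f\<close>. Potentials of integrable functions are thus locally integrable, which
  later provides both almost everywhere finiteness and majorants.\<close>

lemma nn_integral_riesz_pot:
  assumes [measurable]: "f \<in> borel_measurable borel" and r: "0 \<le> r"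
  shows "(\<integral>\<^sup>+z. indicator (cball a r) z * riesz_pot f z \<partial>lborel) \<le> ennreal (riesz_const r) * (\<integral>\<^sup>+\<zeta>. f \<zeta> \<partial>lborel)"
proof -
  have "(\<integral>\<^sup>+z. indicator (cball a r) z * riesz_pot f z \<partial>lborel)
      = (\<integral>\<^sup>+z. (\<integral>\<^sup>+\<zeta>. indicator (cball a r) z * (f \<zeta> * ennreal (inverse (cmod (z - \<zeta>)))) \<partial>lborel) \<partial>lborel)"
    unfolding riesz_pot_def by (intro nn_integral_cong nn_integral_cmult[symmetric]) measurable
  also have "\<dots> = (\<integral>\<^sup>+\<zeta>. (\<integral>\<^sup>+z. indicator (cball a r) z * (f \<zeta> * ennreal (inverse (cmod (z - \<zeta>)))) \<partial>lborel) \<partial>lborel)"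
    by (rule lborel_pair.Fubini') measurable
  also have "\<dots> = (\<integral>\<^sup>+\<zeta>. f \<zeta> * (\<integral>\<^sup>+z. indicator (cball a r) z * ennreal (inverse (cmod (\<zeta> - z))) \<partial>lborel) \<partial>lborel)"
    by (intro nn_integral_cong, subst nn_integral_cmult[symmetric]) (auto simp: norm_minus_commute mult_ac)
  also have "\<dots> \<le> (\<integral>\<^sup>+\<zeta>. f \<zeta> * ennreal (riesz_const r) \<partial>lborel)"
    using r by (intro nn_integral_mono mult_left_mono nn_integral_weakly_singular inverse_weakly_singular) auto
  also have "\<dots> = ennreal (riesz_const r) * (\<integral>\<^sup>+\<zeta>. f \<zeta> \<partial>lborel)"
    by (subst nn_integral_multc) (auto simp: mult.commute)
  finally show ?thesis .
qed

lemma AE_riesz_pot_finite: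
  assumes [measurable]: "f \<in> borel_measurable borel" and f: "(\<integral>\<^sup>+\<zeta>. f \<zeta> \<partial>lborel) < \<infinity>"
  shows "AE z in lborel. riesz_pot f z < \<infinity>"
proof -
  have "AE z in lborel. indicator (cball 0 (real n)) z * riesz_pot f z \<noteq> \<infinity>" for n
  proof (rule nn_integral_PInf_AE)
    have "(\<integral>\<^sup>+z. indicator (cball 0 (real n)) z * riesz_pot f z \<partial>lborel) < \<infinity>"
      using nn_integral_riesz_pot[OF assms(1), of "real n" 0] f
      by (auto simp: ennreal_mult_less_top intro: le_less_trans)
    then show "(\<integral>\<^sup>+z. indicator (cball 0 (real n)) z * riesz_pot f z \<partial>lborel) \<noteq> \<infinity>" by simp
  qed measurable
  then have "AE z in lborel. \<forall>n. indicator (cball 0 (real n)) z * riesz_pot f z \<noteq> \<infinity>"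
    by (subst AE_all_countable) blast
  then show ?thesis
  proof eventually_elim
    case (elim z)
    obtain n where "cmod z \<le> real n" using real_arch_simple by blast
    with elim[rule_format, of n] show ?case by (simp add: less_top)
  qed
qed

text \<open>The composition of two Riesz kernels of order 1 is dominated by the kernel
  \<open>\<bar>z - \<eta>\<bar> powr (-1/2)\<close>, which is locally square integrable.\<close>
lemma riesz_pot_twice:
  assumes [measurable]: "f \<in> borel_measurable borel" and r: "0 \<le> r"
  shows "riesz_pot (\<lambda>\<zeta>. indicator (cball a r) \<zeta> * riesz_pot f \<zeta>) z
     \<le> ennreal (4 * riesz_const r) * (\<integral>\<^sup>+\<eta>. f \<eta> * ennreal (cmod (z - \<eta>) powr (-1/2)) \<partial>lborel)"
proof -
  let ?I = "\<lambda>\<zeta>. indicator (cball a r) \<zeta> :: ennreal"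
  let ?k = "\<lambda>z \<zeta>. ennreal (inverse (cmod (z - \<zeta>)))"
  let ?q = "\<lambda>z \<zeta>. ennreal (cmod (z - \<zeta>) powr (-3/2))"
  have "riesz_pot (\<lambda>\<zeta>. ?I \<zeta> * riesz_pot f \<zeta>) z
      = (\<integral>\<^sup>+\<zeta>. (\<integral>\<^sup>+\<eta>. f \<eta> * (?I \<zeta> * (?k z \<zeta> * ?k \<zeta> \<eta>)) \<partial>lborel) \<partial>lborel)"
    unfolding riesz_pot_def
    by (intro nn_integral_cong, subst mult.assoc, subst mult.left_commute, subst mult.commute,
      subst nn_integral_multc[symmetric]) (auto simp: mult_ac intro!: nn_integral_cong)
  also have "\<dots> = (\<integral>\<^sup>+\<eta>. (\<integral>\<^sup>+\<zeta>. f \<eta> * (?I \<zeta> * (?k z \<zeta> * ?k \<zeta> \<eta>)) \<partial>lborel) \<partial>lborel)"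
    by (rule lborel_pair.Fubini') measurable
  also have "\<dots> = (\<integral>\<^sup>+\<eta>. f \<eta> * (\<integral>\<^sup>+\<zeta>. ?I \<zeta> * (?k z \<zeta> * ?k \<zeta> \<eta>) \<partial>lborel) \<partial>lborel)"
    by (intro nn_integral_cong nn_integral_cmult) measurable
  also have "\<dots> \<le> (\<integral>\<^sup>+\<eta>. f \<eta> * (ennreal (cmod (z - \<eta>) powr (-1/2)) * ennreal (4 * riesz_const r)) \<partial>lborel)"
  proof (rule nn_integral_mono_AE)
    show "AE \<eta> in lborel. f \<eta> * (\<integral>\<^sup>+\<zeta>. ?I \<zeta> * (?k z \<zeta> * ?k \<zeta> \<eta>) \<partial>lborel)
      \<le> f \<eta> * (ennreal (cmod (z - \<eta>) powr (-1/2)) * ennreal (4 * riesz_const r))"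
      \<comment> \<open>At \<open>\<eta> = z\<close> the right-hand kernel is
        \<open>0 powr (-1/2) = 0\<close> while the inner integral may be infinite, so this null
        point is removed first.\<close>
      using AE_lborel_singleton[of z]
    proof eventually_elim
      case (elim \<eta>)
      define c where "c = cmod (z - \<eta>)"
      have c: "c > 0" using elim by (simp add: c_def)
      have "(\<integral>\<^sup>+\<zeta>. ?I \<zeta> * (?k z \<zeta> * ?k \<zeta> \<eta>) \<partial>lborel)
          \<le> (\<integral>\<^sup>+\<zeta>. ennreal (2 * c powr (-1/2)) * (?I \<zeta> * ?q z \<zeta> + ?I \<zeta> * ?q \<eta> \<zeta>) \<partial>lborel)"
      proof (rule nn_integral_mono)
        fix \<zeta>
        have "inverse (cmod (z - \<zeta>)) * inverse (cmod (\<zeta> - \<eta>))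
            \<le> 2 * c powr (-1/2) * (cmod (z - \<zeta>) powr (-3/2) + cmod (\<eta> - \<zeta>) powr (-3/2))"
        proof (cases "\<zeta> = z \<or> \<zeta> = \<eta>")
          case False
          have "c \<le> cmod (z - \<zeta>) + cmod (\<zeta> - \<eta>)"
            using norm_triangle_ineq[of "z - \<zeta>" "\<zeta> - \<eta>"] by (simp add: c_def)
          moreover have "0 < cmod (z - \<zeta>)" "0 < cmod (\<zeta> - \<eta>)" using False by auto
          ultimately show ?thesis
            using inverse_product_bound[of "cmod (z - \<zeta>)" "cmod (\<zeta> - \<eta>)" c] c
            by (simp add: norm_minus_commute[of \<zeta> \<eta>] del: zero_less_norm_iff)
        qed auto
        then have "ennreal (inverse (cmod (z - \<zeta>)) * inverse (cmod (\<zeta> - \<eta>)))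
          \<le> ennreal (2 * c powr (-1/2) * (cmod (z - \<zeta>) powr (-3/2) + cmod (\<eta> - \<zeta>) powr (-3/2)))"
          by (rule ennreal_leI)
        then have "?k z \<zeta> * ?k \<zeta> \<eta> \<le> ennreal (2 * c powr (-1/2)) * (?q z \<zeta> + ?q \<eta> \<zeta>)"
          by (simp add: ennreal_mult)
        then show "?I \<zeta> * (?k z \<zeta> * ?k \<zeta> \<eta>) \<le> ennreal (2 * c powr (-1/2)) * (?I \<zeta> * ?q z \<zeta> + ?I \<zeta> * ?q \<eta> \<zeta>)"
          by (cases "\<zeta> \<in> cball a r") auto
      qed
      also have "\<dots> = ennreal (2 * c powr (-1/2)) *
          ((\<integral>\<^sup>+\<zeta>. ?I \<zeta> * ?q z \<zeta> \<partial>lborel) + (\<integral>\<^sup>+\<zeta>. ?I \<zeta> * ?q \<eta> \<zeta> \<partial>lborel))"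
        by (simp add: nn_integral_cmult nn_integral_add)
      also have "\<dots> \<le> ennreal (2 * c powr (-1/2)) * (ennreal (riesz_const r) + ennreal (riesz_const r))"
        using r powr_weakly_singular[of "3/2"]
        by (intro mult_left_mono add_mono nn_integral_weakly_singular) auto
      also have "\<dots> = ennreal (c powr (-1/2)) * ennreal (4 * riesz_const r)"
        by (simp add: riesz_const_nonneg ennreal_mult'[symmetric] ennreal_plus[symmetric] mult_ac del: ennreal_plus)
      finally show ?case unfolding c_def by (rule mult_left_mono) simp
    qed
  qed
  also have "\<dots> = ennreal (4 * riesz_const r) * (\<integral>\<^sup>+\<eta>. f \<eta> * ennreal (cmod (z - \<eta>) powr (-1/2)) \<partial>lborel)"
    by (subst nn_integral_cmult[symmetric]) (auto simp: mult_ac)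
  finally show ?thesis .
qed

section \<open>Interior regularity of weak solutions\<close>

text \<open>Bicomplex numbers have zero divisors and the Euclidean norm is not multiplicative;
  bounding the four component products separately gives the crude factor 4 that appears in the later
  constants.\<close>

lemma norm_bc_mult: "norm (U \<odot> X) \<le> 4 * norm U * norm X"
proof -
  obtain a b c d where UX: "U = (a, b)" "X = (c, d)" by (metis surj_pair)
  have n: "cmod a \<le> norm U" "cmod b \<le> norm U" "cmod c \<le> norm X" "cmod d \<le> norm X"
    using norm_fst_le[of a b] norm_snd_le[of b a] norm_fst_le[of c d] norm_snd_le[of d c] by (simp_all add: UX)
  have "norm (U \<odot> X) \<le> norm (a * c - b * d) + norm (a * d + b * c)"
    unfolding UX bc_mult_def by (simp add: norm_Pair_le)
  also have "\<dots> \<le> (norm (a * c) + norm (b * d)) + (norm (a * d) + norm (b * c))"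
    by (intro add_mono norm_triangle_ineq4 norm_triangle_ineq)
  also have "\<dots> \<le> (norm U * norm X + norm U * norm X) + (norm U * norm X + norm U * norm X)"
    unfolding norm_mult by (intro add_mono mult_mono n) auto
  finally show ?thesis by simp
qed

interpretation bc: bounded_bilinear bc_mult
proof
  show "\<exists>K. \<forall>a b. norm (a \<odot> b) \<le> norm a * norm b * K"
    using norm_bc_mult by (intro exI[of _ 4]) (simp add: mult_ac)
qed (auto simp: bc_mult_def algebra_simps scaleR_conv_of_real)

lemma bc_mult_assoc: "(U \<odot> X) \<odot> Y = U \<odot> (X \<odot> Y)"
  by (simp add: bc_mult_def algebra_simps)

lemma bc_mult_real: "U \<odot> (c *\<^sub>R (1, 0)) = c *\<^sub>R U"
  by (simp add: bc_mult_def scaleR_prod_def prod_eq_iff scaleR_conv_of_real)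

lemma measurable_bc_mult [measurable (raw)]:
  assumes [measurable]: "f \<in> borel_measurable M" "g \<in> borel_measurable M"
  shows "(\<lambda>x. f x \<odot> g x) \<in> borel_measurable M"
  by (rule borel_measurable_continuous_Pair[OF assms])
    (intro bc.continuous_on continuous_intros)

lemma integrable_bc_mult_bounded:
  assumes f: "integrable M f" and [measurable]: "g \<in> borel_measurable M" and g: "\<And>x. norm (g x) \<le> B"
  shows "integrable M (\<lambda>x. f x \<odot> g x)"
proof (rule Bochner_Integration.integrable_bound)
  show "integrable M (\<lambda>x. 4 * B * norm (f x))" using f by simp
  have [measurable]: "f \<in> borel_measurable M" using f by auto
  show "(\<lambda>x. f x \<odot> g x) \<in> borel_measurable M" by measurable
  have "norm (f x \<odot> g x) \<le> \<bar>4 * B * norm (f x)\<bar>" for x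
  proof -
    have "norm (f x \<odot> g x) \<le> 4 * norm (f x) * norm (g x)" by (rule norm_bc_mult)
    also have "\<dots> \<le> 4 * norm (f x) * B" by (intro mult_left_mono g) auto
    finally show ?thesis by (simp add: mult_ac)
  qed
  then show "AE x in M. norm (f x \<odot> g x) \<le> norm (4 * B * norm (f x))" by simp
qed

lemma cutoff_le_1: "cutoff a r \<zeta> \<le> 1"
  by (simp add: cutoff_def bump_def)

text \<open>This is \<open>s^2 / 2 \<le> exp s\<close> at \<open>s = 1 / t\<close>.\<close>

lemma bump_2_le: "bump 2 t \<le> 2"
proof (cases "t > 0")
  case True
  have "0 \<le> 1 / t" using True by simp
  then have "1 + 1 / t + (1 / t)\<^sup>2 / 2 \<le> exp (1 / t)" by (rule exp_lower_Taylor_quadratic)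
  then have "(1 / t)\<^sup>2 \<le> 2 * exp (1 / t)" using \<open>0 \<le> 1 / t\<close> by linarith
  then have "(1 / t)\<^sup>2 / exp (1 / t) \<le> 2" by (simp only: pos_divide_le_eq exp_gt_zero)
  moreover have "bump 2 t = (1 / t)\<^sup>2 / exp (1 / t)"
    using True by (simp add: bump_def power_divide exp_minus divide_inverse mult_ac power_inverse)
  ultimately show ?thesis by simp
qed (simp add: bump_def)

lemma norm_cutoff_dbar:
  assumes "0 \<le> r" shows "norm (cutoff_dbar a r \<zeta>) \<le> 2 * r"
proof (cases "\<zeta> \<in> cball a r")
  case True
  have "norm (complex_of_real (Re \<zeta> - Re a), complex_of_real (Im \<zeta> - Im a)) = cmod (\<zeta> - a)"
    unfolding norm_prod_def cmod_def by simp
  then have "norm (cutoff_dbar a r \<zeta>) = \<bar>bump 2 (r\<^sup>2 - rsq a \<zeta>)\<bar> * cmod (\<zeta> - a)"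
    unfolding cutoff_dbar_def norm_scaleR by simp
  also have "\<dots> \<le> 2 * r" using True bump_2_le bump_nonneg
    by (intro mult_mono) (auto simp: dist_norm norm_minus_commute)
  finally show ?thesis .
qed (simp add: cutoff_dbar_outside assms)

lemma measurable_cutoff [measurable]: "cutoff a r \<in> borel_measurable borel"
  by (rule borel_measurable_continuous_onI[OF continuous_cutoff])

lemma measurable_cutoff_dbar [measurable]: "cutoff_dbar a r \<in> borel_measurable borel"
  by (rule borel_measurable_continuous_onI[OF continuous_cutoff_dbar])

text \<open>On the half disc \<open>r^2 - |\<zeta> - a|^2\<close> is at least
  \<open>r^2 - (r/2)^2\<close>, and \<open>exp (-1/t)\<close> increases with \<open>t\<close>. This
  positive floor makes division by the cutoff harmless.\<close>

lemma cutoff_ge: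
  assumes "0 < r" "\<zeta> \<in> cball a (r / 2)"
  shows "bump 0 (3 / 4 * r\<^sup>2) \<le> cutoff a r \<zeta>"
proof -
  have "rsq a \<zeta> \<le> (r / 2)\<^sup>2"
    using assms unfolding rsq_eq by (intro power_mono) (auto simp: dist_norm norm_minus_commute)
  then have le: "3 / 4 * r\<^sup>2 \<le> r\<^sup>2 - rsq a \<zeta>" by (simp add: power_divide)
  have pos: "0 < 3 / 4 * r\<^sup>2" using assms by simp
  have pos': "0 < r\<^sup>2 - rsq a \<zeta>" using le pos by linarith
  have "1 / (r\<^sup>2 - rsq a \<zeta>) \<le> 1 / (3 / 4 * r\<^sup>2)" using le pos by (intro divide_left_mono mult_pos_pos) linarith+
  then have "exp (- (1 / (3 / 4 * r\<^sup>2))) \<le> exp (- (1 / (r\<^sup>2 - rsq a \<zeta>)))" by simp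
  then show ?thesis using pos pos' by (simp only: cutoff_def bump_def if_True power_0 div_by_1)
qed

lemma ennreal_le_sqrt:
  assumes "x\<^sup>2 \<le> ennreal y" "0 \<le> y" shows "x \<le> ennreal (sqrt y)"
proof (cases x)
  case (real r)
  with assms have "r\<^sup>2 \<le> y" by (simp add: ennreal_power)
  then show ?thesis using real by (simp add: ennreal_leI real_le_rsqrt)
next
  case top
  then show ?thesis using assms by (simp add: power2_eq_square ennreal_mult_top top_unique)
qed

section \<open>Cauchy representation of a solution on a disc\<close>

text \<open>Here \<open>a\<close> is the centre of a disc, not the coefficient. \<open>W\<close> and
  \<open>V\<close> are Borel functions on the whole plane; \<open>V\<close> stands for the
  right-hand side of the equation, of which only the bound by \<open>C * norm (W \<zeta>)\<close> is
  kept, and the weak equation is retained just for the truncated kernels on concentric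
  discs.\<close>

locale local_solution =
  fixes a :: complex and R C :: real and W V :: "complex \<Rightarrow> bicomplex"
  assumes R: "0 < R" and C: "0 \<le> C"
    and W_int: "integrable lborel W" and W_sq: "integrable lborel (\<lambda>\<zeta>. (norm (W \<zeta>))\<^sup>2)"
    and V_meas [measurable]: "V \<in> borel_measurable borel"
    and V_bound: "AE \<zeta> in lborel. norm (V \<zeta>) \<le> C * norm (W \<zeta>)"
    and weak: "\<And>r e z. 0 < r \<Longrightarrow> r \<le> R \<Longrightarrow> 0 < e \<Longrightarrow>
      (\<integral>\<zeta>. W \<zeta> \<odot> dbar (kern_test a r e z) \<zeta> \<partial>lborel) = - (\<integral>\<zeta>. V \<zeta> \<odot> kern_test a r e z \<zeta> \<partial>lborel)"
begin

lemma W_meas [measurable]: "W \<in> borel_measurable borel"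
  using W_int by auto

text \<open>The weak \<open>dbar\<close>-derivative of the cutoff times \<open>W\<close>, by the
  Leibniz rule with \<open>V\<close> as derivative of \<open>W\<close>.\<close>

definition F :: "real \<Rightarrow> complex \<Rightarrow> bicomplex" where
  "F r \<zeta> = W \<zeta> \<odot> cutoff_dbar a r \<zeta> + cutoff a r \<zeta> *\<^sub>R V \<zeta>"

text \<open>The 8 is the constant 4 of \<open>norm_bc_mult\<close> times the 2 of
  \<open>norm_cutoff_dbar\<close>.\<close>

definition D :: real where "D = 8 * R + C"

definition fW :: "real \<Rightarrow> complex \<Rightarrow> real" where
  "fW r \<zeta> = indicator (cball a r) \<zeta> * norm (W \<zeta>)"

text \<open>Up to the factor pi, the Cauchy transform of \<open>F r\<close> when
  \<open>e = 0\<close>, and its regularisation when \<open>e > 0\<close>.\<close>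

definition u :: "real \<Rightarrow> real \<Rightarrow> complex \<Rightarrow> bicomplex" where
  "u r e z = (\<integral>\<zeta>. F r \<zeta> \<odot> kern e (z - \<zeta>) \<partial>lborel)"

lemma D_nonneg: "0 \<le> D" using R C by (simp add: D_def)

lemma fW_nonneg: "0 \<le> fW r \<zeta>" by (simp add: fW_def)

lemma measurable_fW [measurable]: "fW r \<in> borel_measurable borel"
  unfolding fW_def by measurable

lemma measurable_F [measurable]: "F r \<in> borel_measurable borel"
  unfolding F_def by measurable

lemma measurable_u [measurable]: "u r e \<in> borel_measurable borel"
  unfolding u_def by measurable

lemma F_bound:
  assumes "0 < r" "r \<le> R"
  shows "AE \<zeta> in lborel. norm (F r \<zeta>) \<le> D * fW r \<zeta>"
  using V_bound
proof eventually_elim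
  case (elim \<zeta>)
  show ?case
  proof (cases "\<zeta> \<in> cball a r")
    case True
    have "norm (F r \<zeta>) \<le> norm (W \<zeta> \<odot> cutoff_dbar a r \<zeta>) + norm (cutoff a r \<zeta> *\<^sub>R V \<zeta>)"
      unfolding F_def by (rule norm_triangle_ineq)
    also have "norm (W \<zeta> \<odot> cutoff_dbar a r \<zeta>) \<le> 4 * norm (W \<zeta>) * (2 * R)"
      by (rule order_trans[OF norm_bc_mult mult_left_mono])
        (use norm_cutoff_dbar[of r a \<zeta>] assms in auto)
    also have "norm (cutoff a r \<zeta> *\<^sub>R V \<zeta>) \<le> 1 * norm (V \<zeta>)"
      unfolding norm_scaleR using cutoff_nonneg[of a r \<zeta>] cutoff_le_1[of a r \<zeta>] by (intro mult_right_mono) auto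
    finally show ?thesis using elim True by (simp add: D_def fW_def algebra_simps)
  next
    case False
    then show ?thesis using assms
      by (simp add: F_def cutoff_outside cutoff_dbar_outside fW_def bc.zero_right)
  qed
qed

lemma integrable_fW: "integrable lborel (fW r)"
  unfolding fW_def using integrable_mult_indicator[OF _ integrable_norm[OF W_int], of "cball a r"] by simp

lemma integrable_F:
  assumes "0 < r" "r \<le> R" shows "integrable lborel (F r)"
proof (rule Bochner_Integration.integrable_bound)
  show "integrable lborel (\<lambda>\<zeta>. D * fW r \<zeta>)" using integrable_fW by simp
  show "AE \<zeta> in lborel. norm (F r \<zeta>) \<le> norm (D * fW r \<zeta>)"
    using F_bound[OF assms] by eventually_elim simp
qed measurable

lemma integrable_F_kern:
  assumes "0 < r" "r \<le> R" "0 < e" shows "integrable lborel (\<lambda>\<zeta>. F r \<zeta> \<odot> kern e (z - \<zeta>))"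
  by (rule integrable_bc_mult_bounded[OF integrable_F, where B="1/e"])
    (use assms norm_kern_le_inverse in auto)

text \<open>The weak equation for \<open>kern_test\<close>, rearranged after its \<open>dbar\<close>
  is expanded. It holds for every \<open>z\<close> and every \<open>e > 0\<close>; exceptional null
  sets arise only in the limit.\<close>

lemma mollified:
  assumes r: "0 < r" "r \<le> R" and e: "0 < e"
  shows "(\<integral>\<zeta>. approx_delta e (z - \<zeta>) *\<^sub>R (cutoff a r \<zeta> *\<^sub>R W \<zeta>) \<partial>lborel) = u r e z"
proof -
  let ?A = "\<lambda>\<zeta>. (W \<zeta> \<odot> cutoff_dbar a r \<zeta>) \<odot> kern e (z - \<zeta>)"
  let ?B = "\<lambda>\<zeta>. approx_delta e (z - \<zeta>) *\<^sub>R (cutoff a r \<zeta> *\<^sub>R W \<zeta>)"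
  let ?E = "\<lambda>\<zeta>. (cutoff a r \<zeta> *\<^sub>R V \<zeta>) \<odot> kern e (z - \<zeta>)"
  have k: "norm (kern e (z - \<zeta>)) \<le> 1 / e" for \<zeta> using norm_kern_le_inverse[OF e] .
  have iA: "integrable lborel ?A"
    by (intro integrable_bc_mult_bounded[where B="1/e"] integrable_bc_mult_bounded[where B="2 * r"] W_int norm_cutoff_dbar k)
      (use r in auto)
  have iE: "integrable lborel ?E"
  proof (intro integrable_bc_mult_bounded[where B="1/e"] k)
    show "integrable lborel (\<lambda>\<zeta>. cutoff a r \<zeta> *\<^sub>R V \<zeta>)"
    proof (rule Bochner_Integration.integrable_bound)
      show "integrable lborel (\<lambda>\<zeta>. C * norm (W \<zeta>))" using W_int by simp
      show "AE \<zeta> in lborel. norm (cutoff a r \<zeta> *\<^sub>R V \<zeta>) \<le> norm (C * norm (W \<zeta>))"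
        using V_bound
      proof eventually_elim
        case (elim \<zeta>)
        have "norm (cutoff a r \<zeta> *\<^sub>R V \<zeta>) \<le> 1 * norm (V \<zeta>)"
          unfolding norm_scaleR using cutoff_nonneg[of a r \<zeta>] cutoff_le_1[of a r \<zeta>] by (intro mult_right_mono) auto
        then show ?case using elim C by simp
      qed
    qed measurable
  qed measurable
  have iB: "integrable lborel ?B"
  proof (rule Bochner_Integration.integrable_bound)
    show "integrable lborel (\<lambda>\<zeta>. (1 / e\<^sup>2) * norm (W \<zeta>))" using W_int by simp
    show "AE \<zeta> in lborel. norm (?B \<zeta>) \<le> norm ((1 / e\<^sup>2) * norm (W \<zeta>))"
    proof (intro AE_I2)
      fix \<zeta>
      have "norm (?B \<zeta>) \<le> (1 / e\<^sup>2) * (1 * norm (W \<zeta>))"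
        unfolding norm_scaleR using cutoff_nonneg[of a r \<zeta>] cutoff_le_1[of a r \<zeta>] approx_delta_bound[OF e, of "z - \<zeta>"]
        by (intro mult_mono) auto
      then show "norm (?B \<zeta>) \<le> norm ((1 / e\<^sup>2) * norm (W \<zeta>))" by simp
    qed
  qed measurable
  have "W \<zeta> \<odot> dbar (kern_test a r e z) \<zeta> = ?A \<zeta> - ?B \<zeta>" for \<zeta>
    unfolding dbar_kern_test[OF e] bc.diff_right bc_mult_real bc_mult_assoc by (simp add: mult.commute)
  moreover have "V \<zeta> \<odot> kern_test a r e z \<zeta> = ?E \<zeta>" for \<zeta>
    by (simp add: kern_test_def bc.scaleR_left bc.scaleR_right)
  ultimately have "(\<integral>\<zeta>. ?A \<zeta> - ?B \<zeta> \<partial>lborel) = - (\<integral>\<zeta>. ?E \<zeta> \<partial>lborel)"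
    using weak[OF r e, of z] by simp
  then have "(\<integral>\<zeta>. ?B \<zeta> \<partial>lborel) = (\<integral>\<zeta>. ?A \<zeta> \<partial>lborel) + (\<integral>\<zeta>. ?E \<zeta> \<partial>lborel)"
    using iA iB by (simp add: algebra_simps)
  also have "\<dots> = u r e z"
    unfolding u_def F_def bc.add_left using iA iE by simp
  finally show ?thesis .
qed

lemma F_kern_bound:
  assumes "0 < r" "r \<le> R"
  shows "AE \<zeta> in lborel. norm (F r \<zeta> \<odot> kern e (z - \<zeta>)) \<le> 4 * D * (fW r \<zeta> * inverse (cmod (z - \<zeta>)))"
  using F_bound[OF assms]
proof eventually_elim
  case (elim \<zeta>)
  have "norm (F r \<zeta> \<odot> kern e (z - \<zeta>)) \<le> 4 * norm (F r \<zeta>) * norm (kern e (z - \<zeta>))" by (rule norm_bc_mult)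
  also have "\<dots> \<le> 4 * (D * fW r \<zeta>) * inverse (cmod (z - \<zeta>))"
    using elim norm_kern_le by (intro mult_mono) (auto simp: D_nonneg fW_nonneg)
  finally show ?case by (simp add: mult_ac)
qed

abbreviation "pot r \<equiv> riesz_pot (\<lambda>\<zeta>. ennreal (fW r \<zeta>))"

lemma norm_u_le:
  assumes "0 < r" "r \<le> R"
  shows "ennreal (norm (u r e z)) \<le> ennreal (4 * D) * pot r z"
proof (cases "integrable lborel (\<lambda>\<zeta>. F r \<zeta> \<odot> kern e (z - \<zeta>))")
  case True
  have "ennreal (norm (u r e z)) \<le> (\<integral>\<^sup>+\<zeta>. ennreal (norm (F r \<zeta> \<odot> kern e (z - \<zeta>))) \<partial>lborel)"
    unfolding u_def by (rule integral_norm_bound_ennreal[OF True])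
  also have "\<dots> \<le> (\<integral>\<^sup>+\<zeta>. ennreal (4 * D) * (ennreal (fW r \<zeta>) * ennreal (inverse (cmod (z - \<zeta>)))) \<partial>lborel)"
  proof (rule nn_integral_mono_AE)
    show "AE \<zeta> in lborel. ennreal (norm (F r \<zeta> \<odot> kern e (z - \<zeta>)))
      \<le> ennreal (4 * D) * (ennreal (fW r \<zeta>) * ennreal (inverse (cmod (z - \<zeta>))))"
      using F_kern_bound[OF assms, of e z]
      by eventually_elim (simp add: ennreal_mult[symmetric] fW_nonneg D_nonneg ennreal_leI)
  qed
  also have "\<dots> = ennreal (4 * D) * pot r z"
    unfolding riesz_pot_def by (rule nn_integral_cmult) measurable
  finally show ?thesis .
next
  \<comment> \<open>A non-integrable function has Bochner integral 0 by convention, so the bound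
    holds here too.\<close>
  case False
  then show ?thesis by (simp add: u_def not_integrable_integral_eq)
qed

lemma fW_kernel_integrable:
  assumes "pot r z < \<infinity>"
  shows "integrable lborel (\<lambda>\<zeta>. fW r \<zeta> * inverse (cmod (z - \<zeta>)))"
proof (rule integrableI_nonneg)
  show "(\<integral>\<^sup>+\<zeta>. ennreal (fW r \<zeta> * inverse (cmod (z - \<zeta>))) \<partial>lborel) < \<infinity>"
    using assms unfolding riesz_pot_def by (simp add: ennreal_mult fW_nonneg)
qed (auto simp: fW_nonneg)

lemma u_tendsto:
  assumes r: "0 < r" "r \<le> R" and fin: "pot r z < \<infinity>" and e: "e \<longlonglongrightarrow> 0"
  shows "(\<lambda>n. u r (e n) z) \<longlonglongrightarrow> u r 0 z"
  unfolding u_def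
proof (rule integral_dominated_convergence)
  show "integrable lborel (\<lambda>\<zeta>. 4 * D * (fW r \<zeta> * inverse (cmod (z - \<zeta>))))"
    using fW_kernel_integrable[OF fin] by simp
  show "AE \<zeta> in lborel. (\<lambda>n. F r \<zeta> \<odot> kern (e n) (z - \<zeta>)) \<longlonglongrightarrow> F r \<zeta> \<odot> kern 0 (z - \<zeta>)"
    by (intro AE_I2 bc.tendsto tendsto_const kern_tendsto e)
  show "AE \<zeta> in lborel. norm (F r \<zeta> \<odot> kern (e n) (z - \<zeta>)) \<le> 4 * D * (fW r \<zeta> * inverse (cmod (z - \<zeta>)))" for n
    by (rule F_kern_bound[OF r])
qed measurable

lemma nn_integral_fW_finite: "(\<integral>\<^sup>+\<zeta>. ennreal (fW r \<zeta>) \<partial>lborel) < \<infinity>"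
  using integrable_fW[of r] unfolding integrable_iff_bounded by (simp add: fW_nonneg)

text \<open>The two sides of \<open>mollified\<close> have separate limits: the Cauchy transforms
  converge to \<open>u r 0 z\<close> wherever the potential is finite, and
  \<open>approx_identity_AE\<close> identifies the limit of the mollifications.\<close>

lemma representation:
  assumes r: "0 < r" "r \<le> R"
  shows "AE z in lborel. u r 0 z = (delta_mass * cutoff a r z) *\<^sub>R W z"
proof -
  define e where "e n = 1 / real (Suc n)" for n
  have e: "e n > 0" "e \<longlonglongrightarrow> 0" for n
    unfolding e_def using LIMSEQ_inverse_real_of_nat by (auto simp: inverse_eq_divide)
  have m: "(\<integral>\<zeta>. approx_delta (e n) (z - \<zeta>) *\<^sub>R (cutoff a r \<zeta> *\<^sub>R W \<zeta>) \<partial>lborel) = u r (e n) z" for n z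
    by (rule mollified[OF r e(1)])
  have fin: "AE z in lborel. pot r z < \<infinity>"
    by (rule AE_riesz_pot_finite[OF _ nn_integral_fW_finite]) measurable
  have "AE z in lborel. u r 0 z = delta_mass *\<^sub>R (cutoff a r z *\<^sub>R W z)"
  proof (rule approx_identity_AE[OF _ _ e])
    show "integrable lborel (\<lambda>z. cutoff a r z *\<^sub>R W z)"
    proof (rule Bochner_Integration.integrable_bound[OF W_int])
      show "AE z in lborel. norm (cutoff a r z *\<^sub>R W z) \<le> norm (W z)"
        using cutoff_nonneg cutoff_le_1 by (intro AE_I2) (simp add: mult_left_le_one_le)
    qed measurable
    show "AE z in lborel. (\<lambda>n. \<integral>\<zeta>. approx_delta (e n) (z - \<zeta>) *\<^sub>R (cutoff a r \<zeta> *\<^sub>R W \<zeta>) \<partial>lborel) \<longlonglongrightarrow> u r 0 z"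
      unfolding m using fin by eventually_elim (rule u_tendsto[OF r _ e(2)])
    fix p q :: complex
    obtain N where N: "box p q \<subseteq> cball 0 N" "0 \<le> N"
    proof -
      obtain b where "b > 0" "\<forall>x\<in>box p q. cmod x \<le> b"
        using bounded_box[of p q] unfolding bounded_pos by blast
      moreover from this have "box p q \<subseteq> cball 0 b" unfolding subset_iff mem_cball dist_norm by simp
      ultimately show ?thesis using that[of b] by simp
    qed
    \<comment> \<open>A majorant independent of \<open>n\<close>: the potential, cut to a disc
      containing the box, has finite integral by \<open>nn_integral_riesz_pot\<close>.\<close>
    let ?G = "\<lambda>z. enn2real (ennreal (4 * D) * (indicator (cball 0 N) z * pot r z))"
    have "integrable lborel ?G"
    proof (rule integrableI_nonneg)
      have "(\<integral>\<^sup>+z. ennreal (?G z) \<partial>lborel) \<le> (\<integral>\<^sup>+z. ennreal (4 * D) * (indicator (cball 0 N) z * pot r z) \<partial>lborel)"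
        by (intro nn_integral_mono) (auto simp: ennreal_enn2real_if)
      also have "\<dots> = ennreal (4 * D) * (\<integral>\<^sup>+z. indicator (cball 0 N) z * pot r z \<partial>lborel)"
        by (rule nn_integral_cmult) measurable
      also have "\<dots> \<le> ennreal (4 * D) * (ennreal (riesz_const N) * (\<integral>\<^sup>+\<zeta>. ennreal (fW r \<zeta>) \<partial>lborel))"
        using N by (intro mult_left_mono nn_integral_riesz_pot) auto
      also have "\<dots> < \<infinity>" using nn_integral_fW_finite[of r] by (simp add: ennreal_mult_less_top)
      finally show "(\<integral>\<^sup>+z. ennreal (?G z) \<partial>lborel) < \<infinity>" .
    qed auto
    moreover have "\<forall>n. AE z in lborel. z \<in> box p q \<longrightarrow> norm (u r (e n) z) \<le> ?G z"
    proof
      fix n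
      show "AE z in lborel. z \<in> box p q \<longrightarrow> norm (u r (e n) z) \<le> ?G z"
        using fin
      proof eventually_elim
        case (elim z)
        show ?case
        proof
          assume "z \<in> box p q"
          then have "z \<in> cball 0 N" using N by blast
          then have "ennreal (4 * D) * (indicator (cball 0 N) z * pot r z) = ennreal (4 * D) * pot r z" by simp
          moreover have "enn2real (ennreal (norm (u r (e n) z))) \<le> enn2real (ennreal (4 * D) * pot r z)"
            using elim by (intro enn2real_mono norm_u_le r) (auto simp: ennreal_mult_less_top)
          ultimately show "norm (u r (e n) z) \<le> ?G z" by simp
        qed
      qed
    qed
    ultimately show "\<exists>G. integrable lborel G \<and> (\<forall>n. AE z in lborel. z \<in> box p q \<longrightarrow>
        norm (\<integral>\<zeta>. approx_delta (e n) (z - \<zeta>) *\<^sub>R (cutoff a r \<zeta> *\<^sub>R W \<zeta>) \<partial>lborel) \<le> G z)"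
      unfolding m by blast
  qed measurable
  then show ?thesis by simp
qed

end

text \<open>The factor \<open>4 * D\<close> of \<open>norm_u_le\<close> over the floor of
  \<open>delta_mass * cutoff\<close> on the half disc. The constants are defined outside the locale,
  as functions of disc and coefficient bound, so that they are visibly the same for all
  solutions.\<close>

definition pot_const :: "real \<Rightarrow> real \<Rightarrow> real \<Rightarrow> real" where
  "pot_const R C r = 4 * (8 * R + C) / (delta_mass * bump 0 (3 / 4 * r\<^sup>2))"

text \<open>Factor by factor: the potential bound at radius \<open>R/2\<close>, the one at radius
  \<open>R\<close>, the composition of two kernels, and Cauchy-Schwarz with the half-order
  kernel.\<close>

definition bound_const :: "real \<Rightarrow> real \<Rightarrow> real" where
  "bound_const R C = pot_const R C (R/2) * pot_const R C R * (4 * riesz_const R) * sqrt (riesz_const R)"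

text \<open>The supremum bound for \<open>u (R/4) 0\<close> divided by \<open>delta_mass\<close>
  times the cutoff at the centre.\<close>

definition value_const :: "complex \<Rightarrow> real \<Rightarrow> real \<Rightarrow> real" where
  "value_const a R C = 4 * (8 * R + C) * bound_const R C * riesz_const R / (delta_mass * cutoff a (R/4) a)"

section \<open>From square integrable to bounded to continuous\<close>

context local_solution
begin

lemma pot_const_nonneg: "0 \<le> pot_const R C r"
  using R C delta_mass_pos bump_nonneg by (simp add: pot_const_def)

lemma bound_const_nonneg: "0 \<le> bound_const R C"
  by (simp add: bound_const_def pot_const_nonneg riesz_const_nonneg)

definition N where "N = sqrt (\<integral>\<zeta>. (norm (W \<zeta>))\<^sup>2 \<partial>lborel)"

lemma N_nonneg: "0 \<le> N" by (simp add: N_def)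

lemma nn_integral_W_sq: "(\<integral>\<^sup>+\<zeta>. ennreal ((norm (W \<zeta>))\<^sup>2) \<partial>lborel) = ennreal (N\<^sup>2)"
  using W_sq by (simp add: nn_integral_eq_integral N_def)

text \<open>The representation is divided by the cutoff, whose floor is available on the half disc;
  this is why every use costs half of the radius.\<close>

lemma norm_W_le_pot:
  assumes r: "0 < r" "r \<le> R"
  shows "AE z in lborel. z \<in> cball a (r/2) \<longrightarrow> ennreal (norm (W z)) \<le> ennreal (pot_const R C r) * pot r z"
  using representation[OF r]
proof eventually_elim
  case (elim z)
  let ?m = "bump 0 (3 / 4 * r\<^sup>2)"
  have m: "0 < delta_mass * ?m" using r by (intro mult_pos_pos delta_mass_pos bump_pos) auto
  define k where "k = inverse (delta_mass * ?m)"
  have k: "0 \<le> k" unfolding k_def by (intro less_imp_le positive_imp_inverse_positive m)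
  show ?case
  proof
    assume z: "z \<in> cball a (r/2)"
    have "delta_mass * ?m * norm (W z) \<le> delta_mass * cutoff a r z * norm (W z)"
      using cutoff_ge[OF r(1) z] delta_mass_pos by (intro mult_right_mono mult_left_mono) auto
    also have "\<dots> = norm (u r 0 z)" unfolding elim norm_scaleR
      using delta_mass_pos cutoff_nonneg[of a r z] by simp
    finally have "norm (W z) * (delta_mass * ?m) \<le> norm (u r 0 z)" by (subst mult.commute)
    then have "norm (W z) \<le> norm (u r 0 z) / (delta_mass * ?m)" by (subst pos_le_divide_eq[OF m])
    then have le: "norm (W z) \<le> k * norm (u r 0 z)"
      unfolding k_def divide_inverse by (subst mult.commute)
    have "ennreal (norm (W z)) \<le> ennreal k * ennreal (norm (u r 0 z))"
      using ennreal_leI[OF le] unfolding ennreal_mult[OF k norm_ge_zero] .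
    also have "\<dots> \<le> ennreal k * (ennreal (4 * D) * pot r z)"
      by (intro mult_left_mono norm_u_le r) simp
    also have "\<dots> = ennreal (k * (4 * D)) * pot r z"
    proof -
      have "ennreal (k * (4 * D)) = ennreal k * ennreal (4 * D)"
        by (rule ennreal_mult[OF k]) (use D_nonneg in simp)
      then show ?thesis by (simp only: mult.assoc)
    qed
    also have "k * (4 * D) = pot_const R C r"
      by (simp only: pot_const_def D_def k_def divide_inverse mult_ac)
    finally show "ennreal (norm (W z)) \<le> ennreal (pot_const R C r) * pot r z" .
  qed
qed

text \<open>Cauchy-Schwarz: squaring turns \<open>|w| powr (-1/2)\<close> into
  \<open>|w| powr (-1)\<close>, which falls under the uniform bound for weakly singular
  kernels.\<close>

lemma half_order_potential:
  "(\<integral>\<^sup>+\<eta>. ennreal (fW R \<eta>) * ennreal (cmod (z - \<eta>) powr (-1/2)) \<partial>lborel) \<le> ennreal (sqrt (riesz_const R) * N)"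
proof -
  let ?g = "\<lambda>\<eta>. indicator (cball a R) \<eta> * ennreal (cmod (z - \<eta>) powr (-1/2))"
  have "(\<integral>\<^sup>+\<eta>. ennreal (fW R \<eta>) * ennreal (cmod (z - \<eta>) powr (-1/2)) \<partial>lborel)
      = (\<integral>\<^sup>+\<eta>. ennreal (norm (W \<eta>)) * ?g \<eta> \<partial>lborel)"
    by (intro nn_integral_cong) (auto simp: fW_def indicator_def)
  also have "\<dots> \<le> ennreal (sqrt (riesz_const R * N\<^sup>2))"
  proof (rule ennreal_le_sqrt)
    have CS: "(\<integral>\<^sup>+\<eta>. ennreal (norm (W \<eta>)) * ?g \<eta> \<partial>lborel)\<^sup>2
      \<le> (\<integral>\<^sup>+\<eta>. (ennreal (norm (W \<eta>)))\<^sup>2 \<partial>lborel) * (\<integral>\<^sup>+\<eta>. (?g \<eta>)\<^sup>2 \<partial>lborel)"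
      by (rule Cauchy_Schwarz_nn_integral) measurable
    have W2: "(\<integral>\<^sup>+\<eta>. (ennreal (norm (W \<eta>)))\<^sup>2 \<partial>lborel) = ennreal (N\<^sup>2)"
      by (simp add: ennreal_power nn_integral_W_sq)
    have "(?g \<eta>)\<^sup>2 = indicator (cball a R) \<eta> * ennreal (cmod (z - \<eta>) powr (-1))" for \<eta>
    proof -
      have "(cmod (z - \<eta>) powr (-1/2))\<^sup>2 = cmod (z - \<eta>) powr (-1)"
        unfolding power2_eq_square powr_add[symmetric] by simp
      then show ?thesis by (auto simp: indicator_def ennreal_power)
    qed
    then have "(\<integral>\<^sup>+\<eta>. (?g \<eta>)\<^sup>2 \<partial>lborel) \<le> ennreal (riesz_const R)"
      using R powr_weakly_singular[of 1] nn_integral_weakly_singular[of "\<lambda>w. cmod w powr (-1)" R R a z] by simp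
    from order_trans[OF CS[unfolded W2] mult_left_mono[OF this zero_le]]
    show "(\<integral>\<^sup>+\<eta>. ennreal (norm (W \<eta>)) * ?g \<eta> \<partial>lborel)\<^sup>2 \<le> ennreal (riesz_const R * N\<^sup>2)"
      by (simp only: ennreal_mult[OF riesz_const_nonneg zero_le_power2] mult.commute)
  qed (simp add: riesz_const_nonneg)
  finally show ?thesis using N_nonneg by (simp add: real_sqrt_mult)
qed

lemma riesz_pot_mono_AE:
  assumes "AE \<zeta> in lborel. f \<zeta> \<le> g \<zeta>" shows "riesz_pot f z \<le> riesz_pot g z"
  unfolding riesz_pot_def
  by (rule nn_integral_mono_AE) (use assms in \<open>eventually_elim, auto intro: mult_right_mono\<close>)

text \<open>The potential bound on the disc of radius \<open>R/2\<close> is inserted into the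
  potential that bounds \<open>W\<close> on radius \<open>R/4\<close>. Two kernels are then
  composed, and the half-order estimate yields a supremum bound.\<close>

lemma norm_W_bound:
  "AE z in lborel. z \<in> cball a (R/4) \<longrightarrow> norm (W z) \<le> bound_const R C * N"
proof -
  let ?I = "\<lambda>\<zeta>. indicator (cball a (R/2)) \<zeta> :: ennreal"
  let ?p = "ennreal (pot_const R C R)" and ?q = "ennreal (pot_const R C (R/2))"
  have b1: "AE \<zeta> in lborel. ennreal (fW (R/2) \<zeta>) \<le> ?p * (?I \<zeta> * pot R \<zeta>)"
  proof -
    have "AE z in lborel. z \<in> cball a (R/2) \<longrightarrow> ennreal (norm (W z)) \<le> ?p * pot R z"
      using R by (intro norm_W_le_pot) auto
    then show ?thesis
    proof eventually_elim
      case (elim z)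
      then show ?case by (cases "z \<in> cball a (R/2)") (simp_all add: fW_def)
    qed
  qed
  have b2: "pot (R/2) z \<le> ?p * (ennreal (4 * riesz_const R) * ennreal (sqrt (riesz_const R) * N))" for z
  proof -
    have "riesz_pot (\<lambda>\<zeta>. ?I \<zeta> * pot R \<zeta>) z \<le> riesz_pot (\<lambda>\<zeta>. indicator (cball a R) \<zeta> * pot R \<zeta>) z"
    proof (intro riesz_pot_mono_AE AE_I2)
      fix \<zeta>
      have "cball a (R/2) \<subseteq> cball a R" using R by (intro subset_cball) simp
      then show "?I \<zeta> * pot R \<zeta> \<le> indicator (cball a R) \<zeta> * pot R \<zeta>"
        by (intro mult_right_mono) (auto simp: indicator_def)
    qed
    also have "\<dots> \<le> ennreal (4 * riesz_const R) * (\<integral>\<^sup>+\<eta>. ennreal (fW R \<eta>) * ennreal (cmod (z - \<eta>) powr (-1/2)) \<partial>lborel)"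
      by (rule riesz_pot_twice) (use R in auto)
    also have "\<dots> \<le> ennreal (4 * riesz_const R) * ennreal (sqrt (riesz_const R) * N)"
      by (intro mult_left_mono half_order_potential) simp
    finally have s: "riesz_pot (\<lambda>\<zeta>. ?I \<zeta> * pot R \<zeta>) z \<le> ennreal (4 * riesz_const R) * ennreal (sqrt (riesz_const R) * N)" .
    have "pot (R/2) z \<le> riesz_pot (\<lambda>\<zeta>. ?p * (?I \<zeta> * pot R \<zeta>)) z"
      by (rule riesz_pot_mono_AE[OF b1])
    also have "\<dots> = ?p * riesz_pot (\<lambda>\<zeta>. ?I \<zeta> * pot R \<zeta>) z"
      unfolding riesz_pot_def[of "\<lambda>\<zeta>. ?I \<zeta> * pot R \<zeta>"] riesz_pot_def[of "\<lambda>\<zeta>. ?p * (?I \<zeta> * pot R \<zeta>)"] mult.assoc[of ?p]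
      by (rule nn_integral_cmult) measurable
    also have "\<dots> \<le> ?p * (ennreal (4 * riesz_const R) * ennreal (sqrt (riesz_const R) * N))"
      by (intro mult_left_mono s) simp
    finally show ?thesis .
  qed
  have "AE z in lborel. z \<in> cball a (R/2/2) \<longrightarrow> ennreal (norm (W z)) \<le> ?q * pot (R/2) z"
    using norm_W_le_pot[of "R/2"] R by simp
  then show ?thesis
  proof eventually_elim
    case (elim z)
    show ?case
    proof
      assume "z \<in> cball a (R/4)"
      then have "ennreal (norm (W z)) \<le> ?q * pot (R/2) z" using elim by simp
      also have "\<dots> \<le> ?q * (?p * (ennreal (4 * riesz_const R) * ennreal (sqrt (riesz_const R) * N)))"
        by (intro mult_left_mono b2) simp
      also have "\<dots> = ennreal (bound_const R C * N)"
        using pot_const_nonneg riesz_const_nonneg[of R] N_nonneg unfolding bound_const_def mult.assoc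
        by (simp only: ennreal_mult mult_nonneg_nonneg real_sqrt_ge_zero zero_le_numeral mult.assoc)
      finally show "norm (W z) \<le> bound_const R C * N"
        by (simp add: bound_const_nonneg N_nonneg)
    qed
  qed
qed

lemma fW_bound: "AE \<zeta> in lborel. fW (R/4) \<zeta> \<le> bound_const R C * N * indicator (cball a (R/4)) \<zeta>"
  using norm_W_bound by eventually_elim (auto simp: fW_def indicator_def)

text \<open>The almost everywhere bound for \<open>W\<close> enters under the integral sign, so the
  conclusion holds at every \<open>z\<close>; continuity and values at a point depend on
  this.\<close>

lemma pot_quarter_le: "pot (R/4) z \<le> ennreal (bound_const R C * N * riesz_const R)"
proof -
  have "pot (R/4) z \<le> (\<integral>\<^sup>+\<zeta>. ennreal (bound_const R C * N) * (indicator (cball a (R/4)) \<zeta> * ennreal (inverse (cmod (z - \<zeta>)))) \<partial>lborel)"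
    unfolding riesz_pot_def
  proof (rule nn_integral_mono_AE)
    show "AE \<zeta> in lborel. ennreal (fW (R/4) \<zeta>) * ennreal (inverse (cmod (z - \<zeta>)))
      \<le> ennreal (bound_const R C * N) * (indicator (cball a (R/4)) \<zeta> * ennreal (inverse (cmod (z - \<zeta>))))"
      using fW_bound
    proof eventually_elim
      case (elim \<zeta>)
      then have "ennreal (fW (R/4) \<zeta>) \<le> ennreal (bound_const R C * N) * indicator (cball a (R/4)) \<zeta>"
        by (cases "\<zeta> \<in> cball a (R/4)") (auto simp: ennreal_leI ennreal_neg)
      then show ?case by (simp only: mult.assoc[symmetric] mult_right_mono zero_le)
    qed
  qed
  also have "\<dots> = ennreal (bound_const R C * N) * (\<integral>\<^sup>+\<zeta>. indicator (cball a (R/4)) \<zeta> * ennreal (inverse (cmod (z - \<zeta>))) \<partial>lborel)"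
    by (rule nn_integral_cmult) measurable
  also have "\<dots> \<le> ennreal (bound_const R C * N) * ennreal (riesz_const R)"
    using R by (intro mult_left_mono nn_integral_weakly_singular inverse_weakly_singular) auto
  also have "\<dots> = ennreal (bound_const R C * N * riesz_const R)"
    by (rule ennreal_mult[symmetric]) (simp_all add: bound_const_nonneg N_nonneg riesz_const_nonneg)
  finally show ?thesis .
qed

lemma u_quarter_bound: "norm (u (R/4) 0 z) \<le> 4 * D * (bound_const R C * N * riesz_const R)"
proof -
  have "ennreal (norm (u (R/4) 0 z)) \<le> ennreal (4 * D) * pot (R/4) z"
    using R by (intro norm_u_le) auto
  also have "\<dots> \<le> ennreal (4 * D) * ennreal (bound_const R C * N * riesz_const R)"
    by (intro mult_left_mono pot_quarter_le) simp
  finally show ?thesis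
    by (simp add: ennreal_mult'[symmetric] D_nonneg bound_const_nonneg N_nonneg riesz_const_nonneg)
qed

lemma continuous_u_regularised:
  assumes r: "0 < r" "r \<le> R" and e: "0 < e"
  shows "continuous_on UNIV (u r e)"
  unfolding continuous_on_sequentially
proof (intro ballI allI impI, elim conjE)
  fix x :: "nat \<Rightarrow> complex" and z assume x: "x \<longlonglongrightarrow> z"
  show "(u r e \<circ> x) \<longlonglongrightarrow> u r e z"
    unfolding comp_def u_def
  proof (rule integral_dominated_convergence)
    show "integrable lborel (\<lambda>\<zeta>. 4 * norm (F r \<zeta>) * (1 / e))" using integrable_F[OF r] by simp
    show "AE \<zeta> in lborel. (\<lambda>n. F r \<zeta> \<odot> kern e (x n - \<zeta>)) \<longlonglongrightarrow> F r \<zeta> \<odot> kern e (z - \<zeta>)"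
      by (intro AE_I2 bc.tendsto tendsto_const continuous_on_tendsto_compose[OF continuous_kern[OF e, of UNIV]] tendsto_diff x) auto
    show "AE \<zeta> in lborel. norm (F r \<zeta> \<odot> kern e (x n - \<zeta>)) \<le> 4 * norm (F r \<zeta>) * (1 / e)" for n
      by (intro AE_I2 order_trans[OF norm_bc_mult mult_left_mono] norm_kern_le_inverse e) auto
  qed measurable
qed

text \<open>Once \<open>W\<close> is bounded, the error kernel
  \<open>sqrt e * |w| powr (-3/2)\<close> has an integral bounded uniformly in \<open>z\<close>, so
  the continuous regularisations converge uniformly.\<close>

lemma u_quarter_approx:
  assumes e: "0 < e"
  shows "norm (u (R/4) 0 z - u (R/4) e z) \<le> sqrt e * (4 * D * (bound_const R C * N * riesz_const R))"
proof -
  let ?r = "R/4"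
  have r: "0 < ?r" "?r \<le> R" using R by auto
  have fin: "pot ?r z < \<infinity>" using pot_quarter_le[of z] by (rule le_less_trans) simp
  have i0: "integrable lborel (\<lambda>\<zeta>. F ?r \<zeta> \<odot> kern 0 (z - \<zeta>))"
  proof (rule Bochner_Integration.integrable_bound)
    show "integrable lborel (\<lambda>\<zeta>. 4 * D * (fW ?r \<zeta> * inverse (cmod (z - \<zeta>))))"
      using fW_kernel_integrable[OF fin] by simp
    show "AE \<zeta> in lborel. norm (F ?r \<zeta> \<odot> kern 0 (z - \<zeta>)) \<le> norm (4 * D * (fW ?r \<zeta> * inverse (cmod (z - \<zeta>))))"
      using F_kern_bound[OF r, of 0 z] by eventually_elim simp
  qed measurable
  note ie = integrable_F_kern[OF r e, of z]
  have eq: "u ?r 0 z - u ?r e z = (\<integral>\<zeta>. F ?r \<zeta> \<odot> (kern 0 (z - \<zeta>) - kern e (z - \<zeta>)) \<partial>lborel)"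
    unfolding u_def bc.diff_right using i0 ie by simp
  have id: "integrable lborel (\<lambda>\<zeta>. F ?r \<zeta> \<odot> (kern 0 (z - \<zeta>) - kern e (z - \<zeta>)))"
    unfolding bc.diff_right using i0 ie by simp
  let ?K = "4 * (D * (bound_const R C * N)) * sqrt e"
  have K: "0 \<le> ?K" using D_nonneg bound_const_nonneg N_nonneg e by simp
  have "ennreal (norm (u ?r 0 z - u ?r e z)) \<le> (\<integral>\<^sup>+\<zeta>. ennreal (norm (F ?r \<zeta> \<odot> (kern 0 (z - \<zeta>) - kern e (z - \<zeta>)))) \<partial>lborel)"
    unfolding eq by (rule integral_norm_bound_ennreal[OF id])
  also have "\<dots> \<le> (\<integral>\<^sup>+\<zeta>. ennreal ?K * (indicator (cball a ?r) \<zeta> * ennreal (cmod (z - \<zeta>) powr (-3/2))) \<partial>lborel)"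
  proof (rule nn_integral_mono_AE)
    show "AE \<zeta> in lborel. ennreal (norm (F ?r \<zeta> \<odot> (kern 0 (z - \<zeta>) - kern e (z - \<zeta>))))
      \<le> ennreal ?K * (indicator (cball a ?r) \<zeta> * ennreal (cmod (z - \<zeta>) powr (-3/2)))"
      using F_bound[OF r] fW_bound
    proof eventually_elim
      case (elim \<zeta>)
      have "norm (F ?r \<zeta>) \<le> D * (bound_const R C * N * indicator (cball a ?r) \<zeta>)"
        using elim(1) mult_left_mono[OF elim(2) D_nonneg] by linarith
      then have "norm (F ?r \<zeta> \<odot> (kern 0 (z - \<zeta>) - kern e (z - \<zeta>)))
        \<le> 4 * (D * (bound_const R C * N * indicator (cball a ?r) \<zeta>)) * (sqrt e * cmod (z - \<zeta>) powr (-3/2))"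
        by (intro order_trans[OF norm_bc_mult] mult_mono norm_kern_diff e)
          (auto intro!: mult_nonneg_nonneg D_nonneg bound_const_nonneg N_nonneg)
      then show ?case using K
        by (cases "\<zeta> \<in> cball a ?r") (auto simp: ennreal_mult'[symmetric] mult_ac intro!: ennreal_leI)
    qed
  qed
  also have "\<dots> = ennreal ?K * (\<integral>\<^sup>+\<zeta>. indicator (cball a ?r) \<zeta> * ennreal (cmod (z - \<zeta>) powr (-3/2)) \<partial>lborel)"
    by (rule nn_integral_cmult) measurable
  also have "\<dots> \<le> ennreal ?K * ennreal (riesz_const R)"
    using r powr_weakly_singular[of "3/2"] by (intro mult_left_mono nn_integral_weakly_singular) auto
  also have "\<dots> = ennreal (?K * riesz_const R)" using K by (simp only: ennreal_mult'[symmetric])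
  finally have "norm (u ?r 0 z - u ?r e z) \<le> ?K * riesz_const R"
    by (simp only: ennreal_le_iff[OF mult_nonneg_nonneg[OF K riesz_const_nonneg]])
  then show ?thesis by (simp only: mult_ac)
qed

lemma continuous_u_quarter: "continuous_on UNIV (u (R/4) 0)"
proof (rule uniform_limit_theorem)
  define e where "e n = 1 / real (Suc n)" for n
  have e: "e n > 0" "e \<longlonglongrightarrow> 0" for n
    unfolding e_def using LIMSEQ_inverse_real_of_nat by (auto simp: inverse_eq_divide)
  show "\<forall>\<^sub>F n in sequentially. continuous_on UNIV (u (R/4) (e n))"
    using R e by (intro always_eventually allI continuous_u_regularised) auto
  let ?K = "4 * D * (bound_const R C * N * riesz_const R)"
  show "uniform_limit UNIV (\<lambda>n. u (R/4) (e n)) (u (R/4) 0) sequentially"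
  proof (rule uniform_limitI)
    fix d :: real assume d: "0 < d"
    have "(\<lambda>n. sqrt (e n) * ?K) \<longlonglongrightarrow> sqrt 0 * ?K" by (intro tendsto_intros e(2))
    then have "\<forall>\<^sub>F n in sequentially. sqrt (e n) * ?K < d"
      using d by (intro order_tendstoD(2)[where y=0 and a=d, THEN eventually_mono]) auto
    then show "\<forall>\<^sub>F n in sequentially. \<forall>x\<in>UNIV. dist (u (R/4) (e n) x) (u (R/4) 0 x) < d"
    proof eventually_elim
      case (elim n)
      then show ?case using u_quarter_approx[OF e(1)[of n]]
        by (auto simp: dist_norm norm_minus_commute intro: le_less_trans)
    qed
  qed
qed simp

text \<open>The representative is \<open>u (R/4) 0\<close> divided by the cutoff, which is positive
  on the open disc. A value bound at the centre is enough, since each point of the domain becomes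
  the centre of a disc of its own.\<close>

lemma continuous_representative:
  "\<exists>g. continuous_on (ball a (R/4)) g \<and> (AE z in lborel. z \<in> ball a (R/4) \<longrightarrow> W z = g z) \<and>
     norm (g a) \<le> value_const a R C * N"
proof (intro exI conjI)
  let ?c = "\<lambda>z. delta_mass * cutoff a (R/4) z"
  let ?g = "\<lambda>z. inverse (?c z) *\<^sub>R u (R/4) 0 z"
  have c: "0 < ?c z" if "z \<in> ball a (R/4)" for z
    using cutoff_pos[OF that] delta_mass_pos by simp
  show "continuous_on (ball a (R/4)) ?g"
    by (intro continuous_intros continuous_on_subset[OF continuous_cutoff] continuous_on_subset[OF continuous_u_quarter])
      (use c in force)+
  show "AE z in lborel. z \<in> ball a (R/4) \<longrightarrow> W z = ?g z"
  proof -
    have "AE z in lborel. u (R/4) 0 z = ?c z *\<^sub>R W z" using R by (intro representation) auto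
    then show ?thesis
    proof eventually_elim
      case (elim z)
      show ?case
      proof
        assume z: "z \<in> ball a (R/4)"
        have "inverse (?c z) * ?c z = 1" by (rule left_inverse) (use c[OF z] in linarith)
        then show "W z = ?g z" unfolding elim by (simp only: scaleR_scaleR scaleR_one)
      qed
    qed
  qed
  have ca: "0 < ?c a" by (rule c) (use R in simp)
  then have "norm (?g a) = inverse (?c a) * norm (u (R/4) 0 a)"
    unfolding norm_scaleR using positive_imp_inverse_positive[OF ca] by (simp only: abs_of_pos)
  also have "\<dots> \<le> inverse (?c a) * (4 * D * (bound_const R C * N * riesz_const R))"
    by (intro mult_left_mono u_quarter_bound less_imp_le positive_imp_inverse_positive ca)
  also have "\<dots> = value_const a R C * N"
    by (simp only: value_const_def D_def divide_inverse mult_ac)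
  finally show "norm (?g a) \<le> value_const a R C * N" .
qed

end

section \<open>Continuous representatives\<close>

lemma completion_ex_borel_measurable_euclidean:
  fixes f :: "'a \<Rightarrow> 'b::euclidean_space"
  assumes [measurable]: "f \<in> borel_measurable (completion M)"
  shows "\<exists>g\<in>borel_measurable M. AE x in M. f x = g x"
proof -
  have "\<exists>g\<in>borel_measurable M. AE x in M. f x \<bullet> i = g x" for i
    by (rule completion_ex_borel_measurable_real) measurable
  then obtain g where g: "\<And>i. g i \<in> borel_measurable M" "\<And>i. AE x in M. f x \<bullet> i = g i x" by metis
  have [measurable]: "g i \<in> borel_measurable M" for i by (rule g(1))
  have "AE x in M. \<forall>i\<in>Basis. f x \<bullet> i = g i x"
    by (rule AE_finite_allI[OF finite_Basis]) (rule g(2))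
  then have "AE x in M. f x = (\<Sum>i\<in>Basis. g i x *\<^sub>R i)"
    by eventually_elim (subst euclidean_representation[symmetric], rule sum.cong, auto)
  moreover have "(\<lambda>x. \<Sum>i\<in>Basis. g i x *\<^sub>R i) \<in> borel_measurable M" by measurable
  ultimately show ?thesis by (intro bexI[of _ "\<lambda>x. \<Sum>i\<in>Basis. g i x *\<^sub>R i"])
qed

lemma AE_lebesgue_on_iff:
  "S \<in> sets lebesgue \<Longrightarrow> (AE x in lebesgue_on S. P x) \<longleftrightarrow> (AE x in lborel. x \<in> S \<longrightarrow> P x)"
  by (subst AE_restrict_space_iff) (auto simp: AE_completion_iff)

text \<open>The function spaces are defined through \<open>lebesgue_on\<close>, the potential
  estimates live on \<open>lborel\<close>. Extension by zero followed by a change on a null set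
  connects the two.\<close>

lemma lebesgue_on_lborel_transfer:
  fixes f g :: "'a::euclidean_space \<Rightarrow> 'b::euclidean_space"
  assumes S: "S \<in> sets lebesgue" and f: "f \<in> borel_measurable (lebesgue_on S)"
    and g: "g \<in> borel_measurable borel"
    and eq: "AE x in lborel. (if x \<in> S then f x else 0) = g x"
  shows "integrable (lebesgue_on S) f \<longleftrightarrow> integrable lborel g"
    and "integral\<^sup>L (lebesgue_on S) f = integral\<^sup>L lborel g"
proof -
  have m: "(\<lambda>x. if x \<in> S then f x else 0) \<in> borel_measurable lebesgue"
    by (rule borel_measurable_if_I[OF f S])
  have g': "g \<in> borel_measurable lebesgue" using g by (simp add: measurable_completion)
  have eq': "AE x in lebesgue. (if x \<in> S then f x else 0) = g x" using eq by (rule AE_completion)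
  show "integrable (lebesgue_on S) f \<longleftrightarrow> integrable lborel g"
    using integrable_cong_AE[OF m g' eq'] Lebesgue_Measure.integrable_restrict_UNIV[OF S, of f] g
    by (simp add: integrable_completion)
  show "integral\<^sup>L (lebesgue_on S) f = integral\<^sup>L lborel g"
    using integral_cong_AE[OF m g' eq'] Lebesgue_Measure.integral_restrict_UNIV[OF S, of f] g
    by (simp add: integral_completion)
qed

lemma measurable_bicomplex_iff:
  "W \<in> borel_measurable M \<longleftrightarrow> (\<lambda>z. Sc (W z)) \<in> borel_measurable M \<and> (\<lambda>z. Vec (W z)) \<in> borel_measurable M"
  for W :: "'a \<Rightarrow> bicomplex"
proof
  assume [measurable]: "W \<in> borel_measurable M"
  have "(\<lambda>z. Sc (W z)) \<in> borel_measurable M"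
    by (rule borel_measurable_continuous_on[of fst, OF continuous_on_fst[OF continuous_on_id]]) measurable
  moreover have "(\<lambda>z. Vec (W z)) \<in> borel_measurable M"
    by (rule borel_measurable_continuous_on[of snd, OF continuous_on_snd[OF continuous_on_id]]) measurable
  ultimately show "(\<lambda>z. Sc (W z)) \<in> borel_measurable M \<and> (\<lambda>z. Vec (W z)) \<in> borel_measurable M" ..
next
  assume "(\<lambda>z. Sc (W z)) \<in> borel_measurable M \<and> (\<lambda>z. Vec (W z)) \<in> borel_measurable M"
  then have "(\<lambda>z. (Sc (W z), Vec (W z))) \<in> borel_measurable M" by (intro borel_measurable_Pair) auto
  then show "W \<in> borel_measurable M" by simp
qed

lemma norm_bicomplex_sq: "(norm (U :: bicomplex))\<^sup>2 = (cmod (Sc U))\<^sup>2 + (cmod (Vec U))\<^sup>2"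
  by (simp add: norm_prod_def)

lemma bc_L2_space_iff:
  "W \<in> bc_space (L2_space \<Omega>) \<longleftrightarrow> W \<in> borel_measurable (lebesgue_on \<Omega>) \<and> integrable (lebesgue_on \<Omega>) (\<lambda>z. (norm (W z))\<^sup>2)"
proof
  assume "W \<in> bc_space (L2_space \<Omega>)"
  then show "W \<in> borel_measurable (lebesgue_on \<Omega>) \<and> integrable (lebesgue_on \<Omega>) (\<lambda>z. (norm (W z))\<^sup>2)"
    unfolding bc_space_def L2_space_def measurable_bicomplex_iff norm_bicomplex_sq by auto
next
  assume "W \<in> borel_measurable (lebesgue_on \<Omega>) \<and> integrable (lebesgue_on \<Omega>) (\<lambda>z. (norm (W z))\<^sup>2)"
  then have m: "(\<lambda>z. Sc (W z)) \<in> borel_measurable (lebesgue_on \<Omega>)" "(\<lambda>z. Vec (W z)) \<in> borel_measurable (lebesgue_on \<Omega>)"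
    and i: "integrable (lebesgue_on \<Omega>) (\<lambda>z. (norm (W z))\<^sup>2)"
    unfolding measurable_bicomplex_iff by auto
  have "integrable (lebesgue_on \<Omega>) (\<lambda>z. (cmod (Sc (W z)))\<^sup>2)"
    by (rule Bochner_Integration.integrable_bound[OF i]) (use m in \<open>auto simp: norm_bicomplex_sq\<close>)
  moreover have "integrable (lebesgue_on \<Omega>) (\<lambda>z. (cmod (Vec (W z)))\<^sup>2)"
    by (rule Bochner_Integration.integrable_bound[OF i]) (use m in \<open>auto simp: norm_bicomplex_sq\<close>)
  ultimately show "W \<in> bc_space (L2_space \<Omega>)" using m by (simp add: bc_space_def L2_space_def)
qed

lemma bc_Linf_bound:
  assumes "a \<in> bc_space (Linf_space \<Omega>)"
  shows "a \<in> borel_measurable (lebesgue_on \<Omega>)" and "\<exists>C\<ge>0. AE z in lebesgue_on \<Omega>. norm (a z) \<le> C"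
proof -
  show "a \<in> borel_measurable (lebesgue_on \<Omega>)"
    using assms unfolding measurable_bicomplex_iff by (simp add: bc_space_def Linf_space_def)
  from assms obtain C1 C2 where C: "AE z in lebesgue_on \<Omega>. cmod (Sc (a z)) \<le> C1"
    "AE z in lebesgue_on \<Omega>. cmod (Vec (a z)) \<le> C2" by (auto simp: bc_space_def Linf_space_def)
  have "AE z in lebesgue_on \<Omega>. norm (a z) \<le> max 0 (C1 + C2)"
    using C
  proof eventually_elim
    case (elim z)
    have "norm (a z) \<le> cmod (Sc (a z)) + cmod (Vec (a z))" using norm_Pair_le[of "Sc (a z)" "Vec (a z)"] by simp
    then show ?case using elim by linarith
  qed
  then show "\<exists>C\<ge>0. AE z in lebesgue_on \<Omega>. norm (a z) \<le> C" by (intro exI[of _ "max 0 (C1 + C2)"]) simp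
qed

lemma norm_bc_cnj [simp]: "norm (bc_cnj U) = norm U"
  by (simp add: bc_cnj_def norm_prod_def)

lemma measurable_bc_cnj [measurable (raw)]:
  "f \<in> borel_measurable M \<Longrightarrow> (\<lambda>x. bc_cnj (f x)) \<in> borel_measurable M"
  unfolding bc_cnj_def
  by (rule borel_measurable_continuous_on[where f="\<lambda>W. (Sc W, - Vec W)"]) (auto intro!: continuous_intros)

section \<open>Continuous representatives and bounded point evaluations on the domain\<close>

locale vekua_domain =
  fixes \<Omega> :: "complex set" and a b :: "complex \<Rightarrow> bicomplex"
  assumes open_dom: "open \<Omega>" and bounded_dom: "bounded \<Omega>"
    and a_Linf: "a \<in> bc_space (Linf_space \<Omega>)" and b_Linf: "b \<in> bc_space (Linf_space \<Omega>)"
begin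

abbreviation "M \<equiv> lebesgue_on \<Omega>"
abbreviation "A2 \<equiv> vekua_bergman \<Omega> a b"

definition rhs :: "(complex \<Rightarrow> bicomplex) \<Rightarrow> complex \<Rightarrow> bicomplex" where
  "rhs W z = a z \<odot> W z + b z \<odot> bc_cnj (W z)"

definition sq :: "(complex \<Rightarrow> bicomplex) \<Rightarrow> real" where
  "sq W = (\<integral>z. (norm (W z))\<^sup>2 \<partial>M)"

lemma sets_dom: "\<Omega> \<in> sets lebesgue" "\<Omega> \<in> sets borel"
  using open_dom by auto

lemma finite_measure_M: "finite_measure M"
  by (intro finite_measure_lebesgue_on lmeasurable_open bounded_dom open_dom)

lemma measurable_coeff [measurable]: "a \<in> borel_measurable M" "b \<in> borel_measurable M"
  using a_Linf b_Linf by (auto dest: bc_Linf_bound)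

lemma measurable_rhs [measurable (raw)]: "W \<in> borel_measurable M \<Longrightarrow> rhs W \<in> borel_measurable M"
  unfolding rhs_def by (intro borel_measurable_add measurable_bc_mult measurable_bc_cnj measurable_coeff)

lemma ex_coeff_bound: "\<exists>C\<ge>0. \<forall>W. AE z in M. norm (rhs W z) \<le> C * norm (W z)"
proof -
  obtain A B where A: "A \<ge> 0" "AE z in M. norm (a z) \<le> A" and B: "B \<ge> 0" "AE z in M. norm (b z) \<le> B"
    using bc_Linf_bound(2)[OF a_Linf] bc_Linf_bound(2)[OF b_Linf] by blast
  have "AE z in M. norm (rhs W z) \<le> 4 * (A + B) * norm (W z)" for W
    using A(2) B(2)
  proof eventually_elim
    case (elim z)
    have "norm (rhs W z) \<le> norm (a z \<odot> W z) + norm (b z \<odot> bc_cnj (W z))"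
      unfolding rhs_def by (rule norm_triangle_ineq)
    also have "\<dots> \<le> 4 * norm (a z) * norm (W z) + 4 * norm (b z) * norm (W z)"
      using norm_bc_mult[of "b z" "bc_cnj (W z)"] by (intro add_mono norm_bc_mult) simp
    also have "\<dots> \<le> 4 * A * norm (W z) + 4 * B * norm (W z)"
      using elim by (intro add_mono mult_right_mono) auto
    finally show ?case by (simp add: algebra_simps)
  qed
  then show ?thesis using A B by (intro exI[of _ "4 * (A + B)"]) auto
qed

text \<open>Chosen once for all \<open>W\<close>, so that local estimates have constants uniform
  over the Bergman space.\<close>

definition coeff_bound :: real where
  "coeff_bound = (SOME C. C \<ge> 0 \<and> (\<forall>W. AE z in M. norm (rhs W z) \<le> C * norm (W z)))"

lemma coeff_bound: "coeff_bound \<ge> 0" "AE z in M. norm (rhs W z) \<le> coeff_bound * norm (W z)"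
proof -
  have "coeff_bound \<ge> 0 \<and> (\<forall>W. AE z in M. norm (rhs W z) \<le> coeff_bound * norm (W z))"
    unfolding coeff_bound_def by (rule someI_ex) (use ex_coeff_bound in blast)
  then show "coeff_bound \<ge> 0" "AE z in M. norm (rhs W z) \<le> coeff_bound * norm (W z)" by auto
qed

text \<open>The bound \<open>x \<le> 1 + x^2\<close> suffices, because a bounded domain has finite
  measure.\<close>

lemma integrable_if_L2:
  assumes "W \<in> bc_space (L2_space \<Omega>)" shows "integrable M W"
proof -
  have [measurable]: "W \<in> borel_measurable M" and i: "integrable M (\<lambda>z. (norm (W z))\<^sup>2)"
    using assms by (auto simp: bc_L2_space_iff)
  interpret finite_measure M by (rule finite_measure_M)
  show ?thesis
  proof (rule Bochner_Integration.integrable_bound)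
    show "integrable M (\<lambda>z. 1 + (norm (W z))\<^sup>2)" using i by simp
    have "norm (W z) \<le> 1 + (norm (W z))\<^sup>2" for z
      using zero_le_power2[of "norm (W z) - 1/2"] by (simp add: power2_eq_square algebra_simps)
    then show "AE z in M. norm (W z) \<le> norm (1 + (norm (W z))\<^sup>2)" by simp
  qed measurable
qed

lemma A2_D:
  assumes "W \<in> A2"
  shows "W \<in> bc_space (L2_space \<Omega>)"
    and "\<phi> \<in> bc_space (test_functions \<Omega>) \<Longrightarrow> (\<integral>z. W z \<odot> dbar \<phi> z \<partial>M) = - (\<integral>z. rhs W z \<odot> \<phi> z \<partial>M)"
  using assms by (auto simp: vekua_bergman_def is_weak_dbar_def rhs_def)

text \<open>Borel versions extended by zero turn integrals over \<open>\<Omega>\<close> into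
  integrals over the plane, and the kernels truncated to a disc inside \<open>\<Omega>\<close> are
  admissible test functions. One pair \<open>W'\<close>, \<open>V'\<close> thus serves all
  discs.\<close>

lemma borel_representative:
  assumes W: "W \<in> A2"
  obtains W' V' where "AE z in M. W z = W' z" "sq W = (\<integral>z. (norm (W' z))\<^sup>2 \<partial>lborel)"
    "\<And>c R. 0 < R \<Longrightarrow> cball c R \<subseteq> \<Omega> \<Longrightarrow> local_solution c R coeff_bound W' V'"
proof -
  note L2 = A2_D(1)[OF W]
  have Wm [measurable]: "W \<in> borel_measurable M" and Wi: "integrable M (\<lambda>z. (norm (W z))\<^sup>2)"
    using L2 by (auto simp: bc_L2_space_iff)
  obtain W' where W'm [measurable]: "W' \<in> borel_measurable borel"
    and W': "AE z in lborel. (if z \<in> \<Omega> then W z else 0) = W' z"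
    using completion_ex_borel_measurable_euclidean[OF borel_measurable_if_I[OF Wm sets_dom(1)]] by auto
  have rm: "rhs W \<in> borel_measurable M" by measurable
  obtain V' where V'm [measurable]: "V' \<in> borel_measurable borel"
    and V': "AE z in lborel. (if z \<in> \<Omega> then rhs W z else 0) = V' z"
    using completion_ex_borel_measurable_euclidean[OF borel_measurable_if_I[OF rm sets_dom(1)]] by auto
  have sqm: "(\<lambda>z. (norm (W z))\<^sup>2) \<in> borel_measurable M" "(\<lambda>z. (norm (W' z))\<^sup>2) \<in> borel_measurable borel" by measurable
  have sqe: "AE z in lborel. (if z \<in> \<Omega> then (norm (W z))\<^sup>2 else 0) = (norm (W' z))\<^sup>2"
    using W' by eventually_elim (auto split: if_splits)
  note tr = lebesgue_on_lborel_transfer[OF sets_dom(1)]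
  show thesis
  proof (rule that)
    show "AE z in M. W z = W' z"
      using W' by (auto simp: AE_lebesgue_on_iff[OF sets_dom(1)] elim!: eventually_mono split: if_splits)
    show "sq W = (\<integral>z. (norm (W' z))\<^sup>2 \<partial>lborel)"
      unfolding sq_def by (rule tr(2)[OF sqm sqe])
    fix c :: complex and R :: real assume R: "0 < R" "cball c R \<subseteq> \<Omega>"
    show "local_solution c R coeff_bound W' V'"
    proof
      show "0 < R" "0 \<le> coeff_bound" by (use R coeff_bound in auto)
      show "integrable lborel W'" using tr(1)[OF Wm W'm W'] integrable_if_L2[OF L2] by simp
      show "integrable lborel (\<lambda>\<zeta>. (norm (W' \<zeta>))\<^sup>2)" using tr(1)[OF sqm sqe] Wi by simp
      show "V' \<in> borel_measurable borel" by measurable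
      show "AE \<zeta> in lborel. norm (V' \<zeta>) \<le> coeff_bound * norm (W' \<zeta>)"
        using W' V' coeff_bound(2)[of W, unfolded AE_lebesgue_on_iff[OF sets_dom(1)]]
        by eventually_elim (auto split: if_splits)
      fix r e z assume r: "0 < r" "r \<le> R" and e: "(0::real) < e"
      have cb: "cball c r \<subseteq> \<Omega>" using R r subset_cball[of r R c] by blast
      have t: "kern_test c r e z \<in> bc_space (test_functions \<Omega>)"
        using cb r e by (intro kern_test_in_test_functions) auto
      have k [measurable]: "kern_test c r e z \<in> borel_measurable borel"
        unfolding kern_test_def by measurable
      have d [measurable]: "dbar (kern_test c r e z) \<in> borel_measurable borel"
        unfolding dbar_kern_test[OF e] by measurable
      have kM: "kern_test c r e z \<in> borel_measurable M" "dbar (kern_test c r e z) \<in> borel_measurable M"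
        by (auto intro!: measurable_restrict_space1 measurable_completion)
      have "(\<integral>\<zeta>. W \<zeta> \<odot> dbar (kern_test c r e z) \<zeta> \<partial>M) = (\<integral>\<zeta>. W' \<zeta> \<odot> dbar (kern_test c r e z) \<zeta> \<partial>lborel)"
      proof (rule tr(2))
        show "AE x in lborel. (if x \<in> \<Omega> then W x \<odot> dbar (kern_test c r e z) x else 0) = W' x \<odot> dbar (kern_test c r e z) x"
          using W' by eventually_elim (auto simp: bc.zero_left split: if_splits)
      qed (use kM in measurable)
      moreover have "(\<integral>\<zeta>. rhs W \<zeta> \<odot> kern_test c r e z \<zeta> \<partial>M) = (\<integral>\<zeta>. V' \<zeta> \<odot> kern_test c r e z \<zeta> \<partial>lborel)"
      proof (rule tr(2))
        show "AE x in lborel. (if x \<in> \<Omega> then rhs W x \<odot> kern_test c r e z x else 0) = V' x \<odot> kern_test c r e z x"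
          using V' by eventually_elim (auto simp: bc.zero_left split: if_splits)
      qed (use kM in measurable)
      ultimately show "(\<integral>\<zeta>. W' \<zeta> \<odot> dbar (kern_test c r e z) \<zeta> \<partial>lborel) = - (\<integral>\<zeta>. V' \<zeta> \<odot> kern_test c r e z \<zeta> \<partial>lborel)"
        using A2_D(2)[OF W t] by simp
    qed
  qed
qed

text \<open>The order of the quantifiers matters: \<open>r\<close> and \<open>K\<close> come from
  the disc and the coefficients before \<open>W\<close> is given.\<close>

lemma local_continuous_representative:
  assumes z: "z \<in> \<Omega>"
  shows "\<exists>r>0. \<exists>K. ball z r \<subseteq> \<Omega> \<and> (\<forall>W\<in>A2. \<exists>g. continuous_on (ball z r) g \<and>
    (AE w in M. w \<in> ball z r \<longrightarrow> W w = g w) \<and> norm (g z) \<le> K * sqrt (sq W))"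
proof -
  obtain R where R: "0 < R" "cball z R \<subseteq> \<Omega>" using open_dom z open_contains_cball by blast
  have *: "\<exists>g. continuous_on (ball z (R/4)) g \<and> (AE w in M. w \<in> ball z (R/4) \<longrightarrow> W w = g w) \<and>
      norm (g z) \<le> value_const z R coeff_bound * sqrt (sq W)" if "W \<in> A2" for W
  proof -
    from that obtain W' V' where W': "AE z in M. W z = W' z" and s: "sq W = (\<integral>z. (norm (W' z))\<^sup>2 \<partial>lborel)"
      and ls: "local_solution z R coeff_bound W' V'" using borel_representative R by metis
    interpret local_solution z R coeff_bound W' V' by (rule ls)
    from continuous_representative obtain g where g: "continuous_on (ball z (R/4)) g"
      "AE w in lborel. w \<in> ball z (R/4) \<longrightarrow> W' w = g w" "norm (g z) \<le> value_const z R coeff_bound * N" by blast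
    have "AE w in M. w \<in> ball z (R/4) \<longrightarrow> W w = g w"
      unfolding AE_lebesgue_on_iff[OF sets_dom(1)]
      using W'[unfolded AE_lebesgue_on_iff[OF sets_dom(1)]] g(2) by eventually_elim auto
    then show ?thesis using g unfolding N_def s by blast
  qed
  have "ball z (R/4) \<subseteq> \<Omega>" using R by (auto simp: subset_eq)
  moreover have "0 < R/4" using R by simp
  ultimately show ?thesis using * by blast
qed

text \<open>Two continuous functions differ on an open set, and a null open set is empty.\<close>

lemma AE_eq_imp_eq_on_open:
  fixes f g :: "complex \<Rightarrow> bicomplex"
  assumes S: "open S" "S \<subseteq> \<Omega>" and f: "continuous_on S f" and g: "continuous_on S g"
    and eq: "AE z in M. z \<in> S \<longrightarrow> f z = g z" and z: "z \<in> S"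
  shows "f z = g z"
proof (rule ccontr)
  assume ne: "f z \<noteq> g z"
  let ?T = "S \<inter> (\<lambda>z. f z - g z) -` (- {0})"
  have "open ?T" by (intro continuous_open_preimage continuous_intros f g S)
  moreover have "?T \<noteq> {}" using ne z by auto
  moreover have "negligible ?T"
  proof -
    have "AE z in lborel. z \<notin> ?T"
      using eq[unfolded AE_lebesgue_on_iff[OF sets_dom(1)]] by eventually_elim (use S in auto)
    then have "AE z in lebesgue. z \<notin> ?T" by (rule AE_completion)
    then show ?thesis using \<open>open ?T\<close>
      by (subst negligible_iff_null_sets) (auto simp: AE_iff_null_sets)
  qed
  ultimately show False using open_not_negligible by blast
qed

lemma ex_cont_rep:
  assumes W: "W \<in> A2"
  shows "\<exists>V. continuous_on \<Omega> V \<and> (AE z in M. V z = W z)"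
proof -
  have "\<forall>z\<in>\<Omega>. \<exists>r g. 0 < r \<and> ball z r \<subseteq> \<Omega> \<and> continuous_on (ball z r) g \<and> (AE w in M. w \<in> ball z r \<longrightarrow> W w = g w)"
  proof
    fix z assume "z \<in> \<Omega>"
    from local_continuous_representative[OF this] obtain r K where "0 < r" "ball z r \<subseteq> \<Omega>"
      and *: "\<forall>W\<in>A2. \<exists>g. continuous_on (ball z r) g \<and>
        (AE w in M. w \<in> ball z r \<longrightarrow> W w = g w) \<and> norm (g z) \<le> K * sqrt (sq W)" by blast
    moreover from bspec[OF * W] obtain g where "continuous_on (ball z r) g"
      "AE w in M. w \<in> ball z r \<longrightarrow> W w = g w" by blast
    ultimately show "\<exists>r g. 0 < r \<and> ball z r \<subseteq> \<Omega> \<and> continuous_on (ball z r) g \<and> (AE w in M. w \<in> ball z r \<longrightarrow> W w = g w)"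
      by (intro exI[of _ r] exI[of _ g] conjI)
  qed
  from bchoice[OF this] obtain r where "\<forall>z\<in>\<Omega>. \<exists>g. 0 < r z \<and> ball z (r z) \<subseteq> \<Omega> \<and>
    continuous_on (ball z (r z)) g \<and> (AE w in M. w \<in> ball z (r z) \<longrightarrow> W w = g w)" ..
  from bchoice[OF this] obtain g where *: "\<forall>z\<in>\<Omega>. 0 < r z \<and> ball z (r z) \<subseteq> \<Omega> \<and>
    continuous_on (ball z (r z)) (g z) \<and> (AE w in M. w \<in> ball z (r z) \<longrightarrow> W w = g z w)" ..
  then have rg: "\<And>z. z \<in> \<Omega> \<Longrightarrow> 0 < r z" "\<And>z. z \<in> \<Omega> \<Longrightarrow> ball z (r z) \<subseteq> \<Omega>"
    "\<And>z. z \<in> \<Omega> \<Longrightarrow> continuous_on (ball z (r z)) (g z)"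
    "\<And>z. z \<in> \<Omega> \<Longrightarrow> AE w in M. w \<in> ball z (r z) \<longrightarrow> W w = g z w" by simp_all
  \<comment> \<open>Diagonal gluing: each local function is read off at its own centre. Agreement on
    overlaps then shows that \<open>V\<close> coincides with every local function on its whole
    ball.\<close>
  define V where "V w = g w w" for w
  have eq: "V w = g z w" if z: "z \<in> \<Omega>" and w: "w \<in> ball z (r z)" for z w
  proof -
    have w\<Omega>: "w \<in> \<Omega>" using rg(2)[OF z] w by blast
    show ?thesis unfolding V_def
    proof (rule AE_eq_imp_eq_on_open[where S="ball z (r z) \<inter> ball w (r w)" and f="g w" and g="g z"])
      show "continuous_on (ball z (r z) \<inter> ball w (r w)) (g w)" "continuous_on (ball z (r z) \<inter> ball w (r w)) (g z)"
        using rg(3)[OF z] rg(3)[OF w\<Omega>] by (auto intro: continuous_on_subset)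
      show "AE x in M. x \<in> ball z (r z) \<inter> ball w (r w) \<longrightarrow> g w x = g z x"
        using rg(4)[OF z] rg(4)[OF w\<Omega>] by eventually_elim auto
      show "w \<in> ball z (r z) \<inter> ball w (r w)" using w rg(1)[OF w\<Omega>] by simp
    qed (use rg(2)[OF z] in auto)
  qed
  have UN: "(\<Union>z\<in>\<Omega>. ball z (r z)) = \<Omega>" using rg(1,2) by force
  have "continuous_on (\<Union>z\<in>\<Omega>. ball z (r z)) V"
  proof (rule continuous_on_open_UN)
    show "continuous_on (ball z (r z)) V" if "z \<in> \<Omega>" for z
      using rg(3)[OF that] by (rule continuous_on_eq) (simp add: eq[OF that])
  qed auto
  then have cont: "continuous_on \<Omega> V" by (simp only: UN)
  \<comment> \<open>Each ball has its own exceptional null set; a countable subcover keeps their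
    union null.\<close>
  obtain F where F: "F \<subseteq> (\<lambda>z. ball z (r z)) ` \<Omega>" "countable F" "\<Union>F = (\<Union>z\<in>\<Omega>. ball z (r z))"
    using Lindelof[of "(\<lambda>z. ball z (r z)) ` \<Omega>"] by auto
  have "AE w in M. \<forall>B\<in>F. w \<in> B \<longrightarrow> V w = W w"
  proof (subst AE_ball_countable[OF F(2)], intro ballI)
    fix B assume "B \<in> F"
    then obtain z where z: "z \<in> \<Omega>" "B = ball z (r z)" using F(1) by auto
    show "AE w in M. w \<in> B \<longrightarrow> V w = W w"
      using rg(4)[OF z(1)] by eventually_elim (use eq[OF z(1)] z(2) in auto)
  qed
  then have "AE w in M. w \<in> \<Omega> \<longrightarrow> V w = W w"
    by eventually_elim (use F(3) UN in auto)
  then have "AE w in M. V w = W w"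
    by (rule lebesgue_on_mono) auto
  with cont show ?thesis by blast
qed

lemma cont_rep:
  assumes "W \<in> A2"
  shows "continuous_on \<Omega> (cont_rep \<Omega> W)" "AE z in M. cont_rep \<Omega> W z = W z"
  using someI_ex[OF ex_cont_rep[OF assms]] unfolding cont_rep_def by blast+

lemma cont_rep_unique:
  assumes W: "W \<in> A2" and V: "continuous_on \<Omega> V" "AE z in M. V z = W z" and z: "z \<in> \<Omega>"
  shows "cont_rep \<Omega> W z = V z"
proof (rule AE_eq_imp_eq_on_open[where f="cont_rep \<Omega> W" and g=V, OF open_dom order_refl cont_rep(1)[OF W] V(1) _ z])
  show "AE z in M. z \<in> \<Omega> \<longrightarrow> cont_rep \<Omega> W z = V z"
    using cont_rep(2)[OF W] V(2) by eventually_elim auto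
qed

lemma cont_rep_bound:
  assumes z: "z \<in> \<Omega>"
  shows "\<exists>K. \<forall>W\<in>A2. norm (cont_rep \<Omega> W z) \<le> K * sqrt (sq W)"
proof -
  obtain r K where r: "0 < r" "ball z r \<subseteq> \<Omega>" and g: "\<forall>W\<in>A2. \<exists>g. continuous_on (ball z r) g \<and>
    (AE w in M. w \<in> ball z r \<longrightarrow> W w = g w) \<and> norm (g z) \<le> K * sqrt (sq W)"
    using local_continuous_representative[OF z] by blast
  show ?thesis
  proof (intro exI[of _ K] ballI)
    fix W assume W: "W \<in> A2"
    with g obtain g where g: "continuous_on (ball z r) g" "AE w in M. w \<in> ball z r \<longrightarrow> W w = g w"
      "norm (g z) \<le> K * sqrt (sq W)" by blast
    have "cont_rep \<Omega> W z = g z"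
    proof (rule AE_eq_imp_eq_on_open[where f="cont_rep \<Omega> W" and g=g, OF open_ball r(2) _ g(1)])
      show "continuous_on (ball z r) (cont_rep \<Omega> W)" using cont_rep(1)[OF W] r(2) by (rule continuous_on_subset)
      show "AE w in M. w \<in> ball z r \<longrightarrow> cont_rep \<Omega> W w = g w"
        using cont_rep(2)[OF W] g(2) by eventually_elim auto
      show "z \<in> ball z r" using r by simp
    qed
    then show "norm (cont_rep \<Omega> W z) \<le> K * sqrt (sq W)" using g(3) by simp
  qed
qed

end

section \<open>Riesz representation in subspaces of square integrable functions\<close>

lemma bc_of_complex_mult: "bc_of_complex c \<odot> U = (c * Sc U, c * Vec U)"
  by (simp add: bc_mult_def bc_of_complex_def)

lemma norm_bc_of_complex_mult: "norm (bc_of_complex c \<odot> U) = cmod c * norm U"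
proof -
  have "(norm (bc_of_complex c \<odot> U))\<^sup>2 = (cmod c * norm U)\<^sup>2"
    by (simp add: norm_bicomplex_sq bc_of_complex_mult norm_mult power_mult_distrib algebra_simps)
  then show ?thesis by (simp add: power2_eq_iff_nonneg)
qed

lemma bc_inner_add_left: "bc_inner (U + V) X = bc_inner U X + bc_inner V X"
  by (simp add: bc_inner_def algebra_simps)

lemma bc_inner_scale_left: "bc_inner (bc_of_complex c \<odot> U) X = c * bc_inner U X"
  by (simp add: bc_inner_def bc_of_complex_mult algebra_simps)

lemma bc_inner_scale_right: "bc_inner X (bc_of_complex c \<odot> U) = cnj c * bc_inner X U"
  by (simp add: bc_inner_def bc_of_complex_mult algebra_simps)

lemma cnj_bc_inner: "cnj (bc_inner U V) = bc_inner V U"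
  by (simp add: bc_inner_def mult.commute)

lemma norm_bc_add_scale_sq:
  "(norm (U + bc_of_complex c \<odot> V))\<^sup>2 = (norm U)\<^sup>2 + 2 * Re (cnj c * bc_inner U V) + (cmod c)\<^sup>2 * (norm V)\<^sup>2"
proof -
  have s: "(cmod (x + y))\<^sup>2 = (cmod x)\<^sup>2 + 2 * Re (x * cnj y) + (cmod y)\<^sup>2" for x y
    unfolding cmod_power2 by (simp add: power2_eq_square algebra_simps)
  have "(norm (U + bc_of_complex c \<odot> V))\<^sup>2 = (cmod (Sc U + c * Sc V))\<^sup>2 + (cmod (Vec U + c * Vec V))\<^sup>2"
    by (simp add: norm_bicomplex_sq bc_of_complex_mult)
  also have "\<dots> = (norm U)\<^sup>2 + 2 * Re (cnj c * bc_inner U V) + (cmod c)\<^sup>2 * (norm V)\<^sup>2"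
    unfolding s norm_bicomplex_sq norm_mult power_mult_distrib bc_inner_def
    by (simp add: algebra_simps)
  finally show ?thesis .
qed

lemma norm_bc_inner_le: "cmod (bc_inner U V) \<le> (norm U)\<^sup>2 + (norm V)\<^sup>2"
proof -
  have *: "cmod x * cmod y \<le> (cmod x)\<^sup>2 + (cmod y)\<^sup>2" for x y
    using sum_squares_bound[of "cmod x" "cmod y"] mult_nonneg_nonneg[OF norm_ge_zero[of x] norm_ge_zero[of y]] by linarith
  have "cmod (bc_inner U V) \<le> cmod (Sc U) * cmod (Sc V) + cmod (Vec U) * cmod (Vec V)"
    unfolding bc_inner_def using norm_triangle_ineq[of "Sc U * cnj (Sc V)" "Vec U * cnj (Vec V)"] by (simp add: norm_mult)
  also have "\<dots> \<le> (norm U)\<^sup>2 + (norm V)\<^sup>2"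
    using *[of "Sc U" "Sc V"] *[of "Vec U" "Vec V"] by (simp add: norm_bicomplex_sq)
  finally show ?thesis .
qed

text \<open>Functions rather than classes, so \<open>L2_sq\<close> is the square of a seminorm
  only.\<close>

definition L2 :: "'a measure \<Rightarrow> ('a \<Rightarrow> bicomplex) set" where
  "L2 M = {W \<in> borel_measurable M. integrable M (\<lambda>z. (norm (W z))\<^sup>2)}"

definition L2_sq :: "'a measure \<Rightarrow> ('a \<Rightarrow> bicomplex) \<Rightarrow> real" where
  "L2_sq M W = (\<integral>z. (norm (W z))\<^sup>2 \<partial>M)"

definition L2_ip :: "'a measure \<Rightarrow> ('a \<Rightarrow> bicomplex) \<Rightarrow> ('a \<Rightarrow> bicomplex) \<Rightarrow> complex" where
  "L2_ip M U V = (\<integral>z. bc_inner (U z) (V z) \<partial>M)"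

lemma measurable_bc_inner [measurable (raw)]:
  assumes "U \<in> borel_measurable M" "V \<in> borel_measurable M"
  shows "(\<lambda>z. bc_inner (U z) (V z)) \<in> borel_measurable M"
  unfolding bc_inner_def using assms[unfolded measurable_bicomplex_iff]
  by (intro borel_measurable_add borel_measurable_times) (auto intro!: borel_measurable_continuous_on[where f=cnj] continuous_intros)

lemma L2_sq_nonneg: "0 \<le> L2_sq M W"
  by (simp add: L2_sq_def)

lemma integrable_bc_inner:
  assumes "U \<in> L2 M" "V \<in> L2 M" shows "integrable M (\<lambda>z. bc_inner (U z) (V z))"
proof (rule Bochner_Integration.integrable_bound)
  show "integrable M (\<lambda>z. (norm (U z))\<^sup>2 + (norm (V z))\<^sup>2)" using assms by (simp add: L2_def)
  show "(\<lambda>z. bc_inner (U z) (V z)) \<in> borel_measurable M"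
    by (rule measurable_bc_inner) (use assms in \<open>auto simp: L2_def\<close>)
  show "AE z in M. norm (bc_inner (U z) (V z)) \<le> norm ((norm (U z))\<^sup>2 + (norm (V z))\<^sup>2)"
    using norm_bc_inner_le by (intro AE_I2) (simp add: order_trans[OF _ abs_ge_self])
qed

text \<open>The single operation \<open>U + c V\<close> covers sums, differences
  (\<open>c = -1\<close>) and scalar multiples, so linearity is stated through it alone from here
  on.\<close>

lemma L2_add_scale:
  assumes U: "U \<in> L2 M" and V: "V \<in> L2 M"
  shows "(\<lambda>z. U z + bc_of_complex c \<odot> V z) \<in> L2 M"
    and "L2_sq M (\<lambda>z. U z + bc_of_complex c \<odot> V z) = L2_sq M U + 2 * Re (cnj c * L2_ip M U V) + (cmod c)\<^sup>2 * L2_sq M V"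
proof -
  have m: "U \<in> borel_measurable M" "V \<in> borel_measurable M"
    and i: "integrable M (\<lambda>z. (norm (U z))\<^sup>2)" "integrable M (\<lambda>z. (norm (V z))\<^sup>2)"
    using U V by (auto simp: L2_def)
  have p: "integrable M (\<lambda>z. cnj c * bc_inner (U z) (V z))" using integrable_bc_inner[OF U V] by simp
  have r: "integrable M (\<lambda>z. 2 * Re (cnj c * bc_inner (U z) (V z)))"
    by (rule integrable_mult_right) (rule integrable_Re[OF p])
  have v: "integrable M (\<lambda>z. (cmod c)\<^sup>2 * (norm (V z))\<^sup>2)" using i by simp
  have mm: "(\<lambda>z. U z + bc_of_complex c \<odot> V z) \<in> borel_measurable M"
    using m by (intro borel_measurable_add measurable_bc_mult) auto
  show "(\<lambda>z. U z + bc_of_complex c \<odot> V z) \<in> L2 M"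
    using mm i(1) r v
    by (simp only: L2_def mem_Collect_eq norm_bc_add_scale_sq simp_thms Bochner_Integration.integrable_add)
  have "L2_sq M (\<lambda>z. U z + bc_of_complex c \<odot> V z)
      = (\<integral>z. (norm (U z))\<^sup>2 \<partial>M) + (\<integral>z. 2 * Re (cnj c * bc_inner (U z) (V z)) \<partial>M) + (\<integral>z. (cmod c)\<^sup>2 * (norm (V z))\<^sup>2 \<partial>M)"
    unfolding L2_sq_def norm_bc_add_scale_sq
    by (simp only: Bochner_Integration.integral_add[OF Bochner_Integration.integrable_add[OF i(1) r] v] Bochner_Integration.integral_add[OF i(1) r])
  also have "(\<integral>z. 2 * Re (cnj c * bc_inner (U z) (V z)) \<partial>M) = 2 * Re (cnj c * L2_ip M U V)"
    by (simp only: L2_ip_def integral_mult_right_zero integral_Re[OF p])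
  finally show "L2_sq M (\<lambda>z. U z + bc_of_complex c \<odot> V z) = L2_sq M U + 2 * Re (cnj c * L2_ip M U V) + (cmod c)\<^sup>2 * L2_sq M V"
    by (simp add: L2_sq_def)
qed

lemma L2_ip_add_scale_left:
  assumes "U \<in> L2 M" "V \<in> L2 M" "X \<in> L2 M"
  shows "L2_ip M (\<lambda>z. U z + bc_of_complex c \<odot> V z) X = L2_ip M U X + c * L2_ip M V X"
  unfolding L2_ip_def bc_inner_add_left bc_inner_scale_left
  using integrable_bc_inner[OF assms(1,3)] integrable_bc_inner[OF assms(2,3)] by simp

lemma cnj_L2_ip: "cnj (L2_ip M U V) = L2_ip M V U"
proof -
  have "cnj (L2_ip M U V) = (\<integral>z. cnj (bc_inner (U z) (V z)) \<partial>M)"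
    unfolding L2_ip_def by (rule Bochner_Integration.integral_cnj[symmetric])
  then show ?thesis by (simp only: cnj_bc_inner L2_ip_def)
qed

text \<open>Minimise the quadratic at \<open>c = - p / B\<close>; if \<open>B = 0\<close>, an affine
  function bounded below forces \<open>p = 0\<close>. The case \<open>L = 0\<close> is
  Cauchy-Schwarz, the case of the minimal squared norm yields orthogonality to the
  hyperplane.\<close>

lemma quadratic_bound:
  fixes p :: complex and A B L :: real
  assumes q: "\<And>c. L \<le> A + 2 * Re (cnj c * p) + (cmod c)\<^sup>2 * B" and B: "0 \<le> B"
  shows "(cmod p)\<^sup>2 \<le> (A - L) * B"
proof (cases "B = 0")
  case False
  then have "0 < B" using B by simp
  have "cnj (- p / of_real B) * p = of_real (- (cmod p)\<^sup>2 / B)"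
    unfolding of_real_divide of_real_minus complex_norm_square by (simp add: mult.commute)
  then have 1: "Re (cnj (- p / of_real B) * p) = - ((cmod p)\<^sup>2 / B)"
    by (simp only: Re_complex_of_real minus_divide_left)
  have 2: "(cmod (- p / of_real B))\<^sup>2 * B = (cmod p)\<^sup>2 / B"
    using \<open>0 < B\<close> by (simp add: norm_divide power_divide power2_eq_square)
  have "L \<le> A - (cmod p)\<^sup>2 / B" using q[of "- p / of_real B"] unfolding 1 2 by linarith
  then show ?thesis using \<open>0 < B\<close> by (simp add: field_simps)
next
  case True
  have "p = 0"
  proof (rule ccontr)
    assume "p \<noteq> 0"
    then have P: "0 < (cmod p)\<^sup>2" by simp
    \<comment> \<open>This \<open>t\<close> brings the affine value down to \<open>L - 1\<close>,
      below the assumed bound.\<close>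
    define t where "t = (A - L + 1) / (2 * (cmod p)\<^sup>2)"
    have "Re (cnj (of_real (- t) * p) * p) = - t * (cmod p)\<^sup>2"
      unfolding cmod_power2 by (simp add: power2_eq_square algebra_simps)
    then have "L \<le> A - 2 * (t * (cmod p)\<^sup>2)" using q[of "of_real (- t) * p"] True by simp
    also have "2 * (t * (cmod p)\<^sup>2) = A - L + 1" using P by (simp add: t_def)
    finally show False by simp
  qed
  then show ?thesis using True by simp
qed

lemma L2_Cauchy_Schwarz:
  assumes "U \<in> L2 M" "V \<in> L2 M"
  shows "(cmod (L2_ip M U V))\<^sup>2 \<le> L2_sq M U * L2_sq M V"
proof -
  have "(cmod (L2_ip M U V))\<^sup>2 \<le> (L2_sq M U - 0) * L2_sq M V"
  proof (rule quadratic_bound)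
    show "0 \<le> L2_sq M U + 2 * Re (cnj c * L2_ip M U V) + (cmod c)\<^sup>2 * L2_sq M V" for c
      using L2_sq_nonneg[of M "\<lambda>z. U z + bc_of_complex c \<odot> V z"] unfolding L2_add_scale(2)[OF assms] .
  qed (rule L2_sq_nonneg)
  then show ?thesis by simp
qed

text \<open>The representing element is the normalised element of minimal norm on the hyperplane
  \<open>f = 1\<close>.\<close>
lemma Riesz_representation_L2:
  fixes f :: "('a \<Rightarrow> bicomplex) \<Rightarrow> complex"
  assumes S: "S \<subseteq> L2 M" and ne: "S \<noteq> {}"
    and lin: "\<And>U V c. U \<in> S \<Longrightarrow> V \<in> S \<Longrightarrow> (\<lambda>z. U z + bc_of_complex c \<odot> V z) \<in> S"
    and f_lin: "\<And>U V c. U \<in> S \<Longrightarrow> V \<in> S \<Longrightarrow> f (\<lambda>z. U z + bc_of_complex c \<odot> V z) = f U + c * f V"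
    and f_bd: "\<And>U. U \<in> S \<Longrightarrow> (cmod (f U))\<^sup>2 \<le> K * L2_sq M U"
    and complete: "\<And>w. (\<And>n. w n \<in> S) \<Longrightarrow>
       (\<And>e. 0 < e \<Longrightarrow> \<exists>n0::nat. \<forall>m\<ge>n0. \<forall>n\<ge>n0. L2_sq M (\<lambda>z. w m z + bc_of_complex (-1) \<odot> w n z) \<le> e) \<Longrightarrow>
       \<exists>v\<in>S. (\<lambda>n. L2_sq M (\<lambda>z. v z + bc_of_complex (-1) \<odot> w n z)) \<longlonglongrightarrow> 0"
  shows "\<exists>k\<in>S. \<forall>U\<in>S. f U = L2_ip M U k"
proof (cases "\<forall>U\<in>S. f U = 0")
  \<comment> \<open>The zero functional is treated apart because no element then satisfies
    \<open>f U = 1\<close>.\<close>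
  case True
  obtain U0 where U0: "U0 \<in> S" using ne by blast
  have "(\<lambda>z. U0 z + bc_of_complex (-1) \<odot> U0 z) = (\<lambda>z. 0)"
    by (simp add: fun_eq_iff bc_of_complex_mult prod_eq_iff)
  then have "(\<lambda>z. 0) \<in> S" using lin[OF U0 U0, of "-1"] by simp
  then show ?thesis using True by (intro bexI[of _ "\<lambda>z. 0"]) (auto simp: L2_ip_def bc_inner_def)
next
  case False
  then obtain U1 where U1: "U1 \<in> S" "f U1 \<noteq> 0" by blast
  have zero: "(\<lambda>z. 0) \<in> S"
  proof -
    have "(\<lambda>z. U1 z + bc_of_complex (-1) \<odot> U1 z) = (\<lambda>z. 0)"
      by (simp add: fun_eq_iff bc_of_complex_mult prod_eq_iff)
    then show ?thesis using lin[OF U1(1) U1(1), of "-1"] by simp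
  qed
  have f0: "f (\<lambda>z. 0) = 0" using f_lin[OF zero zero, of 1] by (simp add: bc.zero_right)
  have scale: "(\<lambda>z. bc_of_complex c \<odot> U z) \<in> S" "f (\<lambda>z. bc_of_complex c \<odot> U z) = c * f U"
    "L2_sq M (\<lambda>z. bc_of_complex c \<odot> U z) = (cmod c)\<^sup>2 * L2_sq M U" if "U \<in> S" for U c
    using lin[OF zero that, of c] f_lin[OF zero that, of c] f0
    by (simp_all add: L2_sq_def norm_bc_of_complex_mult power_mult_distrib)
  define E where "E = {U \<in> S. f U = 1}"
  define d where "d = Inf (L2_sq M ` E)"
  have Ene: "E \<noteq> {}" using scale(1,2)[OF U1(1), of "inverse (f U1)"] U1(2) by (auto simp: E_def)
  have bdd: "bdd_below (L2_sq M ` E)" by (rule bdd_belowI[of _ 0]) (auto simp: L2_sq_nonneg)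
  have d_le: "d \<le> L2_sq M U" if "U \<in> E" for U unfolding d_def using that bdd by (intro cInf_lower) auto
  have "\<exists>U\<in>E. L2_sq M U < d + 1 / real (Suc n)" for n
    using cInf_lessD[of "L2_sq M ` E" "d + 1 / real (Suc n)"] Ene by (auto simp: d_def)
  then have "\<exists>U. U \<in> E \<and> L2_sq M U < d + 1 / real (Suc n)" for n by blast
  then have "\<exists>w. \<forall>n. w n \<in> E \<and> L2_sq M (w n) < d + 1 / real (Suc n)" by (intro choice allI)
  then obtain w where w: "\<And>n. w n \<in> E" "\<And>n. L2_sq M (w n) < d + 1 / real (Suc n)" by blast
  have wS: "w n \<in> S" and fw: "f (w n) = 1" for n using w(1) by (auto simp: E_def)
  have wL: "w n \<in> L2 M" for n using wS S by blast
  \<comment> \<open>Parallelogram law: the midpoint of \<open>w m\<close> and \<open>w n\<close>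
    stays on the hyperplane, so their sum has squared norm at least \<open>4 * d\<close>.\<close>
  have par: "L2_sq M (\<lambda>z. w m z + bc_of_complex (-1) \<odot> w n z) \<le> 2 / real (Suc m) + 2 / real (Suc n)" for m n
  proof -
    let ?s = "\<lambda>z. w m z + bc_of_complex 1 \<odot> w n z"
    have s: "?s \<in> S" "f ?s = 2" using lin[OF wS wS, of m 1 n] f_lin[OF wS wS, of m 1 n] by (auto simp: fw)
    have "(\<lambda>z. bc_of_complex (1/2) \<odot> ?s z) \<in> E" using scale(1,2)[OF s(1), of "1/2"] s(2) by (simp add: E_def)
    from d_le[OF this] have "4 * d \<le> L2_sq M ?s" unfolding scale(3)[OF s(1)] by (simp add: power2_eq_square)
    moreover have "L2_sq M (\<lambda>z. w m z + bc_of_complex (-1) \<odot> w n z) + L2_sq M ?s = 2 * L2_sq M (w m) + 2 * L2_sq M (w n)"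
      unfolding L2_add_scale(2)[OF wL wL] by simp
    ultimately show ?thesis using w(2)[of m] w(2)[of n] by simp
  qed
  have cau: "\<exists>n0. \<forall>m\<ge>n0. \<forall>n\<ge>n0. L2_sq M (\<lambda>z. w m z + bc_of_complex (-1) \<odot> w n z) \<le> e" if e: "0 < e" for e
  proof -
    obtain n0 where n0: "inverse (real (Suc n0)) < e / 4" using reals_Archimedean[of "e/4"] e by auto
    have le: "2 / real (Suc m) \<le> e / 2" if "m \<ge> n0" for m
    proof -
      have "2 / real (Suc m) \<le> 2 / real (Suc n0)" using that by (intro divide_left_mono) auto
      also have "\<dots> = 2 * inverse (real (Suc n0))" by (rule divide_inverse)
      also have "\<dots> \<le> e / 2" using n0 by linarith
      finally show ?thesis .
    qed
    show ?thesis
    proof (intro exI[of _ n0] allI impI)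
      fix m n assume "n0 \<le> m" "n0 \<le> n"
      then show "L2_sq M (\<lambda>z. w m z + bc_of_complex (-1) \<odot> w n z) \<le> e"
        using par[of m n] le[of m] le[of n] by linarith
    qed
  qed
  obtain v where v: "v \<in> S" and lim: "(\<lambda>n. L2_sq M (\<lambda>z. v z + bc_of_complex (-1) \<odot> w n z)) \<longlonglongrightarrow> 0"
    using complete[OF wS cau] by blast
  have vL: "v \<in> L2 M" using v S by blast
  have null: "g \<longlonglongrightarrow> 0" if "(\<lambda>n. (cmod (g n))\<^sup>2) \<longlonglongrightarrow> 0" for g :: "nat \<Rightarrow> complex"
  proof (rule tendsto_norm_zero_cancel)
    have "(\<lambda>n. sqrt ((cmod (g n))\<^sup>2)) \<longlonglongrightarrow> sqrt 0" using that by (rule tendsto_real_sqrt)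
    then show "(\<lambda>n. cmod (g n)) \<longlonglongrightarrow> 0" by simp
  qed
  \<comment> \<open>A constant within vanishing distance of a null sequence is 0. This serves both
    \<open>f v - 1\<close>, with \<open>y = 0\<close>, and \<open>L2_ip M v U\<close>, with
    \<open>y n = L2_ip M (w n) U\<close>.\<close>
  have squeeze: "x = 0" if "\<And>n. (cmod (x - y n))\<^sup>2 \<le> C * L2_sq M (\<lambda>z. v z + bc_of_complex (-1) \<odot> w n z)"
    "\<And>n. (cmod (y n))\<^sup>2 \<le> D * (1 / real (Suc n))" for x :: complex and y C D
  proof -
    have "(\<lambda>n. C * L2_sq M (\<lambda>z. v z + bc_of_complex (-1) \<odot> w n z)) \<longlonglongrightarrow> 0"
      by (rule tendsto_mult_right_zero[OF lim])
    then have "(\<lambda>n. (cmod (x - y n))\<^sup>2) \<longlonglongrightarrow> 0"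
      by (rule Lim_null_comparison[rotated]) (intro always_eventually allI, use that(1) in simp)
    then have 1: "(\<lambda>n. x - y n) \<longlonglongrightarrow> 0" by (rule null)
    have "(\<lambda>n. D * (1 / real (Suc n))) \<longlonglongrightarrow> 0"
      using tendsto_mult_right_zero[OF LIMSEQ_inverse_real_of_nat, of D] unfolding inverse_eq_divide .
    then have "(\<lambda>n. (cmod (y n))\<^sup>2) \<longlonglongrightarrow> 0"
      by (rule Lim_null_comparison[rotated]) (intro always_eventually allI, use that(2) in simp)
    then have 2: "y \<longlonglongrightarrow> 0" by (rule null)
    from tendsto_add[OF 1 2] have "(\<lambda>n. x) \<longlonglongrightarrow> 0" by simp
    then show ?thesis by (simp add: LIMSEQ_const_iff)
  qed
  have fv: "f v = 1"
  proof -
    have "f v - 1 = 0"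
    proof (rule squeeze[where y="\<lambda>_. 0" and D=0 and C=K])
      fix n show "(cmod (f v - 1 - 0))\<^sup>2 \<le> K * L2_sq M (\<lambda>z. v z + bc_of_complex (-1) \<odot> w n z)"
        using f_bd[OF lin[OF v wS[of n], of "-1"]] f_lin[OF v wS[of n], of "-1"] by (simp add: fw)
    qed simp
    then show ?thesis by simp
  qed
  \<comment> \<open>Adding multiples of \<open>U\<close> to \<open>w n\<close> stays on the
    hyperplane, so the squared norm never drops below \<open>d\<close>; as \<open>w n\<close> is
    within \<open>1 / Suc n\<close> of the minimum, \<open>quadratic_bound\<close> makes its inner
    product with \<open>U\<close> small.\<close>
  have orth: "L2_ip M U v = 0" if U: "U \<in> S" "f U = 0" for U
  proof -
    have UL: "U \<in> L2 M" using U S by blast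
    have "L2_ip M v U = 0"
    proof (rule squeeze)
      fix n
      have "L2_ip M v U - L2_ip M (w n) U = L2_ip M (\<lambda>z. v z + bc_of_complex (-1) \<odot> w n z) U"
        by (simp add: L2_ip_add_scale_left[OF vL wL UL])
      then show "(cmod (L2_ip M v U - L2_ip M (w n) U))\<^sup>2
          \<le> L2_sq M U * L2_sq M (\<lambda>z. v z + bc_of_complex (-1) \<odot> w n z)"
        using L2_Cauchy_Schwarz[OF L2_add_scale(1)[OF vL wL] UL] by (simp add: mult.commute)
      have "(cmod (L2_ip M (w n) U))\<^sup>2 \<le> (L2_sq M (w n) - d) * L2_sq M U"
      proof (rule quadratic_bound)
        fix c
        have "(\<lambda>z. w n z + bc_of_complex c \<odot> U z) \<in> E"
          using lin[OF wS U(1)] f_lin[OF wS U(1)] U(2) by (simp add: E_def fw)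
        from d_le[OF this] show "d \<le> L2_sq M (w n) + 2 * Re (cnj c * L2_ip M (w n) U) + (cmod c)\<^sup>2 * L2_sq M U"
          unfolding L2_add_scale(2)[OF wL UL] .
      qed (rule L2_sq_nonneg)
      also have "\<dots> \<le> (1 / real (Suc n)) * L2_sq M U"
        using w(2)[of n] by (intro mult_right_mono L2_sq_nonneg) linarith
      finally show "(cmod (L2_ip M (w n) U))\<^sup>2 \<le> L2_sq M U * (1 / real (Suc n))" by (simp only: mult.commute)
    qed
    then show ?thesis using cnj_L2_ip[of M v U] by simp
  qed
  have vsq: "L2_ip M v v = of_real (L2_sq M v)"
  proof -
    have "bc_inner X X = of_real ((norm X)\<^sup>2)" for X
      unfolding norm_bicomplex_sq bc_inner_def by (simp only: complex_norm_square of_real_add)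
    then show ?thesis by (simp only: L2_ip_def L2_sq_def integral_complex_of_real)
  qed
  have "0 < L2_sq M v"
  proof -
    \<comment> \<open>The seminorm could vanish on a nonzero function; the bound on \<open>f\<close>
      together with \<open>f v = 1\<close> excludes it.\<close>
    have "L2_sq M v \<noteq> 0" using f_bd[OF v] fv by auto
    then show ?thesis using L2_sq_nonneg[of M v] by simp
  qed
  \<comment> \<open>Since \<open>U - f U v\<close> is annihilated by \<open>f\<close>, it is
    orthogonal to \<open>v\<close>; hence the inner product of \<open>U\<close> with
    \<open>v\<close> is \<open>f U\<close> times \<open>L2_sq M v\<close>, which fixes the
    normalisation.\<close>
  define k where "k z = bc_of_complex (of_real (1 / L2_sq M v)) \<odot> v z" for z
  have kS: "k \<in> S" using scale(1)[OF v, of "of_real (1 / L2_sq M v)"] by (simp add: k_def[abs_def])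
  show ?thesis
  proof (intro bexI[OF _ kS] ballI)
    fix U assume U: "U \<in> S"
    then have UL: "U \<in> L2 M" using S by blast
    have "L2_ip M (\<lambda>z. U z + bc_of_complex (- f U) \<odot> v z) v = 0"
      by (rule orth) (use lin[OF U v] f_lin[OF U v] fv in auto)
    then have "L2_ip M U v = f U * of_real (L2_sq M v)"
      by (simp add: L2_ip_add_scale_left[OF UL vL vL] vsq)
    moreover have "L2_ip M U k = of_real (1 / L2_sq M v) * L2_ip M U v"
      unfolding L2_ip_def k_def bc_inner_scale_right by simp
    ultimately show "f U = L2_ip M U k" using \<open>0 < L2_sq M v\<close> by simp
  qed
qed

section \<open>The Bergman space and its kernels\<close>

lemma bounded_if_compact_support:
  fixes g :: "'a::metric_space \<Rightarrow> 'b::real_normed_vector"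
  assumes "continuous_on UNIV g" "compact S" "\<And>z. z \<notin> S \<Longrightarrow> g z = 0"
  shows "\<exists>B. \<forall>z. norm (g z) \<le> B"
proof -
  have "bounded (g ` S)"
    by (intro compact_imp_bounded compact_continuous_image continuous_on_subset[OF assms(1)] assms(2)) simp
  then obtain B where B: "0 < B" "\<forall>x\<in>g ` S. norm x \<le> B" unfolding bounded_pos by blast
  have "norm (g z) \<le> B" for z
    using B assms(3)[of z] by (cases "z \<in> S") auto
  then show ?thesis by blast
qed

lemma test_function_props:
  assumes "f \<in> test_functions \<Omega>"
  shows "continuous_on UNIV f" "continuous_on UNIV (partial_x f)" "continuous_on UNIV (partial_y f)"
    and "\<And>z. f differentiable (at z)"
    and "compact (closure {z. f z \<noteq> 0})"
    and "\<And>z. z \<notin> closure {z. f z \<noteq> 0} \<Longrightarrow> f z = 0 \<and> partial_x f z = 0 \<and> partial_y f z = 0"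
proof -
  have C: "C_times n f" for n using assms by (simp add: test_functions_def)
  show "continuous_on UNIV f" using C[of 0] by simp
  show "continuous_on UNIV (partial_x f)" "continuous_on UNIV (partial_y f)" "\<And>z. f differentiable (at z)"
    using C[of "Suc 0"] by simp_all
  show "compact (closure {z. f z \<noteq> 0})" using assms by (simp add: test_functions_def)
  fix z assume z: "z \<notin> closure {z. f z \<noteq> 0}"
  have f0: "f w = 0" if "w \<in> - closure {z. f z \<noteq> 0}" for w
    using that closure_subset[of "{z. f z \<noteq> 0}"] by auto
  have "(f has_derivative (\<lambda>_. 0)) (at z)"
  proof (rule has_derivative_transform_within_open)
    show "((\<lambda>_. 0) has_derivative (\<lambda>_. 0)) (at z)" by (rule has_derivative_const)
    show "open (- closure {z. f z \<noteq> 0})" by (rule open_Compl[OF closed_closure])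
    show "z \<in> - closure {z. f z \<noteq> 0}" using z by simp
    show "0 = f w" if "w \<in> - closure {z. f z \<noteq> 0}" for w using f0[OF that] by (rule sym)
  qed
  then show "f z = 0 \<and> partial_x f z = 0 \<and> partial_y f z = 0"
    using partial_has_derivative[of f "\<lambda>_. 0" z] f0[of z] z by simp
qed

text \<open>\<open>vector_derivative\<close> is a choice that means something only where a
  derivative exists; differentiability of both components is what allows it to be computed
  componentwise.\<close>

lemma partial_bicomplex:
  assumes "(\<lambda>z. Sc (\<phi> z)) differentiable (at z)" "(\<lambda>z. Vec (\<phi> z)) differentiable (at z)"
  shows "partial_x \<phi> z = (partial_x (\<lambda>z. Sc (\<phi> z)) z, partial_x (\<lambda>z. Vec (\<phi> z)) z)"
    and "partial_y \<phi> z = (partial_y (\<lambda>z. Sc (\<phi> z)) z, partial_y (\<lambda>z. Vec (\<phi> z)) z)"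
proof -
  obtain D E where D: "((\<lambda>z. Sc (\<phi> z)) has_derivative D) (at z)" and E: "((\<lambda>z. Vec (\<phi> z)) has_derivative E) (at z)"
    using assms unfolding differentiable_def by blast
  have "(\<phi> has_derivative (\<lambda>h. (D h, E h))) (at z)" using has_derivative_Pair[OF D E] by simp
  note p = partial_has_derivative[OF this] partial_has_derivative[OF D] partial_has_derivative[OF E]
  show "partial_x \<phi> z = (partial_x (\<lambda>z. Sc (\<phi> z)) z, partial_x (\<lambda>z. Vec (\<phi> z)) z)"
    "partial_y \<phi> z = (partial_y (\<lambda>z. Sc (\<phi> z)) z, partial_y (\<lambda>z. Vec (\<phi> z)) z)"
    unfolding p by simp_all
qed

lemma test_function_bounds:
  assumes "\<phi> \<in> bc_space (test_functions \<Omega>)"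
  shows "continuous_on UNIV \<phi>" "continuous_on UNIV (dbar \<phi>)"
    and "\<exists>B. \<forall>z. norm (\<phi> z) \<le> B" "\<exists>B. \<forall>z. norm (dbar \<phi> z) \<le> B"
proof -
  have t1: "(\<lambda>z. Sc (\<phi> z)) \<in> test_functions \<Omega>" and t2: "(\<lambda>z. Vec (\<phi> z)) \<in> test_functions \<Omega>"
    using assms by (simp_all add: bc_space_def)
  note p1 = test_function_props[OF t1] and p2 = test_function_props[OF t2]
  have x: "partial_x \<phi> = (\<lambda>z. (partial_x (\<lambda>z. Sc (\<phi> z)) z, partial_x (\<lambda>z. Vec (\<phi> z)) z))"
    and y: "partial_y \<phi> = (\<lambda>z. (partial_y (\<lambda>z. Sc (\<phi> z)) z, partial_y (\<lambda>z. Vec (\<phi> z)) z))"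
    using partial_bicomplex[OF p1(4) p2(4)] by auto
  have "continuous_on UNIV (\<lambda>z. (Sc (\<phi> z), Vec (\<phi> z)))" by (intro continuous_on_Pair p1 p2)
  then show c: "continuous_on UNIV \<phi>" by simp
  show d: "continuous_on UNIV (dbar \<phi>)"
    unfolding dbar_def x y
    by (intro continuous_on_scaleR continuous_on_add continuous_on_const bc.continuous_on continuous_on_Pair p1 p2)
  let ?S = "closure {z. Sc (\<phi> z) \<noteq> 0} \<union> closure {z. Vec (\<phi> z) \<noteq> 0}"
  have S: "compact ?S" by (intro compact_Un p1 p2)
  have z: "\<phi> z = 0 \<and> dbar \<phi> z = 0" if "z \<notin> ?S" for z
  proof -
    have "z \<notin> closure {z. Sc (\<phi> z) \<noteq> 0}" "z \<notin> closure {z. Vec (\<phi> z) \<noteq> 0}" using that by blast+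
    from p1(6)[OF this(1)] p2(6)[OF this(2)] show ?thesis
      by (simp add: dbar_def x y prod_eq_iff bc_mult_def)
  qed
  show "\<exists>B. \<forall>z. norm (\<phi> z) \<le> B"
    using z by (intro bounded_if_compact_support[OF c S]) blast
  show "\<exists>B. \<forall>z. norm (dbar \<phi> z) \<le> B"
    using z by (intro bounded_if_compact_support[OF d S]) blast
qed

section \<open>The Bergman space as a complete complex subspace\<close>

context vekua_domain
begin

lemma L2_space_eq: "bc_space (L2_space \<Omega>) = L2 M"
  by (auto simp: bc_L2_space_iff L2_def)

lemma sq_eq: "sq W = L2_sq M W"
  by (simp add: sq_def L2_sq_def)

lemma L2_inner_eq: "L2_inner \<Omega> U V = L2_ip M U V"
  by (simp add: L2_inner_def L2_ip_def)

lemma integrable_L2: "W \<in> L2 M \<Longrightarrow> integrable M W"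
  using integrable_if_L2 by (simp add: L2_space_eq)

lemma integrable_rhs:
  assumes W: "W \<in> L2 M" shows "integrable M (rhs W)"
proof (rule Bochner_Integration.integrable_bound)
  show "integrable M (\<lambda>z. coeff_bound * norm (W z))" using integrable_L2[OF W] by simp
  show "rhs W \<in> borel_measurable M" by (rule measurable_rhs) (use W in \<open>simp add: L2_def\<close>)
  show "AE z in M. norm (rhs W z) \<le> norm (coeff_bound * norm (W z))"
    using coeff_bound(2)[of W] by eventually_elim simp
qed

text \<open>The conjugation changes the sign of \<open>j\<close> only and so commutes with complex
  scalars. The equation is therefore complex linear, and the Riesz argument with complex scalars
  applies.\<close>

lemma rhs_add_scale:
  "rhs (\<lambda>z. U z + bc_of_complex c \<odot> V z) z = rhs U z + bc_of_complex c \<odot> rhs V z"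
  by (simp add: rhs_def bc_mult_def bc_of_complex_def bc_cnj_def algebra_simps)

text \<open>The residual of the weak equation at one test function. The Bergman space is the common
  kernel of these linear maps, so their continuity makes it closed.\<close>

definition defect :: "(complex \<Rightarrow> bicomplex) \<Rightarrow> (complex \<Rightarrow> bicomplex) \<Rightarrow> bicomplex" where
  "defect \<phi> W = (\<integral>z. W z \<odot> dbar \<phi> z \<partial>M) + (\<integral>z. rhs W z \<odot> \<phi> z \<partial>M)"

lemma test_measurable:
  assumes "\<phi> \<in> bc_space (test_functions \<Omega>)"
  shows "\<phi> \<in> borel_measurable M" "dbar \<phi> \<in> borel_measurable M"
  using test_function_bounds(1,2)[OF assms]
  by (auto intro!: measurable_restrict_space1 measurable_completion borel_measurable_continuous_onI)

lemma integrable_test: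
  assumes \<phi>: "\<phi> \<in> bc_space (test_functions \<Omega>)" and W: "W \<in> L2 M"
  shows "integrable M (\<lambda>z. W z \<odot> dbar \<phi> z)" "integrable M (\<lambda>z. rhs W z \<odot> \<phi> z)"
proof -
  obtain B1 B2 where "\<And>z. norm (\<phi> z) \<le> B1" "\<And>z. norm (dbar \<phi> z) \<le> B2"
    using test_function_bounds(3,4)[OF \<phi>] by blast
  then show "integrable M (\<lambda>z. W z \<odot> dbar \<phi> z)" "integrable M (\<lambda>z. rhs W z \<odot> \<phi> z)"
    using integrable_L2[OF W] integrable_rhs[OF W] test_measurable[OF \<phi>]
    by (auto intro!: integrable_bc_mult_bounded)
qed

lemma defect_add_scale:
  assumes \<phi>: "\<phi> \<in> bc_space (test_functions \<Omega>)" and U: "U \<in> L2 M" and V: "V \<in> L2 M"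
  shows "defect \<phi> (\<lambda>z. U z + bc_of_complex c \<odot> V z) = defect \<phi> U + bc_of_complex c \<odot> defect \<phi> V"
proof -
  note iU = integrable_test[OF \<phi> U] and iV = integrable_test[OF \<phi> V]
  have s: "(\<integral>z. bc_of_complex c \<odot> f z \<partial>M) = bc_of_complex c \<odot> (\<integral>z. f z \<partial>M)"
    "integrable M (\<lambda>z. bc_of_complex c \<odot> f z)" if "integrable M f" for f :: "complex \<Rightarrow> bicomplex"
    using integral_bounded_linear[OF bc.bounded_linear_right that] integrable_bounded_linear[OF bc.bounded_linear_right that] by auto
  have "defect \<phi> (\<lambda>z. U z + bc_of_complex c \<odot> V z)
      = (\<integral>z. U z \<odot> dbar \<phi> z + bc_of_complex c \<odot> (V z \<odot> dbar \<phi> z) \<partial>M)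
        + (\<integral>z. rhs U z \<odot> \<phi> z + bc_of_complex c \<odot> (rhs V z \<odot> \<phi> z) \<partial>M)"
    unfolding defect_def rhs_add_scale bc.add_left bc_mult_assoc ..
  also have "\<dots> = defect \<phi> U + bc_of_complex c \<odot> defect \<phi> V"
    unfolding defect_def bc.add_right
      Bochner_Integration.integral_add[OF iU(1) s(2)[OF iV(1)]] Bochner_Integration.integral_add[OF iU(2) s(2)[OF iV(2)]]
      s(1)[OF iV(1)] s(1)[OF iV(2)]
    by (simp only: add_ac)
  finally show ?thesis .
qed

text \<open>Bounded test functions reduce the defect to the \<open>L1\<close> norm of
  \<open>W\<close>, and Cauchy-Schwarz against the constant 1 passes to the \<open>L2\<close> norm
  on a finite measure space.\<close>

lemma defect_bound:
  assumes \<phi>: "\<phi> \<in> bc_space (test_functions \<Omega>)"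
  shows "\<exists>K. \<forall>W\<in>L2 M. (norm (defect \<phi> W))\<^sup>2 \<le> K * L2_sq M W"
proof -
  obtain B1 B2 where B: "\<And>z. norm (\<phi> z) \<le> B1" "\<And>z. norm (dbar \<phi> z) \<le> B2"
    using test_function_bounds(3,4)[OF \<phi>] by blast
  have B0: "0 \<le> B1" "0 \<le> B2" using B[of 0] norm_ge_zero order_trans by blast+
  interpret finite_measure M by (rule finite_measure_M)
  let ?C = "4 * B2 + 4 * coeff_bound * B1"
  let ?one = "\<lambda>z::complex. (1, 0) :: bicomplex"
  have C: "0 \<le> ?C" using B0 coeff_bound(1) by simp
  have "(norm (defect \<phi> W))\<^sup>2 \<le> ?C\<^sup>2 * L2_sq M ?one * L2_sq M W" if W: "W \<in> L2 M" for W
  proof -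
    note i = integrable_test[OF \<phi> W] and iW = integrable_norm[OF integrable_L2[OF W]]
    have "norm (\<integral>z. W z \<odot> dbar \<phi> z \<partial>M) \<le> (\<integral>z. 4 * B2 * norm (W z) \<partial>M)"
    proof (rule order_trans[OF integral_norm_bound integral_mono_AE])
      have "norm (W z \<odot> dbar \<phi> z) \<le> 4 * B2 * norm (W z)" for z
        using order_trans[OF norm_bc_mult mult_left_mono[OF B(2)], of "W z" z] by (simp add: mult_ac)
      then show "AE z in M. norm (W z \<odot> dbar \<phi> z) \<le> 4 * B2 * norm (W z)" by simp
    qed (use iW i in auto)
    moreover have "norm (\<integral>z. rhs W z \<odot> \<phi> z \<partial>M) \<le> (\<integral>z. 4 * coeff_bound * B1 * norm (W z) \<partial>M)"
    proof (rule order_trans[OF integral_norm_bound integral_mono_AE])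
      show "AE z in M. norm (rhs W z \<odot> \<phi> z) \<le> 4 * coeff_bound * B1 * norm (W z)"
        using coeff_bound(2)[of W]
      proof eventually_elim
        case (elim z)
        have "norm (rhs W z \<odot> \<phi> z) \<le> 4 * norm (rhs W z) * norm (\<phi> z)" by (rule norm_bc_mult)
        also have "\<dots> \<le> 4 * (coeff_bound * norm (W z)) * B1"
          using elim B(1)[of z] coeff_bound(1) by (intro mult_mono) auto
        finally show ?case by (simp add: mult_ac)
      qed
    qed (use iW i in auto)
    ultimately have "norm (defect \<phi> W) \<le> ?C * (\<integral>z. norm (W z) \<partial>M)"
      unfolding defect_def using norm_triangle_ineq[of "\<integral>z. W z \<odot> dbar \<phi> z \<partial>M" "\<integral>z. rhs W z \<odot> \<phi> z \<partial>M"]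
      by (simp add: distrib_right)
    then have "(norm (defect \<phi> W))\<^sup>2 \<le> (?C * (\<integral>z. norm (W z) \<partial>M))\<^sup>2"
      by (intro power_mono) auto
    also have "\<dots> = ?C\<^sup>2 * (\<integral>z. norm (W z) \<partial>M)\<^sup>2" by (rule power_mult_distrib)
    also have "\<dots> \<le> ?C\<^sup>2 * (L2_sq M W * L2_sq M ?one)"
    proof (rule mult_left_mono)
      \<comment> \<open>The scalar function \<open>norm (W z)\<close> is packaged as a bicomplex one
        so that \<open>L2_Cauchy_Schwarz\<close> applies.\<close>
      let ?n = "\<lambda>z. (complex_of_real (norm (W z)), 0) :: bicomplex"
      have "?n \<in> L2 M" using W by (auto simp: L2_def measurable_bicomplex_iff norm_prod_def)
      moreover have "?one \<in> L2 M" by (simp add: L2_def)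
      ultimately have "(cmod (L2_ip M ?n ?one))\<^sup>2 \<le> L2_sq M ?n * L2_sq M ?one" by (rule L2_Cauchy_Schwarz)
      moreover have "L2_ip M ?n ?one = of_real (\<integral>z. norm (W z) \<partial>M)"
        by (simp add: L2_ip_def bc_inner_def)
      moreover have "L2_sq M ?n = L2_sq M W" by (simp add: L2_sq_def norm_prod_def)
      ultimately show "(\<integral>z. norm (W z) \<partial>M)\<^sup>2 \<le> L2_sq M W * L2_sq M ?one" by simp
    qed simp
    finally show ?thesis by (simp only: mult_ac)
  qed
  then show ?thesis by blast
qed

lemma integrable_on_compact:
  fixes f :: "complex \<Rightarrow> complex"
  assumes f: "integrable M f" and K: "compact K" "K \<subseteq> \<Omega>"
  shows "integrable (lebesgue_on K) f"
proof -
  have Ks: "K \<in> sets lebesgue" using K by (simp add: compact_imp_closed borel_closed)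
  have "integrable lebesgue (\<lambda>z. if z \<in> \<Omega> then f z else 0)"
    using f by (simp add: Lebesgue_Measure.integrable_restrict_UNIV[OF sets_dom(1)])
  from integrable_mult_indicator[OF Ks this]
  have "integrable lebesgue (\<lambda>z. if z \<in> K then f z else 0)"
    by (rule back_subst[of "integrable lebesgue"]) (use K in \<open>auto simp: fun_eq_iff indicator_def\<close>)
  then show ?thesis by (simp add: Lebesgue_Measure.integrable_restrict_UNIV[OF Ks])
qed

lemma A2_iff: "W \<in> A2 \<longleftrightarrow> W \<in> L2 M \<and> (\<forall>\<phi>\<in>bc_space (test_functions \<Omega>). defect \<phi> W = 0)"
proof
  assume W: "W \<in> A2"
  have "defect \<phi> W = 0" if "\<phi> \<in> bc_space (test_functions \<Omega>)" for \<phi>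
    unfolding defect_def A2_D(2)[OF W that] by simp
  then show "W \<in> L2 M \<and> (\<forall>\<phi>\<in>bc_space (test_functions \<Omega>). defect \<phi> W = 0)"
    using A2_D(1)[OF W] unfolding L2_space_eq by blast
next
  assume "W \<in> L2 M \<and> (\<forall>\<phi>\<in>bc_space (test_functions \<Omega>). defect \<phi> W = 0)"
  then have W: "W \<in> L2 M" and d: "\<And>\<phi>. \<phi> \<in> bc_space (test_functions \<Omega>) \<Longrightarrow> defect \<phi> W = 0" by auto
  have "rhs W \<in> bc_space (L1_loc \<Omega>)"
    unfolding bc_space_def L1_loc_def mem_Collect_eq
    by (intro conjI allI impI; elim conjE; rule integrable_on_compact)
      (auto intro: integrable_fst integrable_snd integrable_rhs W)
  moreover have "(\<integral>z. W z \<odot> dbar \<phi> z \<partial>M) = - (\<integral>z. rhs W z \<odot> \<phi> z \<partial>M)"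
    if "\<phi> \<in> bc_space (test_functions \<Omega>)" for \<phi>
    using d[OF that] unfolding defect_def by (rule eq_neg_iff_add_eq_0[THEN iffD2])
  ultimately have "is_weak_dbar \<Omega> W (rhs W)"
    using W unfolding is_weak_dbar_def L2_space_eq by blast
  then show "W \<in> A2"
    using W unfolding vekua_bergman_def mem_Collect_eq L2_space_eq rhs_def[abs_def] by blast
qed

lemma A2_add_scale:
  assumes "U \<in> A2" "V \<in> A2" shows "(\<lambda>z. U z + bc_of_complex c \<odot> V z) \<in> A2"
  using assms by (simp add: A2_iff L2_add_scale(1) defect_add_scale bc.zero_right)

lemma cont_rep_add_scale:
  assumes U: "U \<in> A2" and V: "V \<in> A2" and z: "z \<in> \<Omega>"
  shows "cont_rep \<Omega> (\<lambda>z. U z + bc_of_complex c \<odot> V z) z = cont_rep \<Omega> U z + bc_of_complex c \<odot> cont_rep \<Omega> V z"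
proof (rule cont_rep_unique[OF A2_add_scale[OF U V] _ _ z])
  show "continuous_on \<Omega> (\<lambda>z. cont_rep \<Omega> U z + bc_of_complex c \<odot> cont_rep \<Omega> V z)"
    by (intro continuous_on_add bc.continuous_on continuous_on_const cont_rep U V)
  show "AE z in M. cont_rep \<Omega> U z + bc_of_complex c \<odot> cont_rep \<Omega> V z = U z + bc_of_complex c \<odot> V z"
    using cont_rep(2)[OF U] cont_rep(2)[OF V] by eventually_elim simp
qed

lemma measurable_cont_rep: "W \<in> A2 \<Longrightarrow> cont_rep \<Omega> W \<in> borel_measurable M"
  by (intro continuous_imp_measurable_on_sets_lebesgue cont_rep sets_dom)

lemma cont_rep_L2:
  assumes W: "W \<in> A2" shows "cont_rep \<Omega> W \<in> L2 M"
proof -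
  have W2: "W \<in> borel_measurable M" "integrable M (\<lambda>z. (norm (W z))\<^sup>2)" using W by (auto simp: A2_iff L2_def)
  have "integrable M (\<lambda>z. (norm (cont_rep \<Omega> W z))\<^sup>2) \<longleftrightarrow> integrable M (\<lambda>z. (norm (W z))\<^sup>2)"
  proof (rule integrable_cong_AE)
    show "AE z in M. (norm (cont_rep \<Omega> W z))\<^sup>2 = (norm (W z))\<^sup>2"
      using cont_rep(2)[OF W] by eventually_elim simp
  qed (use W2 measurable_cont_rep[OF W] in auto)
  then show ?thesis using W2 measurable_cont_rep[OF W] by (simp add: L2_def)
qed

lemma A2_closed:
  assumes w: "\<And>n. w n \<in> A2" and v: "v \<in> L2 M"
    and lim: "(\<lambda>n. L2_sq M (\<lambda>z. v z + bc_of_complex (-1) \<odot> w n z)) \<longlonglongrightarrow> 0"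
  shows "v \<in> A2"
proof -
  have "defect \<phi> v = 0" if \<phi>: "\<phi> \<in> bc_space (test_functions \<Omega>)" for \<phi>
  proof -
    obtain K where K: "\<And>W. W \<in> L2 M \<Longrightarrow> (norm (defect \<phi> W))\<^sup>2 \<le> K * L2_sq M W"
      using defect_bound[OF \<phi>] by blast
    have "(norm (defect \<phi> v))\<^sup>2 \<le> K * L2_sq M (\<lambda>z. v z + bc_of_complex (-1) \<odot> w n z)" for n
    proof -
      have wn: "w n \<in> L2 M" "defect \<phi> (w n) = 0" using w[of n] \<phi> by (auto simp: A2_iff)
      then have "defect \<phi> (\<lambda>z. v z + bc_of_complex (-1) \<odot> w n z) = defect \<phi> v"
        using defect_add_scale[OF \<phi> v wn(1), of "-1"] by (simp add: bc.zero_right)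
      then show ?thesis using K[OF L2_add_scale(1)[OF v wn(1), of "-1"]] by simp
    qed
    then have "(norm (defect \<phi> v))\<^sup>2 \<le> 0"
      by (intro LIMSEQ_le_const[OF tendsto_mult_right_zero[OF lim, of K]]) auto
    then show ?thesis by simp
  qed
  then show ?thesis using v by (simp add: A2_iff)
qed

text \<open>Point evaluations are bounded, so a Cauchy sequence converges pointwise and Fatou's lemma
  makes the pointwise limit an \<open>L2\<close> limit.\<close>
lemma A2_complete:
  assumes w: "\<And>n. w n \<in> A2"
    and cau: "\<And>e. 0 < e \<Longrightarrow> \<exists>n0::nat. \<forall>m\<ge>n0. \<forall>n\<ge>n0. L2_sq M (\<lambda>z. w m z + bc_of_complex (-1) \<odot> w n z) \<le> e"
  shows "\<exists>v\<in>A2. (\<lambda>n. L2_sq M (\<lambda>z. v z + bc_of_complex (-1) \<odot> w n z)) \<longlonglongrightarrow> 0"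
proof -
  let ?c = "\<lambda>n. cont_rep \<Omega> (w n)"
  let ?d = "\<lambda>u n z. u z + bc_of_complex (-1) \<odot> w n z"
  have w2: "w n \<in> L2 M" "w n \<in> borel_measurable M" for n using w[of n] by (auto simp: A2_iff L2_def)
  have conv: "convergent (\<lambda>n. ?c n z)" if z: "z \<in> \<Omega>" for z
  proof -
    obtain K where K: "\<And>W. W \<in> A2 \<Longrightarrow> norm (cont_rep \<Omega> W z) \<le> K * sqrt (sq W)"
      using cont_rep_bound[OF z] by blast
    have "Cauchy (\<lambda>n. ?c n z)"
    proof (rule CauchyI)
      fix e :: real assume e: "0 < e"
      \<comment> \<open>Nothing is known about the sign of \<open>K\<close>; a positive constant is
        needed as a divisor.\<close>
      define K' where "K' = \<bar>K\<bar> + 1"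
      have K': "0 < K'" by (simp add: K'_def)
      have "0 < (e / (2 * K'))\<^sup>2" using e by (simp add: K'_def)
      from cau[OF this] obtain n0 where n0: "\<And>m n. n0 \<le> m \<Longrightarrow> n0 \<le> n \<Longrightarrow> L2_sq M (?d (w m) n) \<le> (e / (2 * K'))\<^sup>2" by blast
      show "\<exists>n0. \<forall>m\<ge>n0. \<forall>n\<ge>n0. norm (?c m z - ?c n z) < e"
      proof (intro exI[of _ n0] allI impI)
        fix m n assume mn: "n0 \<le> m" "n0 \<le> n"
        have "?c m z - ?c n z = cont_rep \<Omega> (?d (w m) n) z"
          unfolding cont_rep_add_scale[OF w w z] by (simp add: bc_of_complex_mult prod_eq_iff)
        also have "norm \<dots> \<le> K * sqrt (sq (?d (w m) n))" by (intro K A2_add_scale w)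
        also have "\<dots> \<le> K' * sqrt (sq (?d (w m) n))"
          unfolding sq_eq by (intro mult_right_mono) (auto simp: K'_def L2_sq_nonneg)
        also have "\<dots> \<le> K' * (e / (2 * K'))"
        proof (rule mult_left_mono)
          show "sqrt (sq (?d (w m) n)) \<le> e / (2 * K')"
            unfolding sq_eq by (rule real_le_lsqrt) (use n0[OF mn] e in \<open>auto simp: K'_def\<close>)
        qed (simp add: K'_def)
        also have "\<dots> = e / 2" using K' by simp
        also have "\<dots> < e" using e by simp
        finally show "norm (?c m z - ?c n z) < e" .
      qed
    qed
    then show ?thesis by (rule Cauchy_convergent)
  qed
  define v where "v z = (if z \<in> \<Omega> then lim (\<lambda>n. ?c n z) else 0)" for z
  have lim: "(\<lambda>n. ?c n z) \<longlonglongrightarrow> v z" if "z \<in> \<Omega>" for z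
    using conv[OF that] that by (simp add: v_def convergent_LIMSEQ_iff)
  have vm: "v \<in> borel_measurable M"
    by (rule borel_measurable_LIMSEQ_metric[OF measurable_cont_rep[OF w]]) (use lim in simp)
  have ae: "AE z in M. z \<in> \<Omega> \<and> (\<forall>n. ?c n z = w n z)"
  proof -
    have "AE z in M. \<forall>n. ?c n z = w n z" by (subst AE_all_countable) (intro allI cont_rep w)
    moreover have "AE z in M. z \<in> \<Omega>" using AE_space[of M] by simp
    ultimately show ?thesis by eventually_elim simp
  qed
  have dm: "?d v n \<in> borel_measurable M" for n
    by (intro borel_measurable_add measurable_bc_mult vm w2) simp
  \<comment> \<open>Fatou in \<open>m\<close> with \<open>n\<close> fixed carries the Cauchy
    estimate from \<open>w m - w n\<close> to \<open>v - w n\<close>. It also gives square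
    integrability of that difference, from which that of \<open>v\<close> follows.\<close>
  have fatou: "?d v n \<in> L2 M \<and> L2_sq M (?d v n) \<le> e"
    if e: "0 < e" and n0: "\<And>m n. n0 \<le> m \<Longrightarrow> n0 \<le> n \<Longrightarrow> L2_sq M (?d (w m) n) \<le> e" and n: "n0 \<le> n" for e n0 n
  proof -
    let ?u = "\<lambda>m z. ennreal ((norm (?d (w m) n z))\<^sup>2)"
    have [measurable]: "?d (w m) n \<in> borel_measurable M" for m
      by (intro borel_measurable_add measurable_bc_mult w2) simp
    have um: "?u m \<in> borel_measurable M" for m by measurable
    have "(\<integral>\<^sup>+z. ennreal ((norm (?d v n z))\<^sup>2) \<partial>M) = (\<integral>\<^sup>+z. liminf (\<lambda>m. ?u m z) \<partial>M)"
    proof (rule nn_integral_cong_AE)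
      show "AE z in M. ennreal ((norm (?d v n z))\<^sup>2) = liminf (\<lambda>m. ?u m z)"
        using ae
      proof eventually_elim
        case (elim z)
        have "(\<lambda>m. w m z) \<longlonglongrightarrow> v z" using lim[of z] elim by simp
        then have "(\<lambda>m. ?u m z) \<longlonglongrightarrow> ennreal ((norm (?d v n z))\<^sup>2)"
          by (intro tendsto_ennrealI tendsto_power tendsto_norm tendsto_add tendsto_const)
        then show ?case by (rule lim_imp_Liminf[OF sequentially_bot, symmetric])
      qed
    qed
    also have "\<dots> \<le> liminf (\<lambda>m. \<integral>\<^sup>+z. ?u m z \<partial>M)" by (rule nn_integral_liminf[OF um])
    also have "\<dots> \<le> liminf (\<lambda>m. ennreal e)"
    proof (rule Liminf_mono)
      show "\<forall>\<^sub>F m in sequentially. (\<integral>\<^sup>+z. ?u m z \<partial>M) \<le> ennreal e"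
        using eventually_ge_at_top[of n0]
      proof eventually_elim
        case (elim m)
        have "?d (w m) n \<in> L2 M" by (rule L2_add_scale(1)[OF w2(1) w2(1)])
        then have "(\<integral>\<^sup>+z. ?u m z \<partial>M) = ennreal (L2_sq M (?d (w m) n))"
          unfolding L2_def L2_sq_def by (intro nn_integral_eq_integral) auto
        then show ?case using n0[OF elim n] by (simp add: ennreal_leI)
      qed
    qed
    also have "\<dots> = ennreal e" by (simp add: Liminf_const)
    finally have le: "(\<integral>\<^sup>+z. ennreal ((norm (?d v n z))\<^sup>2) \<partial>M) \<le> ennreal e" .
    have sqm: "(\<lambda>z. (norm (?d v n z))\<^sup>2) \<in> borel_measurable M"
      by (rule measurable_compose[OF dm[of n], where g="\<lambda>x. (norm x)\<^sup>2"]) measurable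
    have int: "integrable M (\<lambda>z. (norm (?d v n z))\<^sup>2)"
    proof (rule integrableI_nonneg)
      show "(\<integral>\<^sup>+z. ennreal ((norm (?d v n z))\<^sup>2) \<partial>M) < \<infinity>" using le by (rule le_less_trans) simp
    qed (use sqm in auto)
    have "ennreal (L2_sq M (?d v n)) \<le> ennreal e"
      using le nn_integral_eq_integral[OF int] by (simp add: L2_sq_def)
    then show ?thesis using int dm e by (simp add: L2_def)
  qed
  have vL: "v \<in> L2 M"
  proof -
    obtain n0 where n0: "\<And>m n. n0 \<le> m \<Longrightarrow> n0 \<le> n \<Longrightarrow> L2_sq M (?d (w m) n) \<le> 1"
      using cau[of 1] by auto
    have "?d v n0 \<in> L2 M" using fatou[of 1 n0 n0] n0 by simp
    from L2_add_scale(1)[OF this w2(1)[of n0], of 1]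
    show ?thesis by (rule back_subst[of "\<lambda>f. f \<in> L2 M"]) (simp add: fun_eq_iff bc_of_complex_mult prod_eq_iff)
  qed
  have lim0: "(\<lambda>n. L2_sq M (?d v n)) \<longlonglongrightarrow> 0"
  proof (rule LIMSEQ_I)
    fix e :: real assume e: "0 < e"
    then obtain n0 where n0: "\<And>m n. n0 \<le> m \<Longrightarrow> n0 \<le> n \<Longrightarrow> L2_sq M (?d (w m) n) \<le> e / 2"
      using cau[of "e / 2"] by auto
    have "L2_sq M (?d v n) \<le> e / 2" if "n0 \<le> n" for n using fatou[of "e / 2" n0 n] n0 that e by simp
    then show "\<exists>n0. \<forall>n\<ge>n0. norm (L2_sq M (?d v n) - 0) < e"
      using e L2_sq_nonneg[of M] by (intro exI[of _ n0]) (force simp: abs_of_nonneg intro: le_less_trans)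
  qed
  show ?thesis using A2_closed[OF w vL lim0] lim0 by blast
qed

text \<open>The functional \<open>g\<close> on bicomplex numbers is left abstract so that scalar and
  vector part are two instances; linearity and contractivity pass to its composition with the point
  evaluation.\<close>

lemma ex_kernel:
  assumes z: "z \<in> \<Omega>" and g: "\<And>U c V. g (U + bc_of_complex c \<odot> V) = g U + c * g V" "\<And>U. cmod (g U) \<le> norm U"
  shows "\<exists>k\<in>A2. \<forall>W\<in>A2. g (cont_rep \<Omega> W z) = L2_inner \<Omega> W k"
proof -
  obtain K where K: "\<And>W. W \<in> A2 \<Longrightarrow> norm (cont_rep \<Omega> W z) \<le> K * sqrt (sq W)"
    using cont_rep_bound[OF z] by blast
  have "\<exists>k\<in>A2. \<forall>W\<in>A2. g (cont_rep \<Omega> W z) = L2_ip M W k"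
  proof (rule Riesz_representation_L2[where K="K\<^sup>2"])
    show "A2 \<subseteq> L2 M" using A2_iff by blast
    have "(\<lambda>z. 0) \<in> A2" by (simp add: A2_iff L2_def defect_def rhs_def bc_cnj_def bc_mult_def zero_prod_def[symmetric])
    then show "A2 \<noteq> {}" by blast
  next
    fix U V c assume UV: "U \<in> A2" "V \<in> A2"
    then show "(\<lambda>z. U z + bc_of_complex c \<odot> V z) \<in> A2" by (rule A2_add_scale)
    show "g (cont_rep \<Omega> (\<lambda>z. U z + bc_of_complex c \<odot> V z) z) = g (cont_rep \<Omega> U z) + c * g (cont_rep \<Omega> V z)"
      unfolding cont_rep_add_scale[OF UV z] g(1) ..
  next
    fix U assume U: "U \<in> A2"
    have "(cmod (g (cont_rep \<Omega> U z)))\<^sup>2 \<le> (K * sqrt (sq U))\<^sup>2"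
      by (intro power_mono order_trans[OF g(2) K[OF U]]) simp
    then show "(cmod (g (cont_rep \<Omega> U z)))\<^sup>2 \<le> K\<^sup>2 * L2_sq M U"
      by (simp add: power_mult_distrib sq_eq L2_sq_nonneg)
  qed (rule A2_complete)
  then show ?thesis by (simp only: L2_inner_eq)
qed

lemma has_bochner_integral_inner:
  assumes W: "W \<in> A2" and k: "k \<in> A2"
  shows "has_bochner_integral M (\<lambda>\<zeta>. bc_inner (cont_rep \<Omega> W \<zeta>) (cont_rep \<Omega> k \<zeta>)) (L2_inner \<Omega> W k)"
proof -
  have Wk: "W \<in> L2 M" "k \<in> L2 M" using W k by (auto simp: A2_iff)
  note i = integrable_bc_inner[OF cont_rep_L2[OF W] cont_rep_L2[OF k]]
  have "(\<integral>\<zeta>. bc_inner (cont_rep \<Omega> W \<zeta>) (cont_rep \<Omega> k \<zeta>) \<partial>M) = L2_inner \<Omega> W k"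
    unfolding L2_inner_def
  proof (rule integral_cong_AE)
    show "AE \<zeta> in M. bc_inner (cont_rep \<Omega> W \<zeta>) (cont_rep \<Omega> k \<zeta>) = bc_inner (W \<zeta>) (k \<zeta>)"
      using cont_rep(2)[OF W] cont_rep(2)[OF k] by eventually_elim simp
  qed (use i integrable_bc_inner[OF Wk] in auto)
  then show ?thesis using i by (simp add: has_bochner_integral_iff)
qed

lemma reproducing:
  assumes KL: "\<And>\<zeta>. \<zeta> \<in> \<Omega> \<Longrightarrow> is_Sc_kernel \<Omega> a b \<zeta> (K \<zeta>)" "\<And>\<zeta>. \<zeta> \<in> \<Omega> \<Longrightarrow> is_Vec_kernel \<Omega> a b \<zeta> (L \<zeta>)"
    and W: "W \<in> A2" and z: "z \<in> \<Omega>"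
  shows "has_bochner_integral M (\<lambda>\<zeta>. bergman_kernel \<Omega> K L (cont_rep \<Omega> W \<zeta>) z \<zeta>) (cont_rep \<Omega> W z)"
proof -
  have KA: "K \<zeta> \<in> A2" "L \<zeta> \<in> A2" if "\<zeta> \<in> \<Omega>" for \<zeta>
    using KL[OF that] by (auto simp: is_Sc_kernel_def is_Vec_kernel_def)
  have Sc: "Sc (cont_rep \<Omega> U \<zeta>) = L2_inner \<Omega> U (K \<zeta>)" and Vec: "Vec (cont_rep \<Omega> U \<zeta>) = L2_inner \<Omega> U (L \<zeta>)"
    if "\<zeta> \<in> \<Omega>" "U \<in> A2" for \<zeta> U
    using KL[OF that(1)] that(2) by (auto simp: is_Sc_kernel_def is_Vec_kernel_def)
  have sym: "L2_inner \<Omega> U V = cnj (L2_inner \<Omega> V U)" for U V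
    unfolding L2_inner_eq by (rule cnj_L2_ip[symmetric])
  let ?W = "cont_rep \<Omega> W"
  have eq: "bergman_kernel \<Omega> K L (?W \<zeta>) z \<zeta>
      = (bc_inner (?W \<zeta>) (cont_rep \<Omega> (K z) \<zeta>), 0) + (0, bc_inner (?W \<zeta>) (cont_rep \<Omega> (L z) \<zeta>))"
    if \<zeta>: "\<zeta> \<in> \<Omega>" for \<zeta>
  proof -
    \<comment> \<open>The components of \<open>K \<zeta>\<close> at \<open>z\<close> are its inner
      products with \<open>K z\<close> and \<open>L z\<close>; conjugated, these are the scalar
      parts of \<open>K z\<close> and \<open>L z\<close> at \<open>\<zeta>\<close>. With the
      analogous identity for \<open>L \<zeta>\<close>, the integrand becomes a pair of inner
      products of \<open>W\<close> with fixed functions.\<close>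
    have "cont_rep \<Omega> (K \<zeta>) z = (cnj (Sc (cont_rep \<Omega> (K z) \<zeta>)), cnj (Sc (cont_rep \<Omega> (L z) \<zeta>)))"
      using Sc[OF z KA(1)[OF \<zeta>]] Vec[OF z KA(1)[OF \<zeta>]] Sc[OF \<zeta> KA(1)[OF z]] Sc[OF \<zeta> KA(2)[OF z]]
        sym[of "K \<zeta>" "K z"] sym[of "K \<zeta>" "L z"] by (simp add: prod_eq_iff)
    moreover have "cont_rep \<Omega> (L \<zeta>) z = (cnj (Vec (cont_rep \<Omega> (K z) \<zeta>)), cnj (Vec (cont_rep \<Omega> (L z) \<zeta>)))"
      using Sc[OF z KA(2)[OF \<zeta>]] Vec[OF z KA(2)[OF \<zeta>]] Vec[OF \<zeta> KA(1)[OF z]] Vec[OF \<zeta> KA(2)[OF z]]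
        sym[of "L \<zeta>" "K z"] sym[of "L \<zeta>" "L z"] by (simp add: prod_eq_iff)
    ultimately show ?thesis by (simp add: bergman_kernel_def bc_of_complex_mult bc_inner_def)
  qed
  have bl: "bounded_linear (\<lambda>x::complex. (x, 0::complex))" "bounded_linear (\<lambda>x::complex. (0::complex, x))"
    by (auto intro!: bounded_linear_Pair bounded_linear_ident bounded_linear_zero)
  have "has_bochner_integral M (\<lambda>\<zeta>. (bc_inner (?W \<zeta>) (cont_rep \<Omega> (K z) \<zeta>), 0) + (0, bc_inner (?W \<zeta>) (cont_rep \<Omega> (L z) \<zeta>)))
      ((L2_inner \<Omega> W (K z), 0) + (0, L2_inner \<Omega> W (L z)))"
    by (intro has_bochner_integral_add has_bochner_integral_bounded_linear[OF bl(1)]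
        has_bochner_integral_bounded_linear[OF bl(2)] has_bochner_integral_inner W KA z)
  moreover have "(L2_inner \<Omega> W (K z), 0) + (0, L2_inner \<Omega> W (L z)) = ?W z"
    using Sc[OF z W] Vec[OF z W] by (simp add: prod_eq_iff)
  ultimately show ?thesis
    by (subst has_bochner_integral_cong[OF refl _ refl]) (use eq in auto)
qed

end

text \<open>\<open>has_bochner_integral\<close> asserts integrability as well, so the formula does
  not rest on the default value of an undefined integral. The universal quantifier over
  \<open>K\<close> and \<open>L\<close> reflects that kernels are determined only up to null
  sets.\<close>

theorem mainTheorem4:
  fixes \<Omega> :: "complex set" and a b :: "complex \<Rightarrow> bicomplex"
  assumes "open \<Omega>" and "connected \<Omega>" and "simply_connected \<Omega>" and "bounded \<Omega>"
    and "a \<in> bc_space (Linf_space \<Omega>)" and "b \<in> bc_space (Linf_space \<Omega>)"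
  shows "(\<forall>z\<in>\<Omega>. \<exists>Kz Lz. is_Sc_kernel \<Omega> a b z Kz \<and> is_Vec_kernel \<Omega> a b z Lz) \<and>
    (\<forall>K L. (\<forall>\<zeta>\<in>\<Omega>. is_Sc_kernel \<Omega> a b \<zeta> (K \<zeta>) \<and> is_Vec_kernel \<Omega> a b \<zeta> (L \<zeta>)) \<longrightarrow>
      (\<forall>W\<in>vekua_bergman \<Omega> a b. \<forall>z\<in>\<Omega>.
         has_bochner_integral (lebesgue_on \<Omega>)
           (\<lambda>\<zeta>. bergman_kernel \<Omega> K L (cont_rep \<Omega> W \<zeta>) z \<zeta>) (cont_rep \<Omega> W z)))"
proof -
  interpret vekua_domain \<Omega> a b by standard (use assms in auto)
  have "\<exists>Kz Lz. is_Sc_kernel \<Omega> a b z Kz \<and> is_Vec_kernel \<Omega> a b z Lz" if z: "z \<in> \<Omega>" for z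
  proof -
    have "\<exists>k\<in>A2. \<forall>W\<in>A2. Sc (cont_rep \<Omega> W z) = L2_inner \<Omega> W k"
      by (rule ex_kernel[OF z]) (auto simp: bc_of_complex_mult norm_fst_le)
    moreover have "\<exists>l\<in>A2. \<forall>W\<in>A2. Vec (cont_rep \<Omega> W z) = L2_inner \<Omega> W l"
      by (rule ex_kernel[OF z]) (auto simp: bc_of_complex_mult norm_snd_le)
    ultimately show ?thesis unfolding is_Sc_kernel_def is_Vec_kernel_def by blast
  qed
  then show ?thesis using reproducing by blast
qed

end
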